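(* Let $A=kQ/I$ be a bound quiver algebra, where $Q$ is a finite quiver, $I$ an admissible ideal of the path algebra $kQ$ and $k$ a field. Assume that $kQ/I$ is given a connective dg algebra structure concentrated in degrees $-d$ to $0$. If $Q$ has no oriented cycles, then $$\mathrm{gl.dim}\,kQ/I\leq l(d+1),$$ where $l$ is the maximal length of a path in $Q$ and $\mathrm{gl.dim}\,kQ/I$ denotes the global dimension of $kQ/I$ as a connective dg algebra.
   Context: Modules are right dg modules. A dg algebra $A$ is connective if $H^n(A)=0$ for all $n>0$. For $A$ connective, let $\mathcal{H}=\{x\in\mathsf{D}(A): H^n(x)=0\ \forall n\neq0\}\simeq \mathrm{Mod}\text{-}H^0(A)$ be the heart of the standard t-structure of $\mathsf{D}(A)$. For $x\in\mathsf{D}(A)$, $\mathrm{pdim}_Ax$ is the infimum of those $n\in\mathbb{Z}\cup\{\pm\infty\}$ with $\mathrm{Hom}_{\mathsf{D}(A)}(x,y[i])=0$ for all $i>n$ and all $y\in\mathcal{H}$. The global dimension of the connective dg algebra $A$ is $\mathrm{gl.dim}\,A=\sup\{\mathrm{pdim}_Ax:x\in\mathcal{H}\}$. "$kQ/I$ is given a connective dg algebra structure concentrated in degrees $-d$ to $0$" means that the $k$-algebra $kQ/I$ is equipped with a grading $A=\bigoplus_{j=-d}^{0}A^j$ and a differential of degree $1$ making it a dg $k$-algebra. *)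

theory Defs
  imports
    "HOL-Algebra.Algebra"
    "HOL-Library.Extended_Real"
    "HOL-Library.Equipollence"
    "Graph_Theory.Arc_Walk"
begin

section \<open>Bound quiver algebras\<close>

text \<open>
  Quivers are multidigraphs with loops, i.e. records of type \<^typ>\<open>('v, 'e) pre_digraph\<close>; they are
  finite if they satisfy \<^locale>\<open>fin_digraph\<close>. A path is a pair \<open>(u, p)\<close> of its source \<open>u\<close> and its
  list of arrows \<open>p\<close>, so that \<open>(u, [])\<close> is the trivial path at \<open>u\<close>. An element of the path algebra is
  its coefficient function. The product of two paths is their concatenation, read from left to
  right, hence the coefficient of a product at a path is a sum over the ways to cut the path in two.
\<close>

definition quiver_paths :: "('v, 'e) pre_digraph \<Rightarrow> ('v \<times> 'e list) set" where
  "quiver_paths Q = {(u, p). \<exists>v. pre_digraph.awalk Q u p v}"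

definition path_target :: "('v, 'e) pre_digraph \<Rightarrow> 'v \<Rightarrow> 'e list \<Rightarrow> 'v" where
  "path_target Q u p = last (pre_digraph.awalk_verts Q u p)"

definition max_path_length :: "('v, 'e) pre_digraph \<Rightarrow> nat" where
  "max_path_length Q = Max ((\<lambda>(u, p). length p) ` quiver_paths Q)"

definition path_algebra ::
  "('v, 'e) pre_digraph \<Rightarrow> ('k::field, 'v \<times> 'e list \<Rightarrow> 'k) module" where
  "path_algebra Q =
    \<lparr>carrier = {f. finite {x. f x \<noteq> 0} \<and> {x. f x \<noteq> 0} \<subseteq> quiver_paths Q},
     monoid.mult = (\<lambda>f g (u, p).
       \<Sum>i\<le>length p. f (u, take i p) * g (path_target Q u (take i p), drop i p)),
     one = (\<lambda>(u, p). if u \<in> verts Q \<and> p = [] then 1 else 0),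
     ring.zero = (\<lambda>_. 0),
     add = (\<lambda>f g x. f x + g x),
     module.smult = (\<lambda>c f x. c * f x)\<rparr>"

definition arrow_ideal :: "('v, 'e) pre_digraph \<Rightarrow> ('v \<times> 'e list \<Rightarrow> 'k::field) set" where
  "arrow_ideal Q = Idl\<^bsub>path_algebra Q\<^esub>
    ((\<lambda>e x. if x = (tail Q e, [e]) then 1 else 0) ` arcs Q)"

primrec ideal_power :: "('a, 'x) ring_scheme \<Rightarrow> 'a set \<Rightarrow> nat \<Rightarrow> 'a set" where
  "ideal_power R J 0 = carrier R"
| "ideal_power R J (Suc n) = ideal_prod R (ideal_power R J n) J"

definition admissible_ideal ::
  "('v, 'e) pre_digraph \<Rightarrow> ('v \<times> 'e list \<Rightarrow> 'k::field) set \<Rightarrow> bool" where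
  "admissible_ideal Q I \<longleftrightarrow> ideal I (path_algebra Q) \<and>
    (\<exists>m\<ge>2. ideal_power (path_algebra Q) (arrow_ideal Q) m \<subseteq> I) \<and>
    I \<subseteq> ideal_power (path_algebra Q) (arrow_ideal Q) 2"

definition quotient_algebra :: "('k, 'a) module \<Rightarrow> 'a set \<Rightarrow> ('k, 'a set) module" where
  "quotient_algebra R I = ring.extend (R Quot I)
    (module.fields (\<lambda>c S. \<Union>x\<in>S. I +>\<^bsub>R\<^esub> (c \<odot>\<^bsub>R\<^esub> x)))"

definition bound_quiver_algebra ::
  "('v, 'e) pre_digraph \<Rightarrow> ('v \<times> 'e list \<Rightarrow> 'k::field) set
    \<Rightarrow> ('k, ('v \<times> 'e list \<Rightarrow> 'k) set) module" where
  "bound_quiver_algebra Q I = quotient_algebra (path_algebra Q) I"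


section \<open>Cochain complexes\<close>

text \<open>
  Only the additive structure of the rings \<open>part C n\<close> is ever used: their multiplication and unit
  carry no information.
\<close>

record 'm cochain =
  part :: "int \<Rightarrow> 'm ring"
  dif :: "int \<Rightarrow> 'm \<Rightarrow> 'm"

definition cocycles :: "('m, 'x) cochain_scheme \<Rightarrow> int \<Rightarrow> 'm set" where
  "cocycles C n = a_kernel (part C n) (part C (n + 1)) (dif C n)"

definition coboundaries :: "('m, 'x) cochain_scheme \<Rightarrow> int \<Rightarrow> 'm set" where
  "coboundaries C n = dif C (n - 1) ` carrier (part C (n - 1))"

definition cohomology :: "('m, 'x) cochain_scheme \<Rightarrow> int \<Rightarrow> 'm set monoid" where
  "cohomology C n = (add_monoid (part C n))\<lparr>carrier := cocycles C n\<rparr> Mod coboundaries C n"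

text \<open>The map induced on cohomology sends the class of \<open>x\<close> to the class of \<open>f n x\<close>.\<close>

definition cohomology_map ::
  "('m, 'x) cochain_scheme \<Rightarrow> (int \<Rightarrow> 'm \<Rightarrow> 'm) \<Rightarrow> int \<Rightarrow> 'm set \<Rightarrow> 'm set" where
  "cohomology_map D f n S = (\<Union>x\<in>S. coboundaries D n +>\<^bsub>part D n\<^esub> f n x)"

definition quasi_iso ::
  "('m, 'x) cochain_scheme \<Rightarrow> ('m, 'x) cochain_scheme \<Rightarrow> (int \<Rightarrow> 'm \<Rightarrow> 'm) \<Rightarrow> bool" where
  "quasi_iso C D f \<longleftrightarrow> (\<forall>n. cohomology_map D f n \<in> iso (cohomology C n) (cohomology D n))"

definition koszul_sign :: "('m, 'x) ring_scheme \<Rightarrow> int \<Rightarrow> 'm \<Rightarrow> 'm" where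
  "koszul_sign G n x = (if even n then x else \<ominus>\<^bsub>G\<^esub> x)"


section \<open>Dg algebras\<close>

definition scalar_ring :: "'k::field ring" where
  "scalar_ring =
    \<lparr>carrier = UNIV, monoid.mult = (*), one = 1, ring.zero = 0, add = (+)\<rparr>"

record ('k, 'a) dg_algebra = "('k, 'a) module" +
  gr :: "int \<Rightarrow> 'a set"
  adif :: "'a \<Rightarrow> 'a"

locale dg_algebra =
  ring A + vs: Module.module "scalar_ring :: 'k::field ring" A
  for A :: "('k::field, 'a, 'x) dg_algebra_scheme" (structure) +
  assumes smult_mult_left:
      "\<lbrakk>a \<in> carrier A; b \<in> carrier A\<rbrakk> \<Longrightarrow> c \<odot> (a \<otimes> b) = (c \<odot> a) \<otimes> b"
    and smult_mult_right:
      "\<lbrakk>a \<in> carrier A; b \<in> carrier A\<rbrakk> \<Longrightarrow> c \<odot> (a \<otimes> b) = a \<otimes> (c \<odot> b)"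
    and gr_subgroup: "additive_subgroup (gr A n) A"
    and gr_smult: "a \<in> gr A n \<Longrightarrow> c \<odot> a \<in> gr A n"
    and gr_decomposition: "a \<in> carrier A \<Longrightarrow>
      \<exists>!f. (\<forall>n. f n \<in> gr A n) \<and> finite {n. f n \<noteq> \<zero>} \<and> a = finsum A f {n. f n \<noteq> \<zero>}"
    and gr_one: "\<one> \<in> gr A 0"
    and gr_mult: "\<lbrakk>a \<in> gr A i; b \<in> gr A j\<rbrakk> \<Longrightarrow> a \<otimes> b \<in> gr A (i + j)"
    and adif_closed: "a \<in> carrier A \<Longrightarrow> adif A a \<in> carrier A"
    and adif_add: "\<lbrakk>a \<in> carrier A; b \<in> carrier A\<rbrakk> \<Longrightarrow> adif A (a \<oplus> b) = adif A a \<oplus> adif A b"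
    and adif_smult: "a \<in> carrier A \<Longrightarrow> adif A (c \<odot> a) = c \<odot> adif A a"
    and adif_degree: "a \<in> gr A n \<Longrightarrow> adif A a \<in> gr A (n + 1)"
    and adif_adif: "a \<in> carrier A \<Longrightarrow> adif A (adif A a) = \<zero>"
    and adif_mult: "\<lbrakk>a \<in> gr A i; b \<in> gr A j\<rbrakk> \<Longrightarrow>
      adif A (a \<otimes> b) = adif A a \<otimes> b \<oplus> koszul_sign A i (a \<otimes> adif A b)"

definition underlying_complex :: "('k, 'a, 'x) dg_algebra_scheme \<Rightarrow> 'a cochain" where
  "underlying_complex A =
    \<lparr>part = (\<lambda>n. ring.truncate (A\<lparr>carrier := gr A n\<rparr>)), dif = (\<lambda>n. adif A)\<rparr>"

definition connective :: "('k, 'a, 'x) dg_algebra_scheme \<Rightarrow> bool" where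
  "connective A \<longleftrightarrow> (\<forall>n>0. trivial_group (cohomology (underlying_complex A) n))"

definition concentrated_in :: "('k, 'a, 'x) dg_algebra_scheme \<Rightarrow> int set \<Rightarrow> bool" where
  "concentrated_in A S \<longleftrightarrow> (\<forall>n. n \<notin> S \<longrightarrow> gr A n = {\<zero>\<^bsub>A\<^esub>})"


section \<open>Right dg modules\<close>

text \<open>
  Dg modules are externally graded, so the degrees are arguments of the action:
  \<open>act M n j x a\<close> is the product of \<open>x\<close> of degree \<open>n\<close> in \<open>M\<close> with \<open>a\<close> of degree \<open>j\<close> in \<open>A\<close>. The
  vector space structure of a dg module is the action of the multiples of \<open>\<one>\<^bsub>A\<^esub>\<close>; every
  additive map commuting with the action is therefore linear, and so is the differential because
  the multiples of \<open>\<one>\<^bsub>A\<^esub>\<close> are cocycles of degree 0.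
\<close>

record ('a, 'm) dg_module = "'m cochain" +
  act :: "int \<Rightarrow> int \<Rightarrow> 'm \<Rightarrow> 'a \<Rightarrow> 'm"

locale dg_module =
  fixes A :: "('k::field, 'a, 'x) dg_algebra_scheme" and M :: "('a, 'm) dg_module"
  assumes algebra: "dg_algebra A"
    and part_group: "abelian_group (part M n)"
    and act_closed: "\<lbrakk>x \<in> carrier (part M n); a \<in> gr A j\<rbrakk> \<Longrightarrow>
      act M n j x a \<in> carrier (part M (n + j))"
    and act_add_left: "\<lbrakk>x \<in> carrier (part M n); y \<in> carrier (part M n); a \<in> gr A j\<rbrakk> \<Longrightarrow>
      act M n j (x \<oplus>\<^bsub>part M n\<^esub> y) a = act M n j x a \<oplus>\<^bsub>part M (n + j)\<^esub> act M n j y a"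
    and act_add_right: "\<lbrakk>x \<in> carrier (part M n); a \<in> gr A j; b \<in> gr A j\<rbrakk> \<Longrightarrow>
      act M n j x (a \<oplus>\<^bsub>A\<^esub> b) = act M n j x a \<oplus>\<^bsub>part M (n + j)\<^esub> act M n j x b"
    and act_act: "\<lbrakk>x \<in> carrier (part M n); a \<in> gr A i; b \<in> gr A j\<rbrakk> \<Longrightarrow>
      act M (n + i) j (act M n i x a) b = act M n (i + j) x (a \<otimes>\<^bsub>A\<^esub> b)"
    and act_one: "x \<in> carrier (part M n) \<Longrightarrow> act M n 0 x \<one>\<^bsub>A\<^esub> = x"
    and dif_hom: "dif M n \<in> hom (add_monoid (part M n)) (add_monoid (part M (n + 1)))"
    and dif_dif: "x \<in> carrier (part M n) \<Longrightarrow>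
      dif M (n + 1) (dif M n x) = \<zero>\<^bsub>part M (n + 1 + 1)\<^esub>"
    and dif_act: "\<lbrakk>x \<in> carrier (part M n); a \<in> gr A j\<rbrakk> \<Longrightarrow>
      dif M (n + j) (act M n j x a) =
        act M (n + 1) j (dif M n x) a \<oplus>\<^bsub>part M (n + j + 1)\<^esub>
        koszul_sign (part M (n + j + 1)) n (act M n (j + 1) x (adif A a))"

definition dg_hom :: "('k, 'a, 'x) dg_algebra_scheme \<Rightarrow> ('a, 'm) dg_module \<Rightarrow> ('a, 'm) dg_module
    \<Rightarrow> (int \<Rightarrow> 'm \<Rightarrow> 'm) set" where
  "dg_hom A M N = {f. \<forall>n.
    f n \<in> hom (add_monoid (part M n)) (add_monoid (part N n)) \<and>
    (\<forall>x\<in>carrier (part M n). f (n + 1) (dif M n x) = dif N n (f n x)) \<and>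
    (\<forall>x\<in>carrier (part M n). \<forall>j. \<forall>a\<in>gr A j. f (n + j) (act M n j x a) = act N n j (f n x) a)}"

definition homotopic :: "('k, 'a, 'x) dg_algebra_scheme \<Rightarrow> ('a, 'm) dg_module \<Rightarrow> ('a, 'm) dg_module
    \<Rightarrow> (int \<Rightarrow> 'm \<Rightarrow> 'm) \<Rightarrow> (int \<Rightarrow> 'm \<Rightarrow> 'm) \<Rightarrow> bool" where
  "homotopic A M N f g \<longleftrightarrow> (\<exists>h. \<forall>n.
    h n \<in> hom (add_monoid (part M n)) (add_monoid (part N (n - 1))) \<and>
    (\<forall>x\<in>carrier (part M n). \<forall>j. \<forall>a\<in>gr A j.
      h (n + j) (act M n j x a) = act N (n - 1) j (h n x) a) \<and>
    (\<forall>x\<in>carrier (part M n).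
      f n x = g n x \<oplus>\<^bsub>part N n\<^esub> (dif N (n - 1) (h n x) \<oplus>\<^bsub>part N n\<^esub> h (n + 1) (dif M n x))))"

definition shift :: "('a, 'm) dg_module \<Rightarrow> int \<Rightarrow> ('a, 'm) dg_module" where
  "shift M i =
    \<lparr>part = (\<lambda>n. part M (n + i)),
     dif = (\<lambda>n x. koszul_sign (part M (n + 1 + i)) i (dif M (n + i) x)),
     act = (\<lambda>n. act M (n + i))\<rparr>"


section \<open>The derived category\<close>

text \<open>
  The derived category is the localization of the homotopy category of dg modules at the
  quasi-isomorphisms, with morphisms from \<open>M\<close> to \<open>N\<close> the equivalence classes of roofs \<open>(Z, s, f)\<close>,
  \<open>M \<leftarrow> Z \<rightarrow> N\<close>, where \<open>s\<close> is a quasi-isomorphism.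

  The type \<open>'m\<close> is the universe: objects and roofs are the dg modules whose homogeneous elements
  are taken from \<open>'m\<close>. If \<open>'m\<close> is infinite and at least as large as \<open>A\<close>, then each dg module in the
  universe has a semi-free resolution in the universe, and this category is the full subcategory
  of the derived category on the dg modules of cardinality at most that of \<open>'m\<close>. A statement for all
  such \<open>'m\<close> is thus a statement about all dg modules. For \<open>A\<close> finite-dimensional over \<open>'k\<close>, an
  infinite \<open>'m\<close> is large enough as soon as \<open>'k\<close> injects into it.
\<close>

type_synonym ('a, 'm) roof = "('a, 'm) dg_module \<times> (int \<Rightarrow> 'm \<Rightarrow> 'm) \<times> (int \<Rightarrow> 'm \<Rightarrow> 'm)"

definition roofs :: "('k::field, 'a, 'x) dg_algebra_scheme
    \<Rightarrow> ('a, 'm) dg_module \<Rightarrow> ('a, 'm) dg_module \<Rightarrow> ('a, 'm) roof set" where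
  "roofs A M N = {(Z, s, f).
    dg_module A Z \<and> s \<in> dg_hom A Z M \<and> quasi_iso Z M s \<and> f \<in> dg_hom A Z N}"

definition roof_equiv :: "('k::field, 'a, 'x) dg_algebra_scheme
    \<Rightarrow> ('a, 'm) dg_module \<Rightarrow> ('a, 'm) dg_module \<Rightarrow> (('a, 'm) roof \<times> ('a, 'm) roof) set" where
  "roof_equiv A M N = {((Z, s, f), (Z', s', f')).
    (Z, s, f) \<in> roofs A M N \<and> (Z', s', f') \<in> roofs A M N \<and>
    (\<exists>W u v. dg_module A W \<and> u \<in> dg_hom A W Z \<and> v \<in> dg_hom A W Z' \<and>
      quasi_iso W M (\<lambda>n. s n \<circ> u n) \<and>
      homotopic A W M (\<lambda>n. s n \<circ> u n) (\<lambda>n. s' n \<circ> v n) \<and>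
      homotopic A W N (\<lambda>n. f n \<circ> u n) (\<lambda>n. f' n \<circ> v n))}"

definition derived_hom :: "('k::field, 'a, 'x) dg_algebra_scheme
    \<Rightarrow> ('a, 'm) dg_module \<Rightarrow> ('a, 'm) dg_module \<Rightarrow> ('a, 'm) roof set set" where
  "derived_hom A M N = roofs A M N // roof_equiv A M N"

definition derived_zero :: "('k::field, 'a, 'x) dg_algebra_scheme
    \<Rightarrow> ('a, 'm) dg_module \<Rightarrow> ('a, 'm) dg_module \<Rightarrow> ('a, 'm) roof set" where
  "derived_zero A M N = roof_equiv A M N `` {(M, \<lambda>n. id, \<lambda>n x. \<zero>\<^bsub>part N n\<^esub>)}"

definition heart :: "('k::field, 'a, 'x) dg_algebra_scheme \<Rightarrow> ('a, 'm) dg_module set" where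
  "heart A = {M. dg_module A M \<and> (\<forall>n. n \<noteq> 0 \<longrightarrow> trivial_group (cohomology M n))}"

definition pdim :: "('k::field, 'a, 'x) dg_algebra_scheme \<Rightarrow> ('a, 'm) dg_module \<Rightarrow> ereal" where
  "pdim A M = Inf {n. n \<in> {-\<infinity>, \<infinity>} \<union> range (\<lambda>i::int. ereal (of_int i)) \<and>
    (\<forall>i::int. ereal (of_int i) > n \<longrightarrow>
      (\<forall>N\<in>heart A. derived_hom A M (shift N i) = {derived_zero A M (shift N i)}))}"

definition gl_dim :: "'m itself \<Rightarrow> ('k::field, 'a, 'x) dg_algebra_scheme \<Rightarrow> ereal" where
  "gl_dim _ A = Sup (pdim A ` (heart A :: ('a, 'm) dg_module set))"

end

(*
  Write A^0 for the degree 0 part. Since A lives in nonpositive degrees, the projection A -> A^0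
  is a ring homomorphism, so the degree 0 components e_v of the vertex idempotents are again
  orthogonal idempotents, and they are conjugate to the vertex idempotents by a unit in
  1 + A^{<0}. As Q is acyclic, e_v A e_w is therefore zero unless v = w, where it is k e_v, or
  the longest path out of v is longer than the longest path out of w.

  Let M be a dg module without cohomology in negative degrees. Starting from the zero module P,
  attach to P free cells e_v A along a basis of the cohomology of the fiber of P -> M.
  Triangularity makes the fiber's cohomology at the vertices of maximal height disappear, while
  its lowest degree drops by at most d + 1. After l + 1 rounds the fiber is acyclic, and P -> M is
  a resolution with all cells in degrees >= - l (d + 1). By obstruction theory, cell by cell, maps
  out of P lift along quasi-isomorphisms and are null-homotopic if the target has no cohomology
  in degrees >= - l (d + 1); hence all roofs from M to N[i] are equivalent for i > l (d + 1).
*)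

theory Submission
  imports Defs
begin

section \<open>Signs, dg modules and linear maps\<close>

text \<open>The grading and the differential are not tied to the quiver: a vertex idempotent need be
  neither homogeneous nor a cocycle, so the projectives spanned by the vertices are not dg modules
  as they stand. Degree 0 idempotents are cocycles because nothing lives in degree 1; this is why
  the vertex idempotents are replaced by their degree 0 components before any cell is attached.

  The factor is \<open>l\<close> and not \<open>l + 1\<close> although there are
  \<open>l + 1\<close> rounds: the fiber of 0 -> M has cohomology from degree 1 on, and a cell lies
  one degree below the cocycle that it kills, so round k, counted from 0, uses cells of degree at
  least - k (d + 1), and the last round has k = l.

  Two traits of the derived category used here shape the rest. All modules have their elements in
  the fixed type \<open>'m\<close>, while free modules and twisted sums live in larger types, so
  each stage of the resolution is copied back along injections after a count of cardinalities. And a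
  Hom set is a quotient of a set of roofs; no Ext group is computed, but one module P is shown to
  dominate any two roofs at once.\<close>

lemma ex1_unique: "\<lbrakk>\<exists>!x. P x; P a; P b\<rbrakk> \<Longrightarrow> a = b"
  by blast

context abelian_group
begin

lemma koszul_sign_closed [simp, intro]: "x \<in> carrier G \<Longrightarrow> koszul_sign G n x \<in> carrier G"
  by (simp add: koszul_sign_def)

lemma koszul_sign_add:
  "\<lbrakk>x \<in> carrier G; y \<in> carrier G\<rbrakk> \<Longrightarrow> koszul_sign G n (x \<oplus> y) = koszul_sign G n x \<oplus> koszul_sign G n y"
  by (simp add: koszul_sign_def minus_add)

lemma koszul_sign_zero [simp]: "koszul_sign G n \<zero> = \<zero>"
  by (simp add: koszul_sign_def)

lemma koszul_sign_koszul_sign: "x \<in> carrier G \<Longrightarrow> koszul_sign G n (koszul_sign G m x) =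
    koszul_sign G (n + m) x"
  by (simp add: koszul_sign_def)

lemma koszul_sign_self [simp]: "x \<in> carrier G \<Longrightarrow> koszul_sign G n (koszul_sign G n x) = x"
  by (simp add: koszul_sign_def)

lemma koszul_sign_even: "even n \<Longrightarrow> koszul_sign G n x = x"
  by (simp add: koszul_sign_def)

lemma add_eq_zero_iff:
  "\<lbrakk>x \<in> carrier G; y \<in> carrier G\<rbrakk> \<Longrightarrow> x \<oplus> y = \<zero> \<longleftrightarrow> x = \<ominus> y"
  by (metis minus_equality r_neg a_comm minus_minus)

lemma idem_zero: "\<lbrakk>x \<oplus> x = x; x \<in> carrier G\<rbrakk> \<Longrightarrow> x = \<zero>"
  by (simp add: add.l_cancel_one')

lemma add_diff_cancel:
  "\<lbrakk>x \<in> carrier G; y \<in> carrier G\<rbrakk> \<Longrightarrow> x \<oplus> y \<oplus> \<ominus> x = y"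
  by (simp add: a_comm[of x y] a_assoc r_neg)

text \<open>Solves the homotopy equation on a free cell: \<open>x\<close> is the given value,
  \<open>a\<close>, \<open>b\<close>, \<open>c\<close> are the known terms, and the last bracket is
  the differential prescribed for the new homotopy.\<close>

lemma cancel_three:
  assumes "x \<in> carrier G" "a \<in> carrier G" "b \<in> carrier G" "c \<in> carrier G"
  shows "x = a \<oplus> (b \<oplus> (c \<oplus> (x \<oplus> \<ominus> b \<oplus> \<ominus> a \<oplus> \<ominus> c)))"
proof -
  have "x \<oplus> \<ominus> b \<oplus> \<ominus> a \<oplus> \<ominus> c = x \<oplus> \<ominus> (a \<oplus> (b \<oplus> c))"
    using assms by (simp add: minus_add a_ac)
  then have "a \<oplus> (b \<oplus> (c \<oplus> (x \<oplus> \<ominus> b \<oplus> \<ominus> a \<oplus> \<ominus> c))) = (a \<oplus> (b \<oplus> c)) \<oplus> x \<oplus> \<ominus> (a \<oplus> (b \<oplus> c))"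
    using assms by (simp add: a_assoc)
  then show ?thesis using assms by (simp add: add_diff_cancel)
qed

end

section \<open>Additive maps between abelian groups\<close>

lemma hom_addD:
  assumes "f \<in> hom (add_monoid G) (add_monoid H)"
  shows "x \<in> carrier G \<Longrightarrow> f x \<in> carrier H"
    and "\<lbrakk>x \<in> carrier G; y \<in> carrier G\<rbrakk> \<Longrightarrow> f (x \<oplus>\<^bsub>G\<^esub> y) = f x \<oplus>\<^bsub>H\<^esub> f y"
  using assms by (auto simp: hom_def Pi_iff)

lemma hom_addI:
  assumes "\<And>x. x \<in> carrier G \<Longrightarrow> f x \<in> carrier H"
    and "\<And>x y. \<lbrakk>x \<in> carrier G; y \<in> carrier G\<rbrakk> \<Longrightarrow> f (x \<oplus>\<^bsub>G\<^esub> y) = f x \<oplus>\<^bsub>H\<^esub> f y"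
  shows "f \<in> hom (add_monoid G) (add_monoid H)"
  using assms by (auto simp: hom_def Pi_iff)

lemma hom_add_zero:
  assumes "abelian_group G" "abelian_group H" "f \<in> hom (add_monoid G) (add_monoid H)"
  shows "f \<zero>\<^bsub>G\<^esub> = \<zero>\<^bsub>H\<^esub>"
proof -
  interpret G: abelian_group G by fact
  interpret H: abelian_group H by fact
  have "f \<zero>\<^bsub>G\<^esub> \<oplus>\<^bsub>H\<^esub> f \<zero>\<^bsub>G\<^esub> = f \<zero>\<^bsub>G\<^esub>"
    using hom_addD(2)[OF assms(3), of "\<zero>\<^bsub>G\<^esub>" "\<zero>\<^bsub>G\<^esub>"] by simp
  then show ?thesis
    by (metis G.zero_closed H.add.l_cancel_one' H.zero_closed assms(3) hom_addD(1))
qed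

lemma hom_add_minus:
  assumes "abelian_group G" "abelian_group H" "f \<in> hom (add_monoid G) (add_monoid H)"
    and "x \<in> carrier G"
  shows "f (\<ominus>\<^bsub>G\<^esub> x) = \<ominus>\<^bsub>H\<^esub> f x"
proof -
  interpret G: abelian_group G by fact
  interpret H: abelian_group H by fact
  have "f x \<oplus>\<^bsub>H\<^esub> f (\<ominus>\<^bsub>G\<^esub> x) = \<zero>\<^bsub>H\<^esub>"
    using hom_addD(2)[OF assms(3,4) G.a_inv_closed[OF assms(4)]] hom_add_zero[OF assms(1-3)]
        assms(4)
    by (simp add: G.r_neg)
  then show ?thesis
    by (metis G.a_inv_closed H.a_comm H.minus_equality assms(3,4) hom_addD(1))
qed

lemma hom_add_koszul_sign:
  assumes "abelian_group G" "abelian_group H" "f \<in> hom (add_monoid G) (add_monoid H)"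
    and "x \<in> carrier G"
  shows "f (koszul_sign G n x) = koszul_sign H n (f x)"
  using assms by (simp add: koszul_sign_def hom_add_minus)

section \<open>Homogeneous elements and the differential of a dg algebra\<close>

context dg_algebra
begin

lemma gr_zero [simp]: "\<zero> \<in> gr A n"
  by (rule additive_subgroup.zero_closed[OF gr_subgroup])

lemma gr_carrier: "a \<in> gr A n \<Longrightarrow> a \<in> carrier A"
  by (rule additive_subgroup.a_Hcarr[OF gr_subgroup])

lemma gr_add: "\<lbrakk>a \<in> gr A n; b \<in> gr A n\<rbrakk> \<Longrightarrow> a \<oplus> b \<in> gr A n"
  by (rule additive_subgroup.a_closed[OF gr_subgroup])

lemma gr_minus: "a \<in> gr A n \<Longrightarrow> \<ominus> a \<in> gr A n"
  by (rule additive_subgroup.a_inv_closed[OF gr_subgroup])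

lemma adif_zero [simp]: "adif A \<zero> = \<zero>"
proof -
  have "adif A \<zero> \<oplus> adif A \<zero> = adif A \<zero>"
    using adif_add[of \<zero> \<zero>] by simp
  then show ?thesis
    by (rule idem_zero) (simp add: adif_closed)
qed

lemma adif_minus:
  assumes "a \<in> carrier A"
  shows "adif A (\<ominus> a) = \<ominus> adif A a"
proof -
  have "adif A (\<ominus> a) \<oplus> adif A a = \<zero>"
    using adif_add[of "\<ominus> a" a] assms by (simp add: l_neg)
  then show ?thesis
    using assms by (simp add: add_eq_zero_iff adif_closed)
qed

text \<open>Otherwise \<open>a\<close> would have two homogeneous decompositions, one concentrated
  in degree \<open>i\<close> and one in degree \<open>j\<close>.\<close>

lemma gr_disjoint:
  assumes "a \<in> gr A i" "a \<in> gr A j" "i \<noteq> j"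
  shows "a = \<zero>"
proof (rule ccontr)
  assume nz: "a \<noteq> \<zero>"
  let ?P = "\<lambda>f. (\<forall>n. f n \<in> gr A n) \<and> finite {n. f n \<noteq> \<zero>} \<and> a = finsum A f {n. f n \<noteq> \<zero>}"
  have *: "?P (\<lambda>n. if n = m then a else \<zero>)" if "m \<in> {i, j}" for m
  proof -
    have "{n. (if n = m then a else \<zero>) \<noteq> \<zero>} = {m}" using nz by auto
    moreover have "a \<in> carrier A" using assms gr_carrier by blast
    ultimately show ?thesis using that assms by auto
  qed
  have "(\<lambda>n. if n = i then a else \<zero>) = (\<lambda>n. if n = j then a else \<zero>)"
    by (rule ex1_unique[of ?P, OF gr_decomposition[OF gr_carrier[OF assms(1)]] * *]) auto
  then show False using assms(3) nz by metis
qed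

end

section \<open>Arithmetic in a dg module\<close>

context dg_module
begin

sublocale A: dg_algebra A
  by (rule algebra)

sublocale P: abelian_group "part M n" for n
  by (rule part_group)

text \<open>The primed variants take the target degree as a variable with an equation: equal degrees
  occur in syntactically different forms, and the parts they index would not match
  otherwise.\<close>

lemma act_closed':
  "\<lbrakk>x \<in> carrier (part M n); a \<in> gr A j; m = n + j\<rbrakk> \<Longrightarrow> act M n j x a \<in> carrier (part M m)"
  using act_closed by blast

lemma act_hom_left:
  "\<lbrakk>a \<in> gr A j; m = n + j\<rbrakk> \<Longrightarrow> (\<lambda>x. act M n j x a) \<in> hom (add_monoid (part M n)) (add_monoid (part M
      m))"
  by (rule hom_addI) (auto simp: act_closed act_add_left)

lemma act_zero_left: "\<lbrakk>a \<in> gr A j; m = n + j\<rbrakk> \<Longrightarrow> act M n j \<zero>\<^bsub>part M n\<^esub> a = \<zero>\<^bsub>part M m\<^esub>"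
  using hom_add_zero[OF part_group part_group act_hom_left] by blast

lemma act_minus_left: "\<lbrakk>x \<in> carrier (part M n); a \<in> gr A j; m = n + j\<rbrakk> \<Longrightarrow>
    act M n j (\<ominus>\<^bsub>part M n\<^esub> x) a = \<ominus>\<^bsub>part M m\<^esub> act M n j x a"
  using hom_add_minus[OF part_group part_group act_hom_left] by blast

lemma act_ks_left: "\<lbrakk>x \<in> carrier (part M n); a \<in> gr A j; m = n + j\<rbrakk> \<Longrightarrow>
    act M n j (koszul_sign (part M n) i x) a = koszul_sign (part M m) i (act M n j x a)"
  using hom_add_koszul_sign[OF part_group part_group act_hom_left] by blast

lemma act_add_left': "\<lbrakk>x \<in> carrier (part M n); y \<in> carrier (part M n); a \<in> gr A j; m = n + j\<rbrakk> \<Longrightarrow>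
    act M n j (x \<oplus>\<^bsub>part M n\<^esub> y) a = act M n j x a \<oplus>\<^bsub>part M m\<^esub> act M n j y a"
  using act_add_left by blast

lemma act_add_right': "\<lbrakk>x \<in> carrier (part M n); a \<in> gr A j; b \<in> gr A j; m = n + j\<rbrakk> \<Longrightarrow>
    act M n j x (a \<oplus>\<^bsub>A\<^esub> b) = act M n j x a \<oplus>\<^bsub>part M m\<^esub> act M n j x b"
  using act_add_right by blast

lemma act_zero_right:
  assumes "x \<in> carrier (part M n)" "m = n + j"
  shows "act M n j x \<zero>\<^bsub>A\<^esub> = \<zero>\<^bsub>part M m\<^esub>"
proof -
  have "act M n j x \<zero>\<^bsub>A\<^esub> \<oplus>\<^bsub>part M m\<^esub> act M n j x \<zero>\<^bsub>A\<^esub> = act M n j x \<zero>\<^bsub>A\<^esub>"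
    using act_add_right'[OF assms(1) A.gr_zero A.gr_zero assms(2)] by simp
  then show ?thesis
    by (rule P.idem_zero) (rule act_closed'[OF assms(1) A.gr_zero assms(2)])
qed

lemma act_act': "\<lbrakk>x \<in> carrier (part M n); a \<in> gr A i; b \<in> gr A j; m = n + i; r = i + j\<rbrakk> \<Longrightarrow>
      act M m j (act M n i x a) b = act M n r x (a \<otimes>\<^bsub>A\<^esub> b)"
  using act_act by blast

lemma dif_closed [intro]: "x \<in> carrier (part M n) \<Longrightarrow> dif M n x \<in> carrier (part M (n + 1))"
  using hom_addD(1)[OF dif_hom] .

lemma dif_closed': "\<lbrakk>x \<in> carrier (part M n); m = n + 1\<rbrakk> \<Longrightarrow> dif M n x \<in> carrier (part M m)"
  using dif_closed by blast

lemma dif_add: "\<lbrakk>x \<in> carrier (part M n); y \<in> carrier (part M n); m = n + 1\<rbrakk> \<Longrightarrow>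
    dif M n (x \<oplus>\<^bsub>part M n\<^esub> y) = dif M n x \<oplus>\<^bsub>part M m\<^esub> dif M n y"
  using hom_addD(2)[OF dif_hom] by blast

lemma dif_zero: "m = n + 1 \<Longrightarrow> dif M n \<zero>\<^bsub>part M n\<^esub> = \<zero>\<^bsub>part M m\<^esub>"
  using hom_add_zero[OF part_group part_group dif_hom] by blast

lemma dif_minus: "\<lbrakk>x \<in> carrier (part M n); m = n + 1\<rbrakk> \<Longrightarrow>
    dif M n (\<ominus>\<^bsub>part M n\<^esub> x) = \<ominus>\<^bsub>part M m\<^esub> dif M n x"
  using hom_add_minus[OF part_group part_group dif_hom] by blast

lemma dif_koszul_sign: "\<lbrakk>x \<in> carrier (part M n); m = n + 1\<rbrakk> \<Longrightarrow>
    dif M n (koszul_sign (part M n) i x) = koszul_sign (part M m) i (dif M n x)"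
  using hom_add_koszul_sign[OF part_group part_group dif_hom] by blast

lemma dif_dif': "\<lbrakk>x \<in> carrier (part M n); m = n + 1; r = n + 2\<rbrakk> \<Longrightarrow>
    dif M m (dif M n x) = \<zero>\<^bsub>part M r\<^esub>"
  using dif_dif[of x n] by (simp add: add.assoc)

lemma dif_act': "\<lbrakk>x \<in> carrier (part M n); a \<in> gr A j; m = n + j; r = n + j + 1; s = n + 1; i =
    j + 1\<rbrakk> \<Longrightarrow>
    dif M m (act M n j x a) = act M s j (dif M n x) a \<oplus>\<^bsub>part M r\<^esub>
      koszul_sign (part M r) n (act M n i x (adif A a))"
  using dif_act by blast

end

text \<open>Homogeneous maps that need not respect the differential: degree 0 is used for chain
  maps, - 1 for homotopies, 1 for twistings. No sign occurs because the algebra acts on the other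
  side. The two element types may differ, so that maps between a free module and a module over
  \<open>'m\<close> are covered.\<close>

definition lin_map :: "('k::field, 'a, 'x) dg_algebra_scheme \<Rightarrow> ('a, 'm) dg_module \<Rightarrow>
    ('a, 'n) dg_module \<Rightarrow> int \<Rightarrow> (int \<Rightarrow> 'm \<Rightarrow> 'n) \<Rightarrow> bool" where
  "lin_map A M N t f \<longleftrightarrow> (\<forall>n.
    f n \<in> hom (add_monoid (part M n)) (add_monoid (part N (n + t))) \<and>
    (\<forall>x\<in>carrier (part M n). \<forall>j. \<forall>a\<in>gr A j. f (n + j) (act M n j x a) = act N (n + t) j (f n x) a))"

lemma lin_mapI:
  assumes "\<And>n x. x \<in> carrier (part M n) \<Longrightarrow> f n x \<in> carrier (part N (n + t))"
    and "\<And>n x y. \<lbrakk>x \<in> carrier (part M n); y \<in> carrier (part M n)\<rbrakk> \<Longrightarrow>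
      f n (x \<oplus>\<^bsub>part M n\<^esub> y) = f n x \<oplus>\<^bsub>part N (n + t)\<^esub> f n y"
    and "\<And>n x j a. \<lbrakk>x \<in> carrier (part M n); a \<in> gr A j\<rbrakk> \<Longrightarrow>
      f (n + j) (act M n j x a) = act N (n + t) j (f n x) a"
  shows "lin_map A M N t f"
  unfolding lin_map_def using hom_addI[of "part M _" _ "part N (_ + t)"] assms by simp

lemma
  assumes "lin_map A M N t f"
  shows lin_map_hom: "m = n + t \<Longrightarrow> f n \<in> hom (add_monoid (part M n)) (add_monoid (part N m))"
    and lin_map_closed: "\<lbrakk>x \<in> carrier (part M n); m = n + t\<rbrakk> \<Longrightarrow> f n x \<in> carrier (part N m)"
    and lin_map_add: "\<lbrakk>x \<in> carrier (part M n); y \<in> carrier (part M n); m = n + t\<rbrakk> \<Longrightarrow>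
      f n (x \<oplus>\<^bsub>part M n\<^esub> y) = f n x \<oplus>\<^bsub>part N m\<^esub> f n y"
    and lin_map_act: "\<lbrakk>x \<in> carrier (part M n); a \<in> gr A j; m = n + j; r = n + t\<rbrakk> \<Longrightarrow>
      f m (act M n j x a) = act N r j (f n x) a"
proof -
  have *: "f n \<in> hom (add_monoid (part M n)) (add_monoid (part N (n + t)))" for n
    using assms unfolding lin_map_def by blast
  then show "m = n + t \<Longrightarrow> f n \<in> hom (add_monoid (part M n)) (add_monoid (part N m))" by blast
  show "\<lbrakk>x \<in> carrier (part M n); m = n + t\<rbrakk> \<Longrightarrow> f n x \<in> carrier (part N m)"
    using hom_addD(1)[OF *] by blast
  show "\<lbrakk>x \<in> carrier (part M n); y \<in> carrier (part M n); m = n + t\<rbrakk> \<Longrightarrow>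
      f n (x \<oplus>\<^bsub>part M n\<^esub> y) = f n x \<oplus>\<^bsub>part N m\<^esub> f n y"
    using hom_addD(2)[OF *] by blast
  show "\<lbrakk>x \<in> carrier (part M n); a \<in> gr A j; m = n + j; r = n + t\<rbrakk> \<Longrightarrow>
      f m (act M n j x a) = act N r j (f n x) a"
    using assms unfolding lin_map_def by blast
qed

lemma
  assumes "dg_module A M" "dg_module A N" "lin_map A M N t f" "m = n + t"
  shows lin_map_zero: "f n \<zero>\<^bsub>part M n\<^esub> = \<zero>\<^bsub>part N m\<^esub>"
    and lin_map_minus: "x \<in> carrier (part M n) \<Longrightarrow> f n (\<ominus>\<^bsub>part M n\<^esub> x) = \<ominus>\<^bsub>part N m\<^esub> f n x"
    and lin_map_koszul_sign: "x \<in> carrier (part M n) \<Longrightarrow>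
      f n (koszul_sign (part M n) i x) = koszul_sign (part N m) i (f n x)"
  using hom_add_zero[OF dg_module.part_group[OF assms(1)] dg_module.part_group[OF assms(2)]
      lin_map_hom[OF assms(3,4)]]
    hom_add_minus[OF dg_module.part_group[OF assms(1)] dg_module.part_group[OF assms(2)]
        lin_map_hom[OF assms(3,4)]]
    hom_add_koszul_sign[OF dg_module.part_group[OF assms(1)] dg_module.part_group[OF assms(2)]
        lin_map_hom[OF assms(3,4)]]
  by blast+

lemma lin_map_comp:
  assumes f: "lin_map A M N t f" and g: "lin_map A N L s g" and r: "r = t + s"
  shows "lin_map A M L r (\<lambda>n x. g (n + t) (f n x))"
proof (rule lin_mapI, goal_cases)
  case (1 n x)
  then show ?case
    using lin_map_closed[OF g lin_map_closed[OF f]] r by (simp add: add.assoc)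
next
  case (2 n x y)
  then show ?case
    using lin_map_add[OF f, of x n y] lin_map_add[OF g, of "f n x" "n + t" "f n y"]
      lin_map_closed[OF f, of _ n] r by (simp add: add.assoc)
next
  case (3 n x j a)
  then have "g (n + j + t) (act N (n + t) j (f n x) a) = act L (n + r) j (g (n + t) (f n x)) a"
    using r by (intro lin_map_act[OF g]) (auto intro!: lin_map_closed[OF f])
  then show ?case
    using 3 lin_map_act[OF f, of x n a j] by simp
qed

lemma lin_map_plus:
  assumes N: "dg_module A N" and f: "lin_map A M N t f" and g: "lin_map A M N t g"
  shows "lin_map A M N t (\<lambda>n x. f n x \<oplus>\<^bsub>part N (n + t)\<^esub> g n x)"
proof -
  interpret N: dg_module A N by fact
  show ?thesis
  proof (rule lin_mapI, goal_cases)
    case (1 n x)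
    then show ?case using lin_map_closed[OF f] lin_map_closed[OF g] by simp
  next
    case (2 n x y)
    then show ?case
      using lin_map_closed[OF f] lin_map_closed[OF g]
      by (simp add: lin_map_add[OF f] lin_map_add[OF g] N.P.a_ac)
  next
    case (3 n x j a)
    then show ?case
      using lin_map_closed[OF f 3(1)] lin_map_closed[OF g 3(1)]
      by (simp add: lin_map_act[OF f] lin_map_act[OF g] N.act_add_left' ac_simps)
  qed
qed

lemma lin_map_koszul_sign_map:
  assumes N: "dg_module A N" and f: "lin_map A M N t f"
  shows "lin_map A M N t (\<lambda>n x. koszul_sign (part N (n + t)) i (f n x))"
proof -
  interpret N: dg_module A N by fact
  show ?thesis
  proof (rule lin_mapI, goal_cases)
    case (1 n x)
    then show ?case using lin_map_closed[OF f] by simp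
  next
    case (2 n x y)
    then show ?case
      using lin_map_closed[OF f] by (simp add: lin_map_add[OF f] N.P.koszul_sign_add)
  next
    case (3 n x j a)
    then show ?case
      using lin_map_closed[OF f 3(1)]
      by (simp add: lin_map_act[OF f] N.act_ks_left ac_simps)
  qed
qed

text \<open>By the Leibniz rule each of the two composites applied to \<open>x a\<close> yields a
  linear term and a multiple of \<open>f x\<close> acted on by \<open>adif A a\<close>, with signs
  \<open>n + t\<close> and \<open>n\<close>; the sign \<open>t\<close> of the graded commutator
  cancels the latter.\<close>

lemma lin_map_comm:
  assumes M: "dg_module A M" and N: "dg_module A N" and f: "lin_map A M N t f"
  shows "lin_map A M N (t + 1) (\<lambda>n x. dif N (n + t) (f n x) \<ominus>\<^bsub>part N (n + t + 1)\<^esub>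
    koszul_sign (part N (n + t + 1)) t (f (n + 1) (dif M n x)))"
proof -
  interpret M: dg_module A M by fact
  interpret N: dg_module A N by fact
  have c1 [simp]: "dif N (n + t) (f n x) \<in> carrier (part N (n + t + 1))" if "x \<in> carrier (part M n)"
      for n x
    using that by (auto intro!: lin_map_closed[OF f])
  have c2 [simp]: "f (n + 1) (dif M n x) \<in> carrier (part N (n + t + 1))" if "x \<in> carrier (part M n)"
      for n x
    using lin_map_closed[OF f M.dif_closed[OF that]] by (simp add: ac_simps)
  show ?thesis
  proof (rule lin_mapI, goal_cases)
    case (1 n x)
    then show ?case by (simp flip: add.assoc)
  next
    case (2 n x y)
    have [simp]: "f n x \<in> carrier (part N (n + t))" if "x \<in> carrier (part M n)" for x
      using that lin_map_closed[OF f] by blast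
    have "f (n + 1) (dif M n (x \<oplus>\<^bsub>part M n\<^esub> y)) = f (n + 1) (dif M n x) \<oplus>\<^bsub>part N (n + t + 1)\<^esub>
        f (n + 1) (dif M n y)"
      using 2 lin_map_add[OF f, of "dif M n x" "n + 1" "dif M n y" "n + t + 1"]
      by (simp add: M.dif_add[of _ _ _ "n + 1"] M.dif_closed)
    then show ?case
      using 2 by (simp add: lin_map_add[OF f, of _ _ _ "n + t"] N.dif_add[of _ _ _ "n + t + 1"]
          N.P.koszul_sign_add
          N.P.minus_add a_minus_def N.P.a_ac flip: add.assoc)
  next
    case (3 n x j a)
    let ?G = "part N (n + j + t + 1)"
    have fx: "f n x \<in> carrier (part N (n + t))" using 3 lin_map_closed[OF f] by blast
    have da: "adif A a \<in> gr A (j + 1)" using 3 M.A.adif_degree by blast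
    have [simp]: "act N (n + t + 1) j y a \<in> carrier ?G" if "y \<in> carrier (part N (n + t + 1))" for y
      using N.act_closed'[OF that 3(2)] by (simp add: ac_simps)
    have [simp]: "act N (n + t) (j + 1) (f n x) (adif A a) \<in> carrier ?G"
      using N.act_closed'[OF fx da] by (simp add: ac_simps)
    have 1: "dif N (n + j + t) (f (n + j) (act M n j x a)) =
      act N (n + t + 1) j (dif N (n + t) (f n x)) a \<oplus>\<^bsub>?G\<^esub>
      koszul_sign ?G (n + t) (act N (n + t) (j + 1) (f n x) (adif A a))"
      using 3 fx by (simp add: lin_map_act[OF f] N.dif_act'[of _ "n + t" _ _ _ "n + j + t + 1"])
    have a1: "f (n + j + 1) (act M (n + 1) j (dif M n x) a) =
        act N (n + t + 1) j (f (n + 1) (dif M n x)) a"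
      using 3 by (intro lin_map_act[OF f]) auto
    have a2: "f (n + j + 1) (act M n (j + 1) x (adif A a)) =
        act N (n + t) (j + 1) (f n x) (adif A a)"
      using 3 da by (intro lin_map_act[OF f]) auto
    have c3: "act M (n + 1) j (dif M n x) a \<in> carrier (part M (n + j + 1))"
      "act M n (j + 1) x (adif A a) \<in> carrier (part M (n + j + 1))"
      using 3 da by (auto intro!: M.act_closed')
    have "f (n + j + 1) (dif M (n + j) (act M n j x a)) =
      f (n + j + 1) (act M (n + 1) j (dif M n x) a \<oplus>\<^bsub>part M (n + j + 1)\<^esub>
        koszul_sign (part M (n + j + 1)) n (act M n (j + 1) x (adif A a)))"
      using 3 by (simp add: M.dif_act)
    also have "\<dots> = act N (n + t + 1) j (f (n + 1) (dif M n x)) a \<oplus>\<^bsub>?G\<^esub>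
      koszul_sign ?G n (act N (n + t) (j + 1) (f n x) (adif A a))"
      using c3 a1 a2 by (subst lin_map_add[OF f, of _ _ _ "n + j + t + 1"])
        (simp_all add: lin_map_koszul_sign[OF M N f, of "n + j + t + 1"])
    finally have 2: "f (n + j + 1) (dif M (n + j) (act M n j x a)) =
      act N (n + t + 1) j (f (n + 1) (dif M n x)) a \<oplus>\<^bsub>?G\<^esub>
      koszul_sign ?G n (act N (n + t) (j + 1) (f n x) (adif A a))" .
    have 4: "act N (n + t + 1) j (dif N (n + t) (f n x) \<ominus>\<^bsub>part N (n + t + 1)\<^esub>
      koszul_sign (part N (n + t + 1)) t (f (n + 1) (dif M n x))) a =
      act N (n + t + 1) j (dif N (n + t) (f n x)) a \<ominus>\<^bsub>?G\<^esub>
      koszul_sign ?G t (act N (n + t + 1) j (f (n + 1) (dif M n x)) a)"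
      using 3 by (simp add: a_minus_def N.act_add_left'[of _ _ _ _ _ "n + j + t + 1"]
          N.act_minus_left[of _ _ _ _ "n + j + t + 1"] N.act_ks_left[of _ _ _ _ "n + j + t + 1"])
    show ?case
      using 3 unfolding 1 2 by (simp add: N.P.koszul_sign_add N.P.koszul_sign_koszul_sign
          a_minus_def N.P.minus_add 4[unfolded a_minus_def]
        N.P.a_ac N.P.r_neg N.P.r_neg1 N.P.r_neg2 add.commute[of t n] flip: add.assoc)
  qed
qed

text \<open>The counterpart of \<open>dg_hom\<close> for modules with different element types; see
  \<open>dg_hom_iff_chain_map\<close>.\<close>

definition chain_map :: "('k::field, 'a, 'x) dg_algebra_scheme \<Rightarrow> ('a, 'm) dg_module \<Rightarrow>
    ('a, 'n) dg_module \<Rightarrow> (int \<Rightarrow> 'm \<Rightarrow> 'n) \<Rightarrow> bool" where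
  "chain_map A M N f \<longleftrightarrow> lin_map A M N 0 f \<and>
    (\<forall>n. \<forall>x\<in>carrier (part M n). f (n + 1) (dif M n x) = dif N n (f n x))"

section \<open>Twisted sums, lifting and transport of structure\<close>

lemma chain_map_dif:
  "\<lbrakk>chain_map A M N f; x \<in> carrier (part M n); m = n + 1\<rbrakk> \<Longrightarrow> f m (dif M n x) = dif N n (f n x)"
  unfolding chain_map_def by blast

lemma chain_map_lin: "chain_map A M N f \<Longrightarrow> lin_map A M N 0 f"
  unfolding chain_map_def by blast

lemma chain_map_closed:
  "\<lbrakk>chain_map A M N f; x \<in> carrier (part M n)\<rbrakk> \<Longrightarrow> f n x \<in> carrier (part N n)"
  by (rule lin_map_closed[OF chain_map_lin]) auto

lemma chain_map_comp:
  assumes f: "chain_map A M N f" and g: "chain_map A N L g"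
  shows "chain_map A M L (\<lambda>n x. g n (f n x))"
  using lin_map_comp[OF chain_map_lin[OF f] chain_map_lin[OF g], of 0]
    chain_map_closed[OF f] chain_map_dif[OF f] chain_map_dif[OF g]
  unfolding chain_map_def by simp

section \<open>Zero modules and shifts\<close>

definition zero_module :: "'m \<Rightarrow> ('a, 'm) dg_module" where
  "zero_module z = \<lparr>part = (\<lambda>_. \<lparr>carrier = {z}, monoid.mult = (\<lambda>_ _. z), one = z, ring.zero =
      z, add = (\<lambda>_ _. z)\<rparr>),
    dif = (\<lambda>_ _. z), act = (\<lambda>_ _ _ _. z)\<rparr>"

lemma zero_module_simps [simp]:
  "carrier (part (zero_module z) n) = {z}" "dif (zero_module z) n x = z"
  "act (zero_module z) n j x a = z" "\<zero>\<^bsub>part (zero_module z) n\<^esub> = z"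
  "x \<oplus>\<^bsub>part (zero_module z) n\<^esub> y = z"
  by (simp_all add: zero_module_def)

lemma zero_module_group: "abelian_group (part (zero_module z) n)"
  by (rule abelian_groupI) auto

lemma zero_module_koszul_sign [simp]: "koszul_sign (part (zero_module z) n) i z = z"
  using abelian_group.koszul_sign_zero[OF zero_module_group[of z n], of i] by simp

lemma zero_module_dg_module:
  assumes "dg_algebra A"
  shows "dg_module A (zero_module z)"
  by (rule dg_module.intro) (auto simp: assms zero_module_group hom_def)

lemma zero_lin_map:
  assumes "dg_module A M" "dg_module A N"
  shows "lin_map A M N t (\<lambda>n x. \<zero>\<^bsub>part N (n + t)\<^esub>)"
proof -
  interpret N: dg_module A N by fact
  show ?thesis
    by (rule lin_mapI) (auto simp: N.act_zero_left ac_simps)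
qed

lemma zero_chain_map:
  assumes "dg_module A M" "dg_module A N"
  shows "chain_map A M N (\<lambda>n x. \<zero>\<^bsub>part N n\<^esub>)"
  unfolding chain_map_def using zero_lin_map[OF assms, of 0] dg_module.dif_zero[OF assms(2)] by simp

lemma zero_chain_map_from:
  assumes "dg_module A N"
  shows "lin_map A (zero_module z) N t f \<Longrightarrow> f n z = \<zero>\<^bsub>part N (n + t)\<^esub>"
  using lin_map_zero[OF zero_module_dg_module[OF dg_module.algebra[OF assms]] assms, of z t f
      "n + t" n]
  by simp

lemma shift_simps [simp]:
  "part (shift M i) n = part M (n + i)"
  "dif (shift M i) n x = koszul_sign (part M (n + 1 + i)) i (dif M (n + i) x)"
  "act (shift M i) n = act M (n + i)"
  by (simp_all add: shift_def)

lemma shift_dg_module: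
  assumes "dg_module A M"
  shows "dg_module A (shift M i)"
proof -
  interpret M: dg_module A M by fact
  show ?thesis
  proof (rule dg_module.intro, goal_cases)
    case 1 show ?case by (rule M.algebra)
  next
    case (2 n) show ?case by (simp add: M.part_group)
  next
    case (3 x n a j) then show ?case by (auto intro: M.act_closed')
  next
    case (4 x n y a j) then show ?case by (simp add: M.act_add_left'[of _ _ _ _ _ "n + j + i"])
  next
    case (5 x n a j b) then show ?case by (simp add: M.act_add_right'[of _ _ _ _ _ "n + j + i"])
  next
    case (6 x n a i b j) then show ?case by (simp add: M.act_act')
  next
    case (7 x n) then show ?case by (simp add: M.act_one)
  next
    case (8 n) show ?case
      by (rule hom_addI) (auto intro: M.dif_closed' simp: M.dif_add[of _ _ _ "n + 1 + i"]
          M.P.koszul_sign_add M.dif_closed')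
  next
    case (9 x n) then show ?case
      by (simp add: M.dif_koszul_sign[of _ "n + 1 + i" "n + 1 + 1 + i"] M.dif_closed'
          M.dif_dif'[of _ "n + i" "n + 1 + i" "n + 1 + 1 + i"])
  next
    case (10 x n a j)
    have a': "adif A a \<in> gr A (j + 1)" using 10 M.A.adif_degree by blast
    have c: "act M (n + i + 1) j (dif M (n + i) x) a \<in> carrier (part M (n + j + 1 + i))"
      "act M (n + i) (j + 1) x (adif A a) \<in> carrier (part M (n + j + 1 + i))"
      using 10 a' by (auto intro!: M.act_closed')
    \<comment> \<open>Leibniz in \<open>M\<close> takes place in degree \<open>n + i\<close> and
      gives the sign \<open>n + i\<close>; multiplied with the sign \<open>i\<close> of the shifted
      differential, this is the sign \<open>n\<close> required in the shift.\<close>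
    have "dif M (n + j + i) (act M (n + i) j x a) =
      act M (n + i + 1) j (dif M (n + i) x) a \<oplus>\<^bsub>part M (n + j + 1 + i)\<^esub>
      koszul_sign (part M (n + j + 1 + i)) (n + i) (act M (n + i) (j + 1) x (adif A a))"
      using 10 by (intro M.dif_act') auto
    moreover have "act M (n + 1 + i) j (koszul_sign (part M (n + 1 + i)) i (dif M (n + i) x)) a
      = koszul_sign (part M (n + j + 1 + i)) i (act M (n + i + 1) j (dif M (n + i) x) a)"
      using 10 M.act_ks_left[of "dif M (n + i) x" "n + 1 + i" a j "n + j + 1 + i" i]
      by (simp add: M.dif_closed' ac_simps)
    ultimately show ?case
      using c by (simp add: M.P.koszul_sign_add) (simp add: koszul_sign_def)
  qed
qed

section \<open>Direct products and twisted sums\<close>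

lemma RDirProd_simps [simp]:
  "carrier (RDirProd R S) = carrier R \<times> carrier S"
  "\<zero>\<^bsub>RDirProd R S\<^esub> = (\<zero>\<^bsub>R\<^esub>, \<zero>\<^bsub>S\<^esub>)"
  "(x, y) \<oplus>\<^bsub>RDirProd R S\<^esub> (x', y') = (x \<oplus>\<^bsub>R\<^esub> x', y \<oplus>\<^bsub>S\<^esub> y')"
  by (simp_all add: RDirProd_def DirProd_def monoid.defs)

lemma RDirProd_abelian_group:
  assumes "abelian_group R" "abelian_group S"
  shows "abelian_group (RDirProd R S)"
proof -
  interpret R: abelian_group R by fact
  interpret S: abelian_group S by fact
  show ?thesis
    by (rule abelian_groupI)
      (auto simp: R.a_ac S.a_ac intro!: bexI[of _ "(\<ominus>\<^bsub>R\<^esub> _, \<ominus>\<^bsub>S\<^esub> _)"] simp: R.l_neg S.l_neg)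
qed

lemma RDirProd_minus [simp]:
  assumes "abelian_group R" "abelian_group S" "x \<in> carrier R" "y \<in> carrier S"
  shows "\<ominus>\<^bsub>RDirProd R S\<^esub> (x, y) = (\<ominus>\<^bsub>R\<^esub> x, \<ominus>\<^bsub>S\<^esub> y)"
proof -
  interpret R: abelian_group R by fact
  interpret S: abelian_group S by fact
  interpret RS: abelian_group "RDirProd R S" by (rule RDirProd_abelian_group) fact+
  show ?thesis
    using assms by (intro RS.minus_equality) (auto simp: R.l_neg S.l_neg)
qed

lemma RDirProd_koszul_sign:
  assumes "abelian_group R" "abelian_group S" "x \<in> carrier R" "y \<in> carrier S"
  shows "koszul_sign (RDirProd R S) n (x, y) = (koszul_sign R n x, koszul_sign S n y)"
  using assms by (simp add: koszul_sign_def)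

text \<open>The equation says that the cross term in the square of the twisted differential
  vanishes, a Maurer-Cartan condition.\<close>

definition twisting :: "('k::field, 'a, 'x) dg_algebra_scheme \<Rightarrow> ('a, 'f) dg_module \<Rightarrow>
    ('a, 'p) dg_module \<Rightarrow> (int \<Rightarrow> 'f \<Rightarrow> 'p) \<Rightarrow> bool" where
  "twisting A F P \<psi> \<longleftrightarrow> lin_map A F P 1 \<psi> \<and>
    (\<forall>n. \<forall>x\<in>carrier (part F n). dif P (n + 1) (\<psi> n x) = \<ominus>\<^bsub>part P (n + 1 + 1)\<^esub>
        \<psi> (n + 1) (dif F n x))"

text \<open>The cone of the chain map \<open>\<psi>\<close> from the shift of \<open>F\<close> by \<open>- 1\<close> to \<open>P\<close>.\<close>

definition twisted_sum :: "('a, 'p) dg_module \<Rightarrow> ('a, 'f) dg_module \<Rightarrow> (int \<Rightarrow> 'f \<Rightarrow> 'p) \<Rightarrow>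
    ('a, 'p \<times> 'f) dg_module" where
  "twisted_sum P F \<psi> = \<lparr>part = (\<lambda>n. RDirProd (part P n) (part F n)),
    dif = (\<lambda>n (p, f). (dif P n p \<oplus>\<^bsub>part P (n + 1)\<^esub> \<psi> n f, dif F n f)),
    act = (\<lambda>n j (p, f) a. (act P n j p a, act F n j f a))\<rparr>"

lemma twisted_sum_simps [simp]:
  "part (twisted_sum P F \<psi>) n = RDirProd (part P n) (part F n)"
  "dif (twisted_sum P F \<psi>) n (p, f) = (dif P n p \<oplus>\<^bsub>part P (n + 1)\<^esub> \<psi> n f, dif F n f)"
  "act (twisted_sum P F \<psi>) n j (p, f) a = (act P n j p a, act F n j f a)"
  by (simp_all add: twisted_sum_def)

lemma twisted_sum_dg_module:
  assumes "dg_module A P" "dg_module A F" "twisting A F P \<psi>"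
  shows "dg_module A (twisted_sum P F \<psi>)"
proof -
  interpret P: dg_module A P by fact
  interpret F: dg_module A F by fact
  have lin: "lin_map A F P 1 \<psi>" and
    tw: "\<And>n x. x \<in> carrier (part F n) \<Longrightarrow> dif P (n + 1) (\<psi> n x) = \<ominus>\<^bsub>part P (n + 1 + 1)\<^esub>
        \<psi> (n + 1) (dif F n x)"
    using assms(3) unfolding twisting_def by auto
  note [simp] = P.part_group F.part_group
  have cl [simp]: "\<psi> n x \<in> carrier (part P (n + 1))" if "x \<in> carrier (part F n)" for n x
    using lin_map_closed[OF lin that] by simp
  show ?thesis
  proof (rule dg_module.intro, goal_cases)
    case 1 show ?case by (rule P.algebra)
  next
    case (2 n) show ?case by (simp add: RDirProd_abelian_group)
  next
    case (3 x n a j) then show ?case by (auto intro: P.act_closed F.act_closed)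
  next
    case (4 x n y a j) then show ?case by (auto simp: P.act_add_left F.act_add_left)
  next
    case (5 x n a j b) then show ?case by (auto simp: P.act_add_right F.act_add_right)
  next
    case (6 x n a i b j) then show ?case by (auto simp: P.act_act F.act_act)
  next
    case (7 x n) then show ?case by (auto simp: P.act_one F.act_one)
  next
    case (8 n) show ?case
      by (rule hom_addI)
        (auto simp: P.dif_add[of _ _ _ "n + 1"] F.dif_add[of _ _ _ "n + 1"] P.dif_closed
            F.dif_closed lin_map_add[OF lin, of _ _ _ "n + 1"] P.P.a_ac)
  next
    case (9 x n)
    have [simp]: "\<psi> (n + 1) (dif F n y) \<in> carrier (part P (2 + n))" if "y \<in> carrier (part F n)"
        for y
      using cl[OF F.dif_closed[OF that]] by simp
    from 9 show ?case
      by (auto simp: P.dif_add[of _ _ _ "n + 1 + 1"] P.dif_closed F.dif_closed P.dif_dif F.dif_dif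
          tw P.P.l_neg)
  next
    case (10 x n a j)
    then obtain p f where x: "x = (p, f)" and p: "p \<in> carrier (part P n)"
        and f: "f \<in> carrier (part F n)"
      by auto
    have a': "adif A a \<in> gr A (j + 1)" using 10 P.A.adif_degree by blast
    have c: "act P (n + 1) j (dif P n p) a \<in> carrier (part P (n + j + 1))"
      "act P (n + 1) j (\<psi> n f) a \<in> carrier (part P (n + j + 1))"
      "act P n (j + 1) p (adif A a) \<in> carrier (part P (n + j + 1))"
      "act F n (j + 1) f (adif A a) \<in> carrier (part F (n + j + 1))"
      using 10 a' p f by (auto intro!: P.act_closed' F.act_closed' P.dif_closed)
    show ?case
      using 10 p f c
      by (simp add: x RDirProd_koszul_sign P.dif_act F.dif_act P.act_add_left'[of _ _ _ _ _ "n + j +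
          1"]
          lin_map_act[OF lin, of f n a j "n + j" "n + 1"] P.P.a_ac P.dif_closed)
  qed
qed

lemma twisted_sum_inl:
  assumes "dg_module A P" "dg_module A F" "twisting A F P \<psi>"
  shows "chain_map A P (twisted_sum P F \<psi>) (\<lambda>n p. (p, \<zero>\<^bsub>part F n\<^esub>))"
proof -
  interpret P: dg_module A P by fact
  interpret F: dg_module A F by fact
  have lin: "lin_map A F P 1 \<psi>" using assms(3) unfolding twisting_def by auto
  have [simp]: "\<psi> n \<zero>\<^bsub>part F n\<^esub> = \<zero>\<^bsub>part P (n + 1)\<^esub>" for n
    using lin_map_zero[OF assms(2,1) lin] by simp
  show ?thesis
    unfolding chain_map_def
    by (auto intro!: lin_mapI simp: F.act_zero_left P.dif_closed F.dif_zero)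
qed

lemma twisted_sum_inr:
  assumes "dg_module A P" "dg_module A F"
  shows "lin_map A F (twisted_sum P F \<psi>) 0 (\<lambda>n f. (\<zero>\<^bsub>part P n\<^esub>, f))"
proof -
  interpret P: dg_module A P by fact
  interpret F: dg_module A F by fact
  show ?thesis
    by (auto intro!: lin_mapI simp: P.act_zero_left)
qed

text \<open>Linear only: \<open>\<psi>\<close> enters the first component of the differential, so
  \<open>fst\<close> is in general no chain map.\<close>

lemma twisted_sum_fst:
  shows "lin_map A (twisted_sum P F \<psi>) P 0 (\<lambda>n. fst)"
    and "lin_map A (twisted_sum P F \<psi>) F 0 (\<lambda>n. snd)"
  by (auto intro!: lin_mapI)

lemma twisted_sum_case:
  assumes "dg_module A Y" and "lin_map A P Y r f" and "lin_map A F Y r g"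
  shows "lin_map A (twisted_sum P F \<psi>) Y r
    (\<lambda>n z. f n (fst z) \<oplus>\<^bsub>part Y (n + r)\<^esub> g n (snd z))"
  using lin_map_plus[OF assms(1) lin_map_comp[OF twisted_sum_fst(1) assms(2)]
      lin_map_comp[OF twisted_sum_fst(2) assms(3)]]
  by simp

text \<open>The cohomology of the cone of \<open>s\<close> vanishes in degree \<open>n\<close>.\<close>

definition rel_exact :: "('a, 'z) dg_module \<Rightarrow> ('a, 'y) dg_module \<Rightarrow> (int \<Rightarrow> 'z \<Rightarrow> 'y) \<Rightarrow> int \<Rightarrow> bool"
    where
  "rel_exact Z Y s n \<longleftrightarrow> (\<forall>x\<in>carrier (part Y n). \<forall>z\<in>carrier (part Z (n + 1)).
    dif Z (n + 1) z = \<zero>\<^bsub>part Z (n + 1 + 1)\<^esub> \<and> s (n + 1) z = dif Y n x \<longrightarrow>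
    (\<exists>z'\<in>carrier (part Z n). \<exists>x'\<in>carrier (part Y (n - 1)).
      z = dif Z n z' \<and> x = s n z' \<oplus>\<^bsub>part Y n\<^esub> dif Y (n - 1) x'))"

text \<open>For \<open>Z = 0\<close> this says that all chain maps from \<open>P\<close> to \<open>Y\<close> are null-homotopic.\<close>

definition lifts :: "('k::field, 'a, 'x) dg_algebra_scheme \<Rightarrow> ('a, 'p) dg_module \<Rightarrow>
    ('a, 'z) dg_module \<Rightarrow> ('a, 'y) dg_module \<Rightarrow> (int \<Rightarrow> 'z \<Rightarrow> 'y) \<Rightarrow> bool" where
  "lifts A P Z Y s \<longleftrightarrow> (\<forall>\<phi>. chain_map A P Y \<phi> \<longrightarrow> (\<exists>u h. chain_map A P Z u \<and> lin_map A P Y (- 1) h \<and>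
    (\<forall>n. \<forall>x\<in>carrier (part P n). \<phi> n x =
      s n (u n x) \<oplus>\<^bsub>part Y n\<^esub> (dif Y (n - 1) (h n x) \<oplus>\<^bsub>part Y n\<^esub> h (n + 1) (dif P n x)))))"

text \<open>The start of the induction over cells in \<open>resolution\<close>.\<close>

lemma lifts_zero_module:
  assumes "dg_module A Z" "dg_module A Y" "chain_map A Z Y s"
  shows "lifts A (zero_module z) Z Y s"
proof -
  interpret Z: dg_module A Z by fact
  interpret Y: dg_module A Y by fact
  have 0: "dg_module A (zero_module z)" by (rule zero_module_dg_module[OF Z.algebra])
  show ?thesis
    unfolding lifts_def
  proof (intro allI impI)
    fix \<phi> assume \<phi>: "chain_map A (zero_module z) Y \<phi>"
    have "\<phi> n z = \<zero>\<^bsub>part Y n\<^esub>" for n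
      using zero_chain_map_from[OF assms(2) chain_map_lin[OF \<phi>]] by simp
    moreover have "s n \<zero>\<^bsub>part Z n\<^esub> = \<zero>\<^bsub>part Y n\<^esub>" for n
      using lin_map_zero[OF assms(1,2) chain_map_lin[OF assms(3)]] by simp
    ultimately show "\<exists>u h. chain_map A (zero_module z) Z u \<and> lin_map A (zero_module z) Y (- 1) h \<and>
        (\<forall>n. \<forall>x\<in>carrier (part (zero_module z) n). \<phi> n x =
          s n (u n x) \<oplus>\<^bsub>part Y n\<^esub> (dif Y (n - 1) (h n x) \<oplus>\<^bsub>part Y n\<^esub>
              h (n + 1) (dif (zero_module z) n x)))"
      using zero_chain_map[OF 0 assms(1)] zero_lin_map[OF 0 assms(2), of "- 1"]
      by (intro exI[of _ "\<lambda>n x. \<zero>\<^bsub>part Z n\<^esub>"] exI[of _ "\<lambda>n x. \<zero>\<^bsub>part Y (n + - 1)\<^esub>"])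
        (simp add: Y.dif_zero[of "n" "n - 1" for n])
  qed
qed

text \<open>Lifting passes to retracts: lift the composite with \<open>e\<close> over
  \<open>P\<close>, then restrict the lift and the homotopy along \<open>d\<close>.\<close>

lemma lifts_along_iso:
  assumes e: "chain_map A P T e" and d: "chain_map A T P d"
    and ed: "\<And>n x. x \<in> carrier (part T n) \<Longrightarrow> e n (d n x) = x"
    and P: "lifts A P Z Y s"
  shows "lifts A T Z Y s"
  unfolding lifts_def
proof (intro allI impI)
  fix \<phi> assume \<phi>: "chain_map A T Y \<phi>"
  from P[unfolded lifts_def, rule_format, OF chain_map_comp[OF e \<phi>]] obtain u h
      where u: "chain_map A P Z u" and h: "lin_map A P Y (- 1) h"
    and eq: "\<And>n x. x \<in> carrier (part P n) \<Longrightarrow> \<phi> n (e n x) =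
      s n (u n x) \<oplus>\<^bsub>part Y n\<^esub> (dif Y (n - 1) (h n x) \<oplus>\<^bsub>part Y n\<^esub> h (n + 1) (dif P n x))"
    by blast
  have "\<phi> n x = s n (u n (d n x)) \<oplus>\<^bsub>part Y n\<^esub> (dif Y (n - 1) (h n (d n x)) \<oplus>\<^bsub>part Y n\<^esub>
      h (n + 1) (d (n + 1) (dif T n x)))"
    if "x \<in> carrier (part T n)" for n x
    using eq[OF chain_map_closed[OF d that]] ed[OF that] chain_map_dif[OF d that] by simp
  moreover have "lin_map A T Y (- 1) (\<lambda>n x. h n (d n x))"
    using lin_map_comp[OF chain_map_lin[OF d] h, of "- 1"] by simp
  ultimately show "\<exists>u h. chain_map A T Z u \<and> lin_map A T Y (- 1) h \<and>
    (\<forall>n. \<forall>x\<in>carrier (part T n). \<phi> n x =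
      s n (u n x) \<oplus>\<^bsub>part Y n\<^esub> (dif Y (n - 1) (h n x) \<oplus>\<^bsub>part Y n\<^esub> h (n + 1) (dif T n x)))"
    using chain_map_comp[OF d u] by blast
qed

text \<open>Brings a module that was built in a larger type back into the universe
  \<open>'m\<close>, degree by degree along injections of its parts.\<close>

lemma dg_module_transport:
  fixes P :: "('a, 'p) dg_module" and en :: "int \<Rightarrow> 'p \<Rightarrow> 'm"
  assumes "dg_module A P" and inj: "\<And>n. inj_on (en n) (carrier (part P n))"
  obtains T :: "('a, 'm) dg_module" and de where "dg_module A T" "chain_map A P T en" "chain_map A T
      P de"
    "\<And>n x. x \<in> carrier (part T n) \<Longrightarrow> en n (de n x) = x"
    "\<And>n x. x \<in> carrier (part P n) \<Longrightarrow> de n (en n x) = x"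
proof -
  interpret P: dg_module A P by fact
  define de where "de n = inv_into (carrier (part P n)) (en n)" for n
  have de_en [simp]: "de n (en n x) = x" if "x \<in> carrier (part P n)" for n x
    unfolding de_def by (rule inv_into_f_f[OF inj that])
  define T where "T = \<lparr>part = (\<lambda>n. \<lparr>carrier = en n ` carrier (part P n), monoid.mult =
      (\<lambda>x y. x), one = undefined,
    ring.zero = en n \<zero>\<^bsub>part P n\<^esub>, add = (\<lambda>x y. en n (de n x \<oplus>\<^bsub>part P n\<^esub> de n y))\<rparr>),
    dif = (\<lambda>n x. en (n + 1) (dif P n (de n x))),
    act = (\<lambda>n j x a. en (n + j) (act P n j (de n x) a))\<rparr>"
  have T [simp]: "carrier (part T n) = en n ` carrier (part P n)"
    "\<zero>\<^bsub>part T n\<^esub> = en n \<zero>\<^bsub>part P n\<^esub>"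
    "x \<oplus>\<^bsub>part T n\<^esub> y = en n (de n x \<oplus>\<^bsub>part P n\<^esub> de n y)"
    "dif T n x = en (n + 1) (dif P n (de n x))"
    "act T n j x a = en (n + j) (act P n j (de n x) a)" for n j x y a
    by (simp_all add: T_def)
  have T_group: "abelian_group (part T n)" for n
    by (rule abelian_groupI) (auto simp: P.P.a_ac intro!: bexI[of _ "\<ominus>\<^bsub>part P n\<^esub> _"] simp: P.P.l_neg
        P.P.r_neg)
  have ks: "koszul_sign (part T n) i (en n x) = en n (koszul_sign (part P n) i x)"
      if "x \<in> carrier (part P n)" for n i x
  proof -
    have "en n \<in> hom (add_monoid (part P n)) (add_monoid (part T n))"
      by (rule hom_addI) auto
    from hom_add_koszul_sign[OF P.part_group T_group this that] show ?thesis by simp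
  qed
  have 1: "dg_module A T"
  proof (rule dg_module.intro, goal_cases)
    case 1 show ?case by (rule P.algebra)
  next
    case (2 n) show ?case by (rule T_group)
  next
    case (3 x n a j) then show ?case by (auto intro: P.act_closed)
  next
    case (4 x n y a j) then show ?case by (auto simp: P.act_add_left P.act_closed)
  next
    case (5 x n a j b) then show ?case by (auto simp: P.act_add_right P.act_closed)
  next
    case (6 x n a i b j) then show ?case by (auto simp: P.act_act P.act_closed add.assoc)
  next
    case (7 x n) then show ?case by (auto simp: P.act_one)
  next
    case (8 n) show ?case
      by (rule hom_addI) (auto simp: P.dif_add[of _ _ _ "n + 1"] P.dif_closed)
  next
    case (9 x n) then show ?case by (auto simp: P.dif_dif P.dif_closed)
  next
    case (10 x n a j)
    then obtain p where x: "x = en n p" and p: "p \<in> carrier (part P n)" by auto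
    have a': "adif A a \<in> gr A (j + 1)" using 10 P.A.adif_degree by blast
    have c: "act P (n + 1) j (dif P n p) a \<in> carrier (part P (n + j + 1))"
      "act P n (j + 1) p (adif A a) \<in> carrier (part P (n + j + 1))"
      using 10 a' p by (auto intro!: P.act_closed' P.dif_closed)
    have i: "n + 1 + j = n + j + 1" "n + (j + 1) = n + j + 1" by simp_all
    show ?case
      using 10 p c by (simp add: x P.dif_act P.act_closed P.dif_closed i ks del: add.assoc)
  qed
  show ?thesis
  proof (rule that[OF 1])
    show "chain_map A P T en" unfolding chain_map_def by (auto intro!: lin_mapI)
    show "chain_map A T P de" unfolding chain_map_def
      by (auto intro!: lin_mapI simp: P.act_closed P.dif_closed)
  qed auto
qed

section \<open>Free modules\<close>

lemma hom_finsum: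
  assumes "abelian_group G" "abelian_group H" "f \<in> hom (add_monoid G) (add_monoid H)"
    and "finite S" "\<And>x. x \<in> S \<Longrightarrow> h x \<in> carrier G"
  shows "f (finsum G h S) = finsum H (\<lambda>x. f (h x)) S"
proof -
  interpret G: abelian_group G by fact
  interpret H: abelian_group H by fact
  show ?thesis
    using assms(4,5)
  proof (induction S)
    case empty
    then show ?case using hom_add_zero[OF assms(1-3)] by simp
  next
    case (insert x S)
    then show ?case
      using hom_addD[OF assms(3)] by (simp add: Pi_iff)
  qed
qed

text \<open>
  A function \<open>f\<close> stands for the finite sum of the products \<open>g \<cdot> f g\<close> over the generators \<open>g\<close>. The
  generator \<open>g\<close> has degree \<open>dg g\<close> and satisfies \<open>g \<cdot> vt g = g\<close>, so it spans a copy of \<open>vt g A\<close>.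
\<close>

definition free_module :: "('k::field, 'a, 'x) dg_algebra_scheme \<Rightarrow> 'g set \<Rightarrow> ('g \<Rightarrow> int) \<Rightarrow> ('g \<Rightarrow> 'a) \<Rightarrow>
    ('a, 'g \<Rightarrow> 'a) dg_module" where
  "free_module A G dg vt = \<lparr>part = (\<lambda>n.
      \<lparr>carrier = {f. finite {g. f g \<noteq> \<zero>\<^bsub>A\<^esub>} \<and> (\<forall>g. g \<notin> G \<longrightarrow> f g = \<zero>\<^bsub>A\<^esub>) \<and>
        (\<forall>g\<in>G. f g \<in> gr A (n - dg g) \<and> vt g \<otimes>\<^bsub>A\<^esub> f g = f g)},
       monoid.mult = (\<lambda>f _. f), one = (\<lambda>_. \<zero>\<^bsub>A\<^esub>), ring.zero = (\<lambda>_. \<zero>\<^bsub>A\<^esub>), add =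
           (\<lambda>f f' g. f g \<oplus>\<^bsub>A\<^esub> f' g)\<rparr>),
    dif = (\<lambda>n f g. koszul_sign A (dg g) (adif A (f g))),
    act = (\<lambda>n j f a g. f g \<otimes>\<^bsub>A\<^esub> a)\<rparr>"

text \<open>A cocycle idempotent of degree 0 cuts out a direct summand \<open>vt g A\<close> of
  \<open>A\<close> as a right dg module. The sign in the differential of \<open>free_module\<close>
  is that of the Leibniz rule for a product of the cocycle \<open>g\<close> of degree
  \<open>dg g\<close> with an algebra element.\<close>

locale free_gens = dg_algebra A
  for A :: "('k::field, 'a, 'x) dg_algebra_scheme" (structure) +
  fixes G :: "'g set" and dg :: "'g \<Rightarrow> int" and vt :: "'g \<Rightarrow> 'a"
  assumes vt_gr: "g \<in> G \<Longrightarrow> vt g \<in> gr A 0"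
    and vt_idem: "g \<in> G \<Longrightarrow> vt g \<otimes> vt g = vt g"
    and vt_adif: "g \<in> G \<Longrightarrow> adif A (vt g) = \<zero>"
begin

lemma vt_carrier [simp, intro]: "g \<in> G \<Longrightarrow> vt g \<in> carrier A"
  using vt_gr gr_carrier by blast

abbreviation F where "F \<equiv> free_module A G dg vt"

lemma F_iff: "f \<in> carrier (part F n) \<longleftrightarrow> finite {g. f g \<noteq> \<zero>} \<and> (\<forall>g. g \<notin> G \<longrightarrow> f g = \<zero>) \<and>
    (\<forall>g\<in>G. f g \<in> gr A (n - dg g) \<and> vt g \<otimes> f g = f g)"
  by (simp add: free_module_def)

lemma F_simps [simp]:
  "\<zero>\<^bsub>part F n\<^esub> = (\<lambda>_. \<zero>)" "f \<oplus>\<^bsub>part F n\<^esub> f' = (\<lambda>g. f g \<oplus> f' g)"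
  "dif F n f = (\<lambda>g. koszul_sign A (dg g) (adif A (f g)))"
  "act F n j f a = (\<lambda>g. f g \<otimes> a)"
  by (simp_all add: free_module_def)

lemma F_gr: "\<lbrakk>f \<in> carrier (part F n); m = n - dg g\<rbrakk> \<Longrightarrow> f g \<in> gr A m"
  by (cases "g \<in> G") (auto simp: F_iff)

lemma F_carrier: "f \<in> carrier (part F n) \<Longrightarrow> f g \<in> carrier A"
  using F_gr gr_carrier by blast

lemma F_vt: "\<lbrakk>f \<in> carrier (part F n); g \<in> G\<rbrakk> \<Longrightarrow> vt g \<otimes> f g = f g"
  by (auto simp: F_iff)

lemma F_outside: "\<lbrakk>f \<in> carrier (part F n); g \<notin> G\<rbrakk> \<Longrightarrow> f g = \<zero>"
  by (auto simp: F_iff)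

lemma F_finite: "f \<in> carrier (part F n) \<Longrightarrow> finite {g. f g \<noteq> \<zero>}"
  by (auto simp: F_iff)

lemma F_I:
  assumes "\<And>g. g \<in> G \<Longrightarrow> f g \<in> gr A (n - dg g)" "\<And>g. g \<in> G \<Longrightarrow> vt g \<otimes> f g = f g"
    and "\<And>g. g \<notin> G \<Longrightarrow> f g = \<zero>" "finite B" "\<And>g. f g \<noteq> \<zero> \<Longrightarrow> g \<in> B"
  shows "f \<in> carrier (part F n)"
  using assms finite_subset[of "{g. f g \<noteq> \<zero>}" B] by (auto simp: F_iff)

lemma F_add_closed:
  assumes "f \<in> carrier (part F n)" "f' \<in> carrier (part F n)"
  shows "(\<lambda>g. f g \<oplus> f' g) \<in> carrier (part F n)"
proof (rule F_I)
  show "finite ({g. f g \<noteq> \<zero>} \<union> {g. f' g \<noteq> \<zero>})" using assms F_finite by blast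
  fix g assume "g \<in> G"
  then show "f g \<oplus> f' g \<in> gr A (n - dg g)" "vt g \<otimes> (f g \<oplus> f' g) = f g \<oplus> f' g"
    using gr_add[OF F_gr[OF assms(1) refl] F_gr[OF assms(2) refl]]
    by (simp_all add: r_distr assms[THEN F_carrier] assms[THEN F_vt])
qed (use assms in \<open>auto simp: F_outside\<close>)

lemma F_minus_closed:
  assumes "f \<in> carrier (part F n)"
  shows "(\<lambda>g. \<ominus> f g) \<in> carrier (part F n)"
proof (rule F_I)
  show "finite {g. f g \<noteq> \<zero>}" using assms F_finite by blast
  fix g assume "g \<in> G"
  then show "\<ominus> f g \<in> gr A (n - dg g)" "vt g \<otimes> \<ominus> f g = \<ominus> f g"
    using gr_minus[OF F_gr[OF assms refl]]
    by (simp_all add: r_minus F_carrier[OF assms] F_vt[OF assms])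
qed (use assms in \<open>auto simp: F_outside\<close>)

lemma F_zero_closed: "(\<lambda>_. \<zero>) \<in> carrier (part F n)"
  by (rule F_I[of _ _ "{}"]) auto

lemma F_group: "abelian_group (part F n)"
  by (rule abelian_groupI)
    (auto simp: F_add_closed F_zero_closed a_ac F_carrier l_neg r_neg intro!:
        bexI[OF _ F_minus_closed])

lemma F_koszul_sign:
  assumes "f \<in> carrier (part F n)"
  shows "koszul_sign (part F n) i f = (\<lambda>g. koszul_sign A i (f g))"
proof -
  interpret F: abelian_group "part F n" by (rule F_group)
  have "\<ominus>\<^bsub>part F n\<^esub> f = (\<lambda>g. \<ominus> f g)"
    using assms by (intro F.minus_equality) (auto simp: F_minus_closed F_carrier l_neg)
  then show ?thesis by (auto simp: koszul_sign_def)
qed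

lemma gr_koszul_sign: "a \<in> gr A n \<Longrightarrow> koszul_sign A i a \<in> gr A n"
  by (simp add: koszul_sign_def gr_minus)

lemma adif_koszul_sign: "a \<in> carrier A \<Longrightarrow> adif A (koszul_sign A i a) = koszul_sign A i (adif A a)"
  by (simp add: koszul_sign_def adif_minus)

lemma F_dg_module: "dg_module A F"
proof (rule dg_module.intro, goal_cases)
  case 1 show ?case by unfold_locales
next
  case (2 n) show ?case by (rule F_group)
next
  case (3 f n a j)
  show ?case
    unfolding F_simps
  proof (rule F_I)
    show "finite {g. f g \<noteq> \<zero>}" using 3 F_finite by blast
    show "f g \<otimes> a \<in> gr A (n + j - dg g)" for g
      using 3 gr_mult[OF F_gr, of f n "n - dg g" g a j] by (simp add: algebra_simps)
    show "vt g \<otimes> (f g \<otimes> a) = f g \<otimes> a" if "g \<in> G" for g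
      using m_assoc[of "vt g" "f g" a] that 3 by (simp add: F_vt[OF 3(1)] F_carrier[OF 3(1)]
          gr_carrier[OF 3(2)])
  qed (use 3 in \<open>auto simp: F_outside gr_carrier\<close>)
next
  case (4 f n f' a j) then show ?case by (auto simp: l_distr F_carrier gr_carrier)
next
  case (5 f n a j b) then show ?case by (auto simp: r_distr F_carrier gr_carrier)
next
  case (6 f n a i b j) then show ?case by (auto simp: m_assoc F_carrier gr_carrier)
next
  case (7 f n) then show ?case by (auto simp: F_carrier)
next
  case (8 n)
  show ?case
  proof (rule hom_addI)
    fix f assume f: "f \<in> carrier (part F n)"
    show "dif F n f \<in> carrier (part F (n + 1))"
      unfolding F_simps
    proof (rule F_I)
      show "finite {g. f g \<noteq> \<zero>}" using f F_finite by blast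
      fix g assume g: "g \<in> G"
      have "adif A (f g) \<in> gr A (n - dg g + 1)" using f adif_degree F_gr by blast
      then show "koszul_sign A (dg g) (adif A (f g)) \<in> gr A (n + 1 - dg g)"
        using gr_koszul_sign by (simp add: algebra_simps)
      \<comment> \<open>Leibniz applied to \<open>vt g \<otimes> f g = f g\<close>, with
        \<open>vt g\<close> a cocycle of degree 0.\<close>
      have "adif A (f g) = vt g \<otimes> adif A (f g)"
        using adif_mult[OF vt_gr[OF g] F_gr[OF f refl, of g]] f g
        by (simp add: F_vt vt_adif F_carrier koszul_sign_even adif_closed vt_gr[THEN gr_carrier])
      then show "vt g \<otimes> koszul_sign A (dg g) (adif A (f g)) = koszul_sign A (dg g) (adif A (f g))"
        using g f by (simp add: koszul_sign_def r_minus vt_gr[THEN gr_carrier] F_carrier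
            adif_closed)
    qed (use f in \<open>auto simp: F_outside\<close>)
  qed (auto simp: adif_add F_carrier koszul_sign_add adif_closed)
next
  case (9 f n)
  then show ?case by (auto simp: adif_koszul_sign F_carrier adif_closed adif_adif)
next
  case (10 f n a j)
  have a: "a \<in> carrier A" and a': "adif A a \<in> carrier A" "adif A a \<in> gr A (j + 1)"
    using 10 gr_carrier adif_closed adif_degree by blast+
  have fa: "(\<lambda>g. f g \<otimes> adif A a) \<in> carrier (part F (n + j + 1))"
  proof (rule F_I)
    show "finite {g. f g \<noteq> \<zero>}" using 10 F_finite by blast
    show "f g \<otimes> adif A a \<in> gr A (n + j + 1 - dg g)" for g
      using 10 gr_mult[OF F_gr a'(2), of f n "n - dg g" g] by (simp add: algebra_simps)
    show "vt g \<otimes> (f g \<otimes> adif A a) = f g \<otimes> adif A a" if "g \<in> G" for g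
      using m_assoc[of "vt g" "f g" "adif A a"] that a'(1)
          by (simp add: F_vt[OF 10(1)] F_carrier[OF 10(1)])
  qed (use 10 a' in \<open>auto simp: F_outside\<close>)
  have "koszul_sign A (dg g) (adif A (f g \<otimes> a)) =
    koszul_sign A (dg g) (adif A (f g)) \<otimes> a \<oplus> koszul_sign A n (f g \<otimes> adif A a)" for g
    using adif_mult[OF F_gr[OF 10(1) refl] 10(2), of g] 10 a a'
    by (auto simp: koszul_sign_add koszul_sign_koszul_sign F_carrier adif_closed) (auto simp:
        koszul_sign_def l_minus F_carrier adif_closed)
  then show ?case
    using fa by (simp add: F_koszul_sign)
qed

sublocale F: dg_module A F
  by (rule F_dg_module)

definition gen :: "'g \<Rightarrow> 'g \<Rightarrow> 'a" where
  "gen g = (\<lambda>_. \<zero>)(g := vt g)"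

lemma gen_closed: "g \<in> G \<Longrightarrow> gen g \<in> carrier (part F (dg g))"
  unfolding gen_def by (rule F_I[of _ _ "{g}"]) (auto simp: vt_gr vt_idem vt_gr[THEN gr_carrier]
      split: if_splits)

lemma gen_dif: "g \<in> G \<Longrightarrow> dif F (dg g) (gen g) = (\<lambda>_. \<zero>)"
  unfolding gen_def by (auto simp: vt_adif)

lemma gen_vt: "g \<in> G \<Longrightarrow> act F (dg g) 0 (gen g) (vt g) = gen g"
  unfolding gen_def by (auto simp: vt_idem vt_gr[THEN gr_carrier])

lemma F_upd_closed:
  assumes "f \<in> carrier (part F n)"
  shows "f(g := \<zero>) \<in> carrier (part F n)"
proof (rule F_I)
  show "finite {g. f g \<noteq> \<zero>}" using assms F_finite by blast
qed (use assms in \<open>auto simp: F_gr F_vt F_outside vt_gr[THEN gr_carrier] split: if_splits\<close>)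

lemma F_split:
  assumes "f \<in> carrier (part F n)" "g \<in> G"
  shows "f = act F (dg g) (n - dg g) (gen g) (f g) \<oplus>\<^bsub>part F n\<^esub> f(g := \<zero>)"
  using assms by (auto simp: gen_def F_vt F_carrier fun_eq_iff)

text \<open>Induction on the size of the support, deleting one generator at a time; with
  \<open>F_split\<close> it replaces computations with finite sums.\<close>

lemma F_induct [consumes 1, case_names zero upd]:
  assumes "f \<in> carrier (part F n)" and "P (\<lambda>_. \<zero>)"
    and step: "\<And>f g. \<lbrakk>f \<in> carrier (part F n); g \<in> G; f g \<noteq> \<zero>; P (f(g := \<zero>))\<rbrakk> \<Longrightarrow> P f"
  shows "P f"
  using assms(1)
proof (induction "card {g. f g \<noteq> \<zero>}" arbitrary: f)
  case 0
  then have "f = (\<lambda>_. \<zero>)" using F_finite by fastforce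
  then show ?case using assms(2) by simp
next
  case (Suc k)
  then obtain g where g: "f g \<noteq> \<zero>" by fastforce
  have "{g'. (f(g := \<zero>)) g' \<noteq> \<zero>} = {g. f g \<noteq> \<zero>} - {g}" by auto
  then have "k = card {g'. (f(g := \<zero>)) g' \<noteq> \<zero>}"
    using Suc(2) g by simp
  then have "P (f(g := \<zero>))" using Suc(1) F_upd_closed[OF Suc(3)] by blast
  moreover have "g \<in> G" using F_outside Suc(3) g by blast
  ultimately show ?case using step Suc(3) g by blast
qed

section \<open>The universal property of free modules\<close>

context
  fixes Y :: "('a, 'y) dg_module" and t :: int
  assumes Y: "dg_module A Y"
begin

interpretation Y: dg_module A Y by (rule Y)

lemma lin_map_split:
  assumes w: "lin_map A F Y t w" and f: "f \<in> carrier (part F n)" and g: "g \<in> G"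
  shows "w n f = act Y (dg g + t) (n - dg g) (w (dg g) (gen g)) (f g) \<oplus>\<^bsub>part Y (n + t)\<^esub>
      w n (f(g := \<zero>))"
proof -
  have 1: "act F (dg g) (n - dg g) (gen g) (f g) \<in> carrier (part F n)"
    by (rule F.act_closed'[OF gen_closed[OF g] F_gr[OF f refl]]) simp
  have "w n f = w n (act F (dg g) (n - dg g) (gen g) (f g)) \<oplus>\<^bsub>part Y (n + t)\<^esub> w n (f(g := \<zero>))"
    by (subst F_split[OF f g]) (rule lin_map_add[OF w 1 F_upd_closed[OF f] refl])
  also have "w n (act F (dg g) (n - dg g) (gen g) (f g)) =
      act Y (dg g + t) (n - dg g) (w (dg g) (gen g)) (f g)"
    by (rule lin_map_act[OF w gen_closed[OF g] F_gr[OF f refl]]) auto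
  finally show ?thesis .
qed

lemma lin_map_unique:
  assumes w: "lin_map A F Y t w" and v: "lin_map A F Y t v"
    and eq: "\<And>g. g \<in> G \<Longrightarrow> w (dg g) (gen g) = v (dg g) (gen g)"
    and f: "f \<in> carrier (part F n)"
  shows "w n f = v n f"
  using f
proof (induction f rule: F_induct)
  case zero
  then show ?case
    using lin_map_zero[OF F_dg_module Y w refl, of n] lin_map_zero[OF F_dg_module Y v refl, of n]
        by simp
next
  case (upd f g)
  show ?case
    unfolding lin_map_split[OF w upd(1,2)] lin_map_split[OF v upd(1,2)] upd(4) eq[OF upd(2)]
        by (rule refl)
qed

text \<open>The extension sends \<open>f\<close> to the sum of the \<open>y g\<close> acted on by
  \<open>f g\<close>. The condition \<open>yvt\<close> is forced by \<open>gen_vt\<close>, and it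
  returns \<open>y g\<close> at the generator, whose coefficient is \<open>vt g\<close> and not the
  unit.\<close>

lemma lin_map_extend:
  assumes y: "\<And>g. g \<in> G \<Longrightarrow> y g \<in> carrier (part Y (dg g + t))"
    and yvt: "\<And>g. g \<in> G \<Longrightarrow> act Y (dg g + t) 0 (y g) (vt g) = y g"
  obtains w where "lin_map A F Y t w" "\<And>g. g \<in> G \<Longrightarrow> w (dg g) (gen g) = y g"
proof -
  define c where "c n f g = act Y (dg g + t) (n - dg g) (y g) (f g)" for n f g
  have c [simp]: "c n f g \<in> carrier (part Y (n + t))" if "f \<in> carrier (part F n)" "g \<in> G" for n f g
    unfolding c_def by (rule Y.act_closed'[OF y[OF that(2)] F_gr[OF that(1) refl]]) simp
  have c0: "c n f g = \<zero>\<^bsub>part Y (n + t)\<^esub>" if "f g = \<zero>" "g \<in> G" for n f g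
    unfolding c_def that(1) by (rule Y.act_zero_right[OF y[OF that(2)]]) simp
  define w where "w n f = finsum (part Y (n + t)) (c n f) {g. f g \<noteq> \<zero>}" for n f
  \<comment> \<open>The support varies with \<open>f\<close>; any larger finite index set gives the
    same sum, so that two elements and their sum can be treated over one set.\<close>
  have w_eq: "w n f = finsum (part Y (n + t)) (c n f) S"
    if "f \<in> carrier (part F n)" "finite S" "{g. f g \<noteq> \<zero>} \<subseteq> S" "S \<subseteq> G" for n f S
    unfolding w_def using that
    by (intro Y.P.add.finprod_mono_neutral_cong_left) (auto intro!: c0)
  have supp: "{g. f g \<noteq> \<zero>} \<subseteq> G" if "f \<in> carrier (part F n)" for f n
    using that F_outside by blast
  have "lin_map A F Y t w"
  proof (rule lin_mapI)
    fix n f assume f: "f \<in> carrier (part F n)"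
    show "w n f \<in> carrier (part Y (n + t))"
      unfolding w_def using f supp[OF f] by (intro Y.P.finsum_closed) auto
    fix f' assume f': "f' \<in> carrier (part F n)"
    let ?S = "{g. f g \<noteq> \<zero>} \<union> {g. f' g \<noteq> \<zero>}"
    have S: "finite ?S" "?S \<subseteq> G" using f f' F_finite F_outside by blast+
    have "w n (f \<oplus>\<^bsub>part F n\<^esub> f') = finsum (part Y (n + t)) (c n (f \<oplus>\<^bsub>part F n\<^esub> f')) ?S"
      using S F_add_closed[OF f f'] by (intro w_eq) auto
    also have "\<dots> = finsum (part Y (n + t)) (\<lambda>g. c n f g \<oplus>\<^bsub>part Y (n + t)\<^esub> c n f' g) ?S"
    proof (rule Y.P.finsum_cong')
      show "(\<lambda>g. c n f g \<oplus>\<^bsub>part Y (n + t)\<^esub> c n f' g) \<in> ?S \<rightarrow> carrier (part Y (n + t))"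
        using S(2) f f' by (auto simp: subset_iff)
      fix g assume "g \<in> ?S"
      then have "g \<in> G" using S(2) by blast
      then show "c n (f \<oplus>\<^bsub>part F n\<^esub> f') g = c n f g \<oplus>\<^bsub>part Y (n + t)\<^esub> c n f' g"
        unfolding c_def using y F_gr[OF f refl] F_gr[OF f' refl]
            by (simp add: Y.act_add_right'[of _ _ _ _ _ "n + t"])
    qed simp
    also have "\<dots> = w n f \<oplus>\<^bsub>part Y (n + t)\<^esub> w n f'"
      using S f f' by (subst Y.P.finsum_addf) (auto simp: w_eq[of f n ?S] w_eq[of f' n ?S])
    finally show "w n (f \<oplus>\<^bsub>part F n\<^esub> f') = w n f \<oplus>\<^bsub>part Y (n + t)\<^esub> w n f'" .
  next
    fix n f j a assume f: "f \<in> carrier (part F n)" and a: "a \<in> gr A j"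
    let ?S = "{g. f g \<noteq> \<zero>}"
    have fa: "act F n j f a \<in> carrier (part F (n + j))" using f a F.act_closed by blast
    have "w (n + j) (act F n j f a) = finsum (part Y (n + j + t)) (c (n + j) (act F n j f a)) ?S"
      using F_finite[OF f] supp[OF f] fa a by (intro w_eq) (auto simp: gr_carrier)
    also have "\<dots> = finsum (part Y (n + j + t)) (\<lambda>g. act Y (n + t) j (c n f g) a) ?S"
    proof (rule Y.P.finsum_cong')
      have *: "act Y (n + t) j (c n f g) a \<in> carrier (part Y (n + j + t))" if "g \<in> G" for g
        using Y.act_closed'[OF c[OF f that] a] by (simp add: ac_simps)
      then show "(\<lambda>g. act Y (n + t) j (c n f g) a) \<in> ?S \<rightarrow> carrier (part Y (n + j + t))"
        using supp[OF f] by auto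
      fix g assume "g \<in> ?S"
      then have g: "g \<in> G" using supp[OF f] by blast
      show "c (n + j) (act F n j f a) g = act Y (n + t) j (c n f g) a"
        unfolding c_def F_simps
        by (rule Y.act_act'[symmetric, OF y[OF g] F_gr[OF f refl] a]) auto
    qed simp
    also have "\<dots> = act Y (n + t) j (w n f) a"
      unfolding w_def using F_finite[OF f] supp[OF f] f
      by (intro hom_finsum[symmetric, OF Y.part_group Y.part_group Y.act_hom_left[OF a]]) auto
    finally show "w (n + j) (act F n j f a) = act Y (n + t) j (w n f) a" .
  qed
  moreover have "w (dg g) (gen g) = y g" if g: "g \<in> G" for g
  proof -
    have "w (dg g) (gen g) = finsum (part Y (dg g + t)) (c (dg g) (gen g)) {g}"
      using g gen_closed by (intro w_eq) (auto simp: gen_def)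
    also have "\<dots> = c (dg g) (gen g) g"
      using c[OF gen_closed[OF g] g] by (subst Y.P.finsum_insert) auto
    also have "\<dots> = y g" unfolding c_def gen_def using yvt[OF g] by simp
    finally show ?thesis .
  qed
  ultimately show ?thesis using that by blast
qed

end

text \<open>
  The graded commutator of a linear map with the differential is linear, so it is determined by
  its values on the generators.
\<close>

lemma dif_lin_map:
  assumes Y: "dg_module A Y" and w: "lin_map A F Y t w" and v: "lin_map A F Y (t + 1) v"
    and eq: "\<And>g. g \<in> G \<Longrightarrow> dif Y (dg g + t) (w (dg g) (gen g)) = v (dg g) (gen g)"
    and f: "f \<in> carrier (part F n)"
  shows "dif Y (n + t) (w n f) = v n f \<oplus>\<^bsub>part Y (n + t + 1)\<^esub>
    koszul_sign (part Y (n + t + 1)) t (w (n + 1) (dif F n f))"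
proof -
  interpret Y: dg_module A Y by (rule Y)
  let ?k = "\<lambda>n f. dif Y (n + t) (w n f) \<ominus>\<^bsub>part Y (n + t + 1)\<^esub>
    koszul_sign (part Y (n + t + 1)) t (w (n + 1) (dif F n f))"
  have c1: "dif Y (n + t) (w n f) \<in> carrier (part Y (n + t + 1))" if "f \<in> carrier (part F n)"
      for n f
    by (rule Y.dif_closed[OF lin_map_closed[OF w that refl]])
  have c2: "w (n + 1) (dif F n f) \<in> carrier (part Y (n + t + 1))"
    by (rule lin_map_closed[OF w F.dif_closed[OF f]]) simp
  have "?k n f = v n f"
  proof (rule lin_map_unique[OF Y lin_map_comm[OF F_dg_module Y w] v _ f])
    fix g assume g: "g \<in> G"
    have "w (dg g + 1) (dif F (dg g) (gen g)) = \<zero>\<^bsub>part Y (dg g + t + 1)\<^esub>"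
      unfolding gen_dif[OF g]
      using lin_map_zero[OF F_dg_module Y w, of "dg g + t + 1" "dg g + 1"] by simp
    then show "?k (dg g) (gen g) = v (dg g) (gen g)"
      using eq[OF g] c1[OF gen_closed[OF g]] by (simp add: a_minus_def)
  qed
  then have "v n f \<oplus>\<^bsub>part Y (n + t + 1)\<^esub> koszul_sign (part Y (n + t + 1)) t (w (n + 1) (dif F n f))
      =
    ?k n f \<oplus>\<^bsub>part Y (n + t + 1)\<^esub> koszul_sign (part Y (n + t + 1)) t (w (n + 1) (dif F n f))"
    by simp
  also have "\<dots> = dif Y (n + t) (w n f)"
    using c1[OF f] c2 by (simp add: a_minus_def Y.P.a_assoc Y.P.l_neg)
  finally show ?thesis by simp
qed

text \<open>Obstruction theory for one layer of cells. On each generator, the lift and the homotopy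
  chosen over \<open>P\<close> produce a cocycle of the cone of \<open>s\<close> in degree
  \<open>dg g\<close>. It is a boundary by \<open>rel_exact\<close>, and a primitive gives the
  values of the extended lift and homotopy on that generator.\<close>

lemma lifts_twisted_sum:
  assumes P: "dg_module A P" and tw: "twisting A F P \<psi>"
    and Z: "dg_module A Z" and Y: "dg_module A Y" and s: "chain_map A Z Y s"
    and ex: "\<And>g. g \<in> G \<Longrightarrow> rel_exact Z Y s (dg g)"
    and lP: "lifts A P Z Y s"
  shows "lifts A (twisted_sum P F \<psi>) Z Y s"
  unfolding lifts_def
proof (intro allI impI)
  let ?T = "twisted_sum P F \<psi>"
  fix \<phi> assume \<phi>: "chain_map A ?T Y \<phi>"
  interpret P: dg_module A P by (rule P)
  interpret Z: dg_module A Z by (rule Z)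
  interpret Y: dg_module A Y by (rule Y)
  have T: "dg_module A ?T" by (rule twisted_sum_dg_module[OF P F_dg_module tw])
  interpret T: dg_module A ?T by (rule T)
  have lin: "lin_map A F P 1 \<psi>" and
    tw': "\<And>n x. x \<in> carrier (part F n) \<Longrightarrow> dif P (n + 1) (\<psi> n x) = \<ominus>\<^bsub>part P (n + 1 + 1)\<^esub>
        \<psi> (n + 1) (dif F n x)"
    using tw unfolding twisting_def by auto
  define \<phi>P where "\<phi>P n p = \<phi> n (p, \<zero>\<^bsub>part F n\<^esub>)" for n p
  define \<phi>F where "\<phi>F n f = \<phi> n (\<zero>\<^bsub>part P n\<^esub>, f)" for n f
  have \<phi>P: "chain_map A P Y \<phi>P"
    using chain_map_comp[OF twisted_sum_inl[OF P F_dg_module tw] \<phi>] unfolding \<phi>P_def .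
  have \<phi>F: "lin_map A F Y 0 \<phi>F"
    using lin_map_comp[OF twisted_sum_inr[OF P F_dg_module, of \<psi>] chain_map_lin[OF \<phi>], of 0]
    unfolding \<phi>F_def by simp
  have \<phi>_eq: "\<phi> n (p, f) = \<phi>P n p \<oplus>\<^bsub>part Y n\<^esub> \<phi>F n f"
    if "p \<in> carrier (part P n)" "f \<in> carrier (part F n)" for n p f
    using lin_map_add[OF chain_map_lin[OF \<phi>], of "(p, \<zero>\<^bsub>part F n\<^esub>)" n "(\<zero>\<^bsub>part P n\<^esub>, f)" n]
      that F_carrier[OF that(2)] F_zero_closed
    unfolding \<phi>P_def \<phi>F_def by simp
  have d\<phi>F: "dif Y n (\<phi>F n f) = \<phi>P (n + 1) (\<psi> n f) \<oplus>\<^bsub>part Y (n + 1)\<^esub> \<phi>F (n + 1) (dif F n f)"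
    if f: "f \<in> carrier (part F n)" for n f
  proof -
    have "dif Y n (\<phi>F n f) = \<phi> (n + 1) (dif ?T n (\<zero>\<^bsub>part P n\<^esub>, f))"
      unfolding \<phi>F_def using f by (intro chain_map_dif[OF \<phi>, symmetric]) auto
    also have "dif ?T n (\<zero>\<^bsub>part P n\<^esub>, f) = (\<psi> n f, dif F n f)"
      using lin_map_closed[OF lin f refl] by (simp add: P.dif_zero[of "n + 1" n])
    also have "\<phi> (n + 1) \<dots> = \<phi>P (n + 1) (\<psi> n f) \<oplus>\<^bsub>part Y (n + 1)\<^esub> \<phi>F (n + 1) (dif F n f)"
      by (rule \<phi>_eq[OF lin_map_closed[OF lin f refl] F.dif_closed[OF f]])
    finally show ?thesis .
  qed
  from lP[unfolded lifts_def, rule_format, OF \<phi>P] obtain u h where u: "chain_map A P Z u"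
    and h: "lin_map A P Y (- 1) h" and uh: "\<And>n p. p \<in> carrier (part P n) \<Longrightarrow> \<phi>P n p =
      s n (u n p) \<oplus>\<^bsub>part Y n\<^esub> (dif Y (n - 1) (h n p) \<oplus>\<^bsub>part Y n\<^esub> h (n + 1) (dif P n p))"
    by blast
  have su: "chain_map A P Y (\<lambda>n p. s n (u n p))" by (rule chain_map_comp[OF u s])
  have u\<psi>: "lin_map A F Z 1 (\<lambda>n f. u (n + 1) (\<psi> n f))"
    by (rule lin_map_comp[OF lin chain_map_lin[OF u]]) simp
  have h\<psi>: "lin_map A F Y 0 (\<lambda>n f. h (n + 1) (\<psi> n f))"
    by (rule lin_map_comp[OF lin h]) simp
  \<comment> \<open>What remains of the map on the cells after removing the contribution of the
    homotopy over \<open>P\<close>, which enters through \<open>\<psi>\<close>.\<close>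
  define \<rho> where "\<rho> n f = \<phi>F n f \<oplus>\<^bsub>part Y n\<^esub> koszul_sign (part Y n) 1 (h (n + 1) (\<psi> n f))" for n f
  have \<rho>: "lin_map A F Y 0 \<rho>"
    using lin_map_plus[OF Y \<phi>F lin_map_koszul_sign_map[OF Y h\<psi>, of 1]] unfolding \<rho>_def by simp
  \<comment> \<open>\<open>z\<close> and \<open>x\<close> become the values of the lift and of the
    homotopy at the generator; the last two conditions are those of
    \<open>lin_map_extend\<close>.\<close>
  let ?good = "\<lambda>g z x. z \<in> carrier (part Z (dg g)) \<and> x \<in> carrier (part Y (dg g - 1)) \<and>
    u (dg g + 1) (\<psi> (dg g) (gen g)) = dif Z (dg g) z \<and>
    \<rho> (dg g) (gen g) = s (dg g) z \<oplus>\<^bsub>part Y (dg g)\<^esub> dif Y (dg g - 1) x \<and>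
    act Z (dg g) 0 z (vt g) = z \<and> act Y (dg g - 1) 0 x (vt g) = x"
  have "\<exists>z x. ?good g z x" if g: "g \<in> G" for g
  proof -
    define n where "n = dg g"
    define p where "p = \<psi> n (gen g)"
    define x0 where "x0 = \<rho> n (gen g)"
    note gen = gen_closed[OF g, folded n_def] and v = vt_gr[OF g]
    have p: "p \<in> carrier (part P (n + 1))"
      unfolding p_def by (rule lin_map_closed[OF lin gen refl])
    have dp: "dif P (n + 1) p = \<zero>\<^bsub>part P (n + 1 + 1)\<^esub>"
      unfolding p_def tw'[OF gen] using gen_dif[OF g] lin_map_zero[OF F_dg_module P lin refl,
          of "n + 1"]
      by (simp add: n_def)
    have x0: "x0 \<in> carrier (part Y n)"
      unfolding x0_def using lin_map_closed[OF \<rho> gen] by simp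
    have z: "u (n + 1) p \<in> carrier (part Z (n + 1))" by (rule chain_map_closed[OF u p])
    have dz: "dif Z (n + 1) (u (n + 1) p) = \<zero>\<^bsub>part Z (n + 1 + 1)\<^esub>"
      using chain_map_dif[OF u p refl] dp lin_map_zero[OF P Z chain_map_lin[OF u], of "n + 1 + 1"
          "n + 1 + 1"]
      by simp
    have hp: "h (n + 1) p \<in> carrier (part Y n)" using lin_map_closed[OF h p] by simp
    have "h (n + 1 + 1) (dif P (n + 1) p) = \<zero>\<^bsub>part Y (n + 1)\<^esub>"
      unfolding dp using lin_map_zero[OF P Y h, of "n + 1" "n + 1 + 1"] by simp
    then have \<phi>p: "\<phi>P (n + 1) p = s (n + 1) (u (n + 1) p) \<oplus>\<^bsub>part Y (n + 1)\<^esub> dif Y n (h (n + 1) p)"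
      using uh[OF p] Y.dif_closed[OF hp] by simp
    have "\<phi>F (n + 1) (dif F n (gen g)) = \<zero>\<^bsub>part Y (n + 1)\<^esub>"
      using gen_dif[OF g] lin_map_zero[OF F_dg_module Y \<phi>F, of "n + 1" "n + 1"] by (simp add: n_def)
    then have "dif Y n (\<phi>F n (gen g)) = s (n + 1) (u (n + 1) p) \<oplus>\<^bsub>part Y (n + 1)\<^esub>
        dif Y n (h (n + 1) p)"
      using d\<phi>F[OF gen] \<phi>p chain_map_closed[OF \<phi>P p] by (simp add: p_def)
    \<comment> \<open>Together with \<open>dz\<close> this is the cocycle condition in the cone of
      \<open>s\<close> to which \<open>rel_exact\<close> applies.\<close>
    then have sz: "s (n + 1) (u (n + 1) p) = dif Y n x0"
      using lin_map_closed[OF \<phi>F gen, of n] hp chain_map_closed[OF s z] Y.dif_closed[OF hp]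
      unfolding x0_def \<rho>_def
      by (simp add: p_def[symmetric] Y.dif_add[of _ _ _ "n + 1"] Y.dif_minus[of _ _ "n + 1"]
          koszul_sign_def
          Y.P.a_assoc Y.P.r_neg)
    obtain z' x' where z': "z' \<in> carrier (part Z n)" and x': "x' \<in> carrier (part Y (n - 1))"
      and zz': "u (n + 1) p = dif Z n z'" and xx': "x0 = s n z' \<oplus>\<^bsub>part Y n\<^esub> dif Y (n - 1) x'"
      using ex[OF g, folded n_def, unfolded rel_exact_def, rule_format, OF x0 z conjI[OF dz sz]]
          by blast
    have v_lin: "act N m 0 (f n (gen g)) (vt g) = f n (gen g)" if "lin_map A F N t f" "m = n + t"
      for N :: "('a, 'w) dg_module" and f t m
      using lin_map_act[OF that(1) gen v, of n m] gen_vt[OF g, folded n_def] that(2)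
          by (simp del: F_simps)
    have v_dif: "dif N n (act N n 0 y (vt g)) = act N (n + 1) 0 (dif N n y) (vt g)"
      if "dg_module A N" "y \<in> carrier (part N n)" for N :: "('a, 'w) dg_module" and y n
    proof -
      interpret N: dg_module A N by fact
      have "act N n 1 y (adif A (vt g)) = \<zero>\<^bsub>part N (n + 1)\<^esub>"
        unfolding vt_adif[OF g] by (rule N.act_zero_right[OF that(2) refl])
      then show ?thesis
        using N.dif_act[OF that(2) v] N.act_closed[OF N.dif_closed[OF that(2)] v] by simp
    qed
    have v_idem: "act N n 0 (act N n 0 y (vt g)) (vt g) = act N n 0 y (vt g)"
      if "dg_module A N" "y \<in> carrier (part N n)" for N :: "('a, 'w) dg_module" and y n
      using dg_module.act_act[OF that v v] vt_idem[OF g] by simp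
    have cl: "s n z' \<in> carrier (part Y n)" "dif Y (n - 1) x' \<in> carrier (part Y n)"
      using chain_map_closed[OF s z'] Y.dif_closed[OF x'] by simp_all
    \<comment> \<open>The primitive from \<open>rel_exact\<close> need not be supported at the
      vertex of \<open>g\<close>. Acting by \<open>vt g\<close> moves it there and keeps both
      equations, because \<open>vt g\<close> is a cocycle and fixes their left hand sides.\<close>
    have "?good g (act Z n 0 z' (vt g)) (act Y (n - 1) 0 x' (vt g))"
      unfolding n_def[symmetric] p_def[symmetric] x0_def[symmetric]
    proof (intro conjI)
      show "u (n + 1) p = dif Z n (act Z n 0 z' (vt g))"
        unfolding v_dif[OF Z z'] zz'[symmetric] p_def by (rule v_lin[OF u\<psi> refl, symmetric])
      have "x0 = act Y n 0 x0 (vt g)"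
        unfolding x0_def by (rule v_lin[OF \<rho>, symmetric]) simp
      also have "\<dots> = act Y n 0 (s n z') (vt g) \<oplus>\<^bsub>part Y n\<^esub> act Y n 0 (dif Y (n - 1) x') (vt g)"
        unfolding xx' using Y.act_add_left'[OF cl v, of n] by simp
      also have "act Y n 0 (s n z') (vt g) = s n (act Z n 0 z' (vt g))"
        by (rule lin_map_act[OF chain_map_lin[OF s] z' v, symmetric]) auto
      also have "act Y n 0 (dif Y (n - 1) x') (vt g) = dif Y (n - 1) (act Y (n - 1) 0 x' (vt g))"
        using v_dif[OF Y x'] by simp
      finally show "x0 = s n (act Z n 0 z' (vt g)) \<oplus>\<^bsub>part Y n\<^esub>
          dif Y (n - 1) (act Y (n - 1) 0 x' (vt g))" .
    qed (use Z.act_closed[OF z' v] Y.act_closed[OF x' v] v_idem[OF Z z'] v_idem[OF Y x'] in auto)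
    then show ?thesis by blast
  qed
  then have "\<forall>g\<in>G. \<exists>z x. ?good g z x" by blast
  from bchoice[OF this] obtain zz where "\<forall>g\<in>G. \<exists>x. ?good g (zz g) x" by blast
  from bchoice[OF this] obtain xx where good: "\<forall>g\<in>G. ?good g (zz g) (xx g)" by blast
  then have zz: "\<And>g. g \<in> G \<Longrightarrow> zz g \<in> carrier (part Z (dg g))"
    and xx: "\<And>g. g \<in> G \<Longrightarrow> xx g \<in> carrier (part Y (dg g - 1))"
    and zz_dif: "\<And>g. g \<in> G \<Longrightarrow> u (dg g + 1) (\<psi> (dg g) (gen g)) = dif Z (dg g) (zz g)"
    and xx_dif: "\<And>g. g \<in> G \<Longrightarrow> \<rho> (dg g) (gen g) = s (dg g) (zz g) \<oplus>\<^bsub>part Y (dg g)\<^esub>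
        dif Y (dg g - 1) (xx g)"
    and zz_vt: "\<And>g. g \<in> G \<Longrightarrow> act Z (dg g) 0 (zz g) (vt g) = zz g"
    and xx_vt: "\<And>g. g \<in> G \<Longrightarrow> act Y (dg g - 1) 0 (xx g) (vt g) = xx g"
    by simp_all
  obtain w where w: "lin_map A F Z 0 w" and w_gen: "\<And>g. g \<in> G \<Longrightarrow> w (dg g) (gen g) = zz g"
    using lin_map_extend[OF Z, of zz 0] zz zz_vt by auto
  obtain k where k: "lin_map A F Y (- 1) k" and k_gen: "\<And>g. g \<in> G \<Longrightarrow> k (dg g) (gen g) = xx g"
    using lin_map_extend[OF Y, of xx "- 1"] xx xx_vt by auto
  have sw: "lin_map A F Y 0 (\<lambda>n f. s n (w n f))"
    using lin_map_comp[OF w chain_map_lin[OF s]] by simp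
  \<comment> \<open>The value that the graded commutator of the new homotopy \<open>k\<close> must
    have. It agrees with the differential of \<open>xx g\<close> on generators, so
    \<open>dif_lin_map\<close> gives it on all of \<open>F\<close>.\<close>
  define \<sigma> where "\<sigma> n f = \<rho> n f \<oplus>\<^bsub>part Y n\<^esub> koszul_sign (part Y n) 1 (s n (w n f))" for n f
  have \<sigma>: "lin_map A F Y 0 \<sigma>"
    using lin_map_plus[OF Y \<rho> lin_map_koszul_sign_map[OF Y sw, of 1]] unfolding \<sigma>_def by simp
  have dw: "dif Z n (w n f) = u (n + 1) (\<psi> n f) \<oplus>\<^bsub>part Z (n + 1)\<^esub> w (n + 1) (dif F n f)"
    if f: "f \<in> carrier (part F n)" for n f
    using dif_lin_map[OF Z w, of "\<lambda>n f. u (n + 1) (\<psi> n f)" f n] u\<psi> zz_dif w_gen f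
        by (simp add: koszul_sign_def)
  have dk: "dif Y (n - 1) (k n f) = \<sigma> n f \<oplus>\<^bsub>part Y n\<^esub> \<ominus>\<^bsub>part Y n\<^esub> k (n + 1) (dif F n f)"
    if f: "f \<in> carrier (part F n)" for n f
  proof -
    have "dif Y (dg g - 1) (k (dg g) (gen g)) = \<sigma> (dg g) (gen g)" if g: "g \<in> G" for g
    proof -
      have "s (dg g) (zz g) \<in> carrier (part Y (dg g))" "dif Y (dg g - 1) (xx g) \<in> carrier (part
          Y (dg g))"
        using chain_map_closed[OF s zz[OF g]] Y.dif_closed[OF xx[OF g]] by simp_all
      then show ?thesis
        unfolding \<sigma>_def using xx_dif[OF g] w_gen[OF g] k_gen[OF g]
        by (simp add: koszul_sign_def Y.P.add_diff_cancel)
    qed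
    then show ?thesis
      using dif_lin_map[OF Y k, of \<sigma> f n] \<sigma> f by (simp add: koszul_sign_def)
  qed
  define U where "U n x = u n (fst x) \<oplus>\<^bsub>part Z n\<^esub> w n (snd x)" for n x
  define H where "H n x = h n (fst x) \<oplus>\<^bsub>part Y (n - 1)\<^esub> k n (snd x)" for n x
  have U: "lin_map A ?T Z 0 U"
    using twisted_sum_case[OF Z chain_map_lin[OF u] w] unfolding U_def by simp
  have H: "lin_map A ?T Y (- 1) H"
    using twisted_sum_case[OF Y h k] unfolding H_def by simp
  have "chain_map A ?T Z U"
    unfolding chain_map_def
  proof (intro conjI U allI ballI)
    fix n x assume "x \<in> carrier (part ?T n)"
    then obtain p f where x: "x = (p, f)" and p: "p \<in> carrier (part P n)"
        and f: "f \<in> carrier (part F n)"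
      by auto
    have "u (n + 1) (dif P n p \<oplus>\<^bsub>part P (n + 1)\<^esub> \<psi> n f) = dif Z n (u n p) \<oplus>\<^bsub>part Z (n + 1)\<^esub>
        u (n + 1) (\<psi> n f)"
      using lin_map_add[OF chain_map_lin[OF u] P.dif_closed[OF p] lin_map_closed[OF lin f refl]]
        chain_map_dif[OF u p] by simp
    then show "U (n + 1) (dif ?T n x) = dif Z n (U n x)"
      using p f chain_map_closed[OF u p] lin_map_closed[OF w f, of n] dw[OF f]
        lin_map_closed[OF u\<psi> f refl] lin_map_closed[OF w F.dif_closed[OF f], of "n + 1"]
      unfolding U_def x by (simp add: Z.dif_add[of _ _ _ "n + 1"] Z.P.a_assoc Z.dif_closed del:
          F_simps)
  qed
  moreover have "\<phi> n x = s n (U n x) \<oplus>\<^bsub>part Y n\<^esub> (dif Y (n - 1) (H n x) \<oplus>\<^bsub>part Y n\<^esub>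
      H (n + 1) (dif ?T n x))"
    if "x \<in> carrier (part ?T n)" for n x
  proof -
    from that obtain p f where x: "x = (p, f)" and p: "p \<in> carrier (part P n)"
        and f: "f \<in> carrier (part F n)"
      by auto
    let ?G = "part Y n"
    note \<psi>f = lin_map_closed[OF lin f refl]
    have c [simp]: "s n (u n p) \<in> carrier ?G" "s n (w n f) \<in> carrier ?G" "dif Y (n - 1) (h n p) \<in>
        carrier ?G"
      "dif Y (n - 1) (k n f) \<in> carrier ?G" "h (n + 1) (dif P n p) \<in> carrier ?G"
      "h (n + 1) (\<psi> n f) \<in> carrier ?G" "k (n + 1) (dif F n f) \<in> carrier ?G"
      "\<phi>F n f \<in> carrier ?G"
      using chain_map_closed[OF su p] lin_map_closed[OF sw f] Y.dif_closed'[OF lin_map_closed[OF h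
          p]]
        Y.dif_closed'[OF lin_map_closed[OF k f]] lin_map_closed[OF h P.dif_closed[OF p]]
        lin_map_closed[OF h \<psi>f] lin_map_closed[OF k F.dif_closed[OF f]] lin_map_closed[OF \<phi>F f]
      by (simp_all del: F_simps)
    have 1: "s n (U n x) = s n (u n p) \<oplus>\<^bsub>?G\<^esub> s n (w n f)"
      unfolding U_def x using lin_map_add[OF chain_map_lin[OF s] chain_map_closed[OF u p]
          lin_map_closed[OF w f]]
      by simp
    have 2: "dif Y (n - 1) (H n x) = dif Y (n - 1) (h n p) \<oplus>\<^bsub>?G\<^esub> dif Y (n - 1) (k n f)"
      unfolding H_def x using lin_map_closed[OF h p] lin_map_closed[OF k f]
          by (simp add: Y.dif_add[of _ _ _ n])
    have 3: "H (n + 1) (dif ?T n x) = h (n + 1) (dif P n p) \<oplus>\<^bsub>?G\<^esub> h (n + 1) (\<psi> n f) \<oplus>\<^bsub>?G\<^esub>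
        k (n + 1) (dif F n f)"
      unfolding H_def x using lin_map_add[OF h P.dif_closed[OF p] \<psi>f] by (simp del: F_simps)
    have 4: "dif Y (n - 1) (k n f) = \<phi>F n f \<oplus>\<^bsub>?G\<^esub> \<ominus>\<^bsub>?G\<^esub> h (n + 1) (\<psi> n f) \<oplus>\<^bsub>?G\<^esub> \<ominus>\<^bsub>?G\<^esub> s n (w n f)
        \<oplus>\<^bsub>?G\<^esub> \<ominus>\<^bsub>?G\<^esub> k (n + 1) (dif F n f)"
      using dk[OF f] unfolding \<sigma>_def \<rho>_def by (simp add: koszul_sign_def del: F_simps)
    have "\<phi>F n f = s n (w n f) \<oplus>\<^bsub>?G\<^esub> (h (n + 1) (\<psi> n f) \<oplus>\<^bsub>?G\<^esub> (k (n + 1) (dif F n f) \<oplus>\<^bsub>?G\<^esub>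
        dif Y (n - 1) (k n f)))"
      unfolding 4 using c by (intro Y.P.cancel_three) simp_all
    then have "\<phi> n x = s n (u n p) \<oplus>\<^bsub>?G\<^esub> (dif Y (n - 1) (h n p) \<oplus>\<^bsub>?G\<^esub> h (n + 1) (dif P n p)) \<oplus>\<^bsub>?G\<^esub>
      (s n (w n f) \<oplus>\<^bsub>?G\<^esub> (h (n + 1) (\<psi> n f) \<oplus>\<^bsub>?G\<^esub> (k (n + 1) (dif F n f) \<oplus>\<^bsub>?G\<^esub>
          dif Y (n - 1) (k n f))))"
      unfolding x \<phi>_eq[OF p f] uh[OF p] by simp
    then show ?thesis
      unfolding 1 2 3 using c by (simp add: Y.P.a_ac del: F_simps)
  qed
  ultimately show "\<exists>u h. chain_map A ?T Z u \<and> lin_map A ?T Y (- 1) h \<and>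
    (\<forall>n. \<forall>x\<in>carrier (part ?T n). \<phi> n x =
      s n (u n x) \<oplus>\<^bsub>part Y n\<^esub> (dif Y (n - 1) (h n x) \<oplus>\<^bsub>part Y n\<^esub> h (n + 1) (dif ?T n x)))"
    using H by blast
qed

end

section \<open>Cardinalities and bases\<close>

lemma infinite_Times_lepoll:
  assumes "infinite (UNIV :: 'm set)"
  shows "(UNIV :: ('m \<times> 'm) set) \<lesssim> (UNIV :: 'm set)"
  using card_of_Times_same_infinite[OF assms] card_of_ordIso unfolding lepoll_def
  by (metis UNIV_Times_UNIV bij_betw_def subset_UNIV)

lemma Times_lepoll_infinite:
  assumes "infinite (UNIV :: 'm set)" "A \<lesssim> (UNIV :: 'm set)" "B \<lesssim> (UNIV :: 'm set)"
  shows "A \<times> B \<lesssim> (UNIV :: 'm set)"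
  using lepoll_trans[OF times_lepoll_mono[OF assms(2,3)]] infinite_Times_lepoll[OF assms(1)] by simp

lemma countable_lepoll_infinite:
  assumes "infinite (UNIV :: 'm set)"
  shows "(S :: 'c::countable set) \<lesssim> (UNIV :: 'm set)"
proof -
  have "S \<lesssim> (UNIV :: nat set)"
    unfolding lepoll_def using inj_to_nat by (metis inj_on_subset subset_UNIV)
  then show ?thesis
    using assms infinite_le_lepoll lepoll_trans by blast
qed

text \<open>Iterated pairing is compared only between lists of equal length, where the arbitrary
  code of the empty list is reached on both sides at once; the length is therefore stored beside
  it.\<close>

lemma lists_lepoll_infinite:
  assumes "infinite (UNIV :: 'm set)"
  shows "(UNIV :: 'm list set) \<lesssim> (UNIV :: 'm set)"
proof -
  obtain pr :: "'m \<times> 'm \<Rightarrow> 'm" where pr: "inj pr"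
    using infinite_Times_lepoll[OF assms] unfolding lepoll_def by blast
  obtain \<nu> :: "nat \<Rightarrow> 'm" where \<nu>: "inj \<nu>"
    using countable_lepoll_infinite[OF assms, of "UNIV :: nat set"] unfolding lepoll_def by blast
  define en where "en xs = rec_list undefined (\<lambda>x _ r. pr (x, r)) xs" for xs
  have en: "en xs = en ys \<Longrightarrow> xs = ys" if "length xs = length ys" for xs ys
    using that by (induction rule: list_induct2) (auto simp: en_def dest: injD[OF pr])
  have "inj (\<lambda>xs. pr (\<nu> (length xs), en xs))"
    by (rule injI) (auto dest!: injD[OF pr] injD[OF \<nu>] en)
  then show ?thesis unfolding lepoll_def by blast
qed

text \<open>The graph over the support is finite and determines the function, and a list enumerates
  it. Which list is chosen does not matter, since its set of entries already recovers the
  graph.\<close>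

lemma finite_support_lepoll:
  assumes inf: "infinite (UNIV :: 'm set)" and G: "G \<lesssim> (UNIV :: 'm set)"
      and B: "B \<lesssim> (UNIV :: 'm set)"
  shows "{f. finite {g. f g \<noteq> z} \<and> {g. f g \<noteq> z} \<subseteq> G \<and> range f \<subseteq> B} \<lesssim> (UNIV :: 'm set)"
proof -
  let ?F = "{f. finite {g. f g \<noteq> z} \<and> {g. f g \<noteq> z} \<subseteq> G \<and> range f \<subseteq> B}"
  obtain i :: "_ \<Rightarrow> 'm" where i: "inj_on i (G \<times> B)"
    using Times_lepoll_infinite[OF inf G B] unfolding lepoll_def by blast
  define code where "code f = (SOME l. set l = (\<lambda>g. i (g, f g)) ` {g. f g \<noteq> z})" for f
  have code: "set (code f) = (\<lambda>g. i (g, f g)) ` {g. f g \<noteq> z}" if "f \<in> ?F" for f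
  proof -
    have "\<exists>l. set l = (\<lambda>g. i (g, f g)) ` {g. f g \<noteq> z}"
      using that by (intro finite_list) auto
    then show ?thesis unfolding code_def by (rule someI_ex)
  qed
  have "inj_on code ?F"
  proof (rule inj_onI)
    have le: "f g = f' g" if "f \<in> ?F" "f' \<in> ?F" "code f = code f'" "f g \<noteq> z" for f f' g
    proof -
      have "i (g, f g) \<in> (\<lambda>g. i (g, f' g)) ` {g. f' g \<noteq> z}"
        using code[OF that(1)] code[OF that(2)] that(3,4) by auto
      then obtain g' where g': "f' g' \<noteq> z" "i (g, f g) = i (g', f' g')" by auto
      have "(g, f g) = (g', f' g')"
        by (rule inj_onD[OF i g'(2)]) (use that g' in auto)
      then show ?thesis by blast
    qed
    fix f f' assume "f \<in> ?F" "f' \<in> ?F" "code f = code f'"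
    then show "f = f'" using le[of f f'] le[of f' f] by (metis ext)
  qed
  then have "?F \<lesssim> (UNIV :: 'm list set)" unfolding lepoll_def by blast
  then show ?thesis using lists_lepoll_infinite[OF inf] lepoll_trans by blast
qed

section \<open>Bases of a quotient of vector spaces\<close>

text \<open>Representatives in \<open>U\<close> stand for the elements of the vector space \<open>U / B\<close>.\<close>

locale vspace_mod = abelian_group G
  for G :: "('a, 'b) ring_scheme" (structure) +
  fixes sm :: "'k::field \<Rightarrow> 'a \<Rightarrow> 'a" and U B :: "'a set"
  assumes U_carrier: "U \<subseteq> carrier G"
    and U_add: "\<lbrakk>x \<in> U; y \<in> U\<rbrakk> \<Longrightarrow> x \<oplus> y \<in> U"
    and U_sm: "x \<in> U \<Longrightarrow> sm c x \<in> U"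
    and B_U: "B \<subseteq> U"
    and B_zero: "\<zero> \<in> B"
    and B_add: "\<lbrakk>x \<in> B; y \<in> B\<rbrakk> \<Longrightarrow> x \<oplus> y \<in> B"
    and B_sm: "x \<in> B \<Longrightarrow> sm c x \<in> B"
    and sm_add: "\<lbrakk>x \<in> U; y \<in> U\<rbrakk> \<Longrightarrow> sm c (x \<oplus> y) = sm c x \<oplus> sm c y"
    and sm_plus: "x \<in> U \<Longrightarrow> sm (c + c') x = sm c x \<oplus> sm c' x"
    and sm_times: "x \<in> U \<Longrightarrow> sm (c * c') x = sm c (sm c' x)"
    and sm_one: "x \<in> U \<Longrightarrow> sm 1 x = x"
begin

text \<open>The preimage in \<open>U\<close> of the span of the classes of \<open>S\<close> in
  \<open>U / B\<close>. Generators may be used repeatedly, so a sequence of steps is an arbitrary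
  linear combination.\<close>

inductive_set span_mod :: "'a set \<Rightarrow> 'a set" for S where
  span_mod_B: "x \<in> B \<Longrightarrow> x \<in> span_mod S"
| span_mod_step: "\<lbrakk>y \<in> span_mod S; x \<in> S\<rbrakk> \<Longrightarrow> y \<oplus> sm c x \<in> span_mod S"

lemma UD [simp, intro]: "x \<in> U \<Longrightarrow> x \<in> carrier G"
  using U_carrier by blast

lemma BD [simp, intro]: "x \<in> B \<Longrightarrow> x \<in> U"
  using B_U by blast

lemma sm_zero: "x \<in> U \<Longrightarrow> sm 0 x = \<zero>"
  using sm_plus[of x 0 0] idem_zero[of "sm 0 x"] U_sm by auto

lemma sm_neg: "x \<in> U \<Longrightarrow> sm (- 1) x = \<ominus> x"
  using sm_plus[of x "- 1" 1] sm_zero[of x] sm_one[of x] U_sm[of x "- 1"]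
      add_eq_zero_iff[of "sm (- 1) x" x]
  by simp

lemma span_mod_U: "\<lbrakk>x \<in> span_mod S; S \<subseteq> U\<rbrakk> \<Longrightarrow> x \<in> U"
  by (induction rule: span_mod.induct) (auto intro: U_add U_sm)

lemma span_mod_mono: "\<lbrakk>x \<in> span_mod S; S \<subseteq> T\<rbrakk> \<Longrightarrow> x \<in> span_mod T"
  by (induction rule: span_mod.induct) (auto intro: span_mod.intros)

lemma span_mod_gen: "\<lbrakk>x \<in> S; S \<subseteq> U\<rbrakk> \<Longrightarrow> x \<in> span_mod S"
  using span_mod_step[OF span_mod_B[OF B_zero], of x S 1] by (auto simp: sm_one subset_iff)

lemma span_mod_add:
  assumes "y \<in> span_mod S" "x \<in> span_mod S" "S \<subseteq> U"
  shows "x \<oplus> y \<in> span_mod S"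
  using assms(1)
proof induction
  case (span_mod_B b)
  show ?case
    using assms(2)
  proof induction
    case (span_mod_B x)
    then show ?case using \<open>b \<in> B\<close> by (blast intro: span_mod.span_mod_B B_add)
  next
    case (span_mod_step y x c)
    moreover have "y \<oplus> sm c x \<oplus> b = y \<oplus> b \<oplus> sm c x"
      using span_mod_step(1,2) \<open>b \<in> B\<close> span_mod_U[OF _ assms(3)] U_sm assms(3)
          by (auto simp: a_ac subset_iff)
    ultimately show ?case by (auto intro: span_mod.span_mod_step)
  qed
next
  case (span_mod_step y z c)
  have "x \<oplus> (y \<oplus> sm c z) = x \<oplus> y \<oplus> sm c z"
    using span_mod_step(1,2) span_mod_U[OF _ assms(3)] assms(2,3) U_sm
        by (auto simp: a_assoc subset_iff)
  then show ?case using span_mod_step span_mod.span_mod_step by simp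
qed

lemma span_mod_sm:
  assumes "x \<in> span_mod S" "S \<subseteq> U"
  shows "sm c x \<in> span_mod S"
  using assms(1)
proof induction
  case (span_mod_B x)
  then show ?case by (blast intro: span_mod.span_mod_B B_sm)
next
  case (span_mod_step y x c')
  have "sm c (y \<oplus> sm c' x) = sm c y \<oplus> sm (c * c') x"
    using span_mod_step(1,2) span_mod_U[OF _ assms(2)] assms(2) U_sm
        by (auto simp: sm_add sm_times subset_iff)
  then show ?case using span_mod_step span_mod.span_mod_step by simp
qed

lemma span_mod_insert:
  assumes "y \<in> span_mod (insert x S)" "insert x S \<subseteq> U"
  shows "\<exists>c. \<exists>z\<in>span_mod S. y = z \<oplus> sm c x"
  using assms(1)
proof induction
  case (span_mod_B y)
  then have "y \<in> span_mod S" "y = y \<oplus> sm 0 x"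
    using assms(2) by (auto intro: span_mod.span_mod_B simp: sm_zero)
  then show ?case by blast
next
  case (span_mod_step y x' c')
  then obtain c z where z: "z \<in> span_mod S" "y = z \<oplus> sm c x" by blast
  have S: "S \<subseteq> U" "x \<in> U" "z \<in> U" "x' \<in> U" using assms(2) z span_mod_U span_mod_step(2) by auto
  show ?case
  proof (cases "x' = x")
    case True
    then have "y \<oplus> sm c' x' = z \<oplus> sm (c + c') x"
      using S z U_sm by (simp add: sm_plus a_assoc)
    then show ?thesis using z by blast
  next
    case False
    then have "z \<oplus> sm c' x' \<in> span_mod S" using z span_mod_step(2)
        by (auto intro: span_mod.span_mod_step)
    moreover have "y \<oplus> sm c' x' = z \<oplus> sm c' x' \<oplus> sm c x"
      using S z U_sm by (simp add: a_ac)
    ultimately show ?thesis by blast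
  qed
qed

lemma span_mod_cancel:
  assumes "z \<oplus> sm c x \<in> span_mod S" "z \<in> span_mod S" "c \<noteq> 0" "S \<subseteq> U" "x \<in> U"
  shows "x \<in> span_mod S"
proof -
  have z: "z \<in> U" using assms span_mod_U by blast
  have "z \<oplus> sm c x \<oplus> sm (- 1) z \<in> span_mod S"
    by (rule span_mod_add[OF span_mod_sm[OF assms(2,4)] assms(1,4)])
  then have "sm c x \<in> span_mod S"
    using z assms(5) U_sm by (simp add: sm_neg add_diff_cancel)
  from span_mod_sm[OF this assms(4), of "inverse c"] show ?thesis
    using assms by (simp add: sm_times[symmetric] sm_one)
qed

text \<open>A combination involves finitely many generators, and a member of the chain contains them
  all. The removed element \<open>g\<close> is carried along because the lemma is used for
  independence.\<close>

lemma span_mod_chain: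
  assumes "x \<in> span_mod (\<Union>\<C> - {g})" "\<C> \<noteq> {}" "\<And>S T. \<lbrakk>S \<in> \<C>; T \<in> \<C>\<rbrakk> \<Longrightarrow> S \<subseteq> T \<or> T \<subseteq> S"
  shows "\<exists>S\<in>\<C>. x \<in> span_mod (S - {g})"
  using assms(1)
proof induction
  case (span_mod_B x)
  then show ?case using assms(2) by (auto intro: span_mod.span_mod_B)
next
  case (span_mod_step y x c)
  then obtain S T where S: "S \<in> \<C>" "y \<in> span_mod (S - {g})" and T: "T \<in> \<C>" "x \<in> T - {g}" by blast
  show ?case
  proof (cases "S \<subseteq> T")
    case True
    then have "y \<in> span_mod (T - {g})" using S span_mod_mono[of y "S - {g}"] by blast
    then show ?thesis using T by (blast intro: span_mod.span_mod_step)
  next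
    case False
    then have "T \<subseteq> S" using assms(3) S T by blast
    then show ?thesis using S T by (blast intro: span_mod.span_mod_step)
  qed
qed

text \<open>Zorn's lemma for independent subsets. Spans contain \<open>B\<close>, so independence
  also keeps the elements of \<open>B\<close> out of the basis; this later rules out cells over
  coboundaries.\<close>

lemma exists_basis:
  obtains S where "S \<subseteq> U" "\<And>x. x \<in> S \<Longrightarrow> x \<notin> span_mod (S - {x})" "U \<subseteq> span_mod S"
proof -
  define I where "I = {S. S \<subseteq> U \<and> (\<forall>x\<in>S. x \<notin> span_mod (S - {x}))}"
  have "\<exists>M\<in>I. \<forall>T\<in>I. M \<subseteq> T \<longrightarrow> T = M"
  proof (rule subset_Zorn_nonempty)
    show "I \<noteq> {}" unfolding I_def by blast
    fix \<C> assume ne: "\<C> \<noteq> {}" and "subset.chain I \<C>"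
    then have C: "\<C> \<subseteq> I" and ch: "\<And>S T. \<lbrakk>S \<in> \<C>; T \<in> \<C>\<rbrakk> \<Longrightarrow> S \<subseteq> T \<or> T \<subseteq> S"
      by (auto simp: subset_chain_def)
    have "x \<notin> span_mod (\<Union>\<C> - {x})" if x: "x \<in> \<Union>\<C>" for x
    proof
      assume "x \<in> span_mod (\<Union>\<C> - {x})"
      then obtain S where S: "S \<in> \<C>" "x \<in> span_mod (S - {x})" using span_mod_chain[OF _ ne ch]
          by blast
      obtain T where T: "T \<in> \<C>" "x \<in> T" using x by blast
      show False
      proof (cases "S \<subseteq> T")
        case True
        then have "x \<in> span_mod (T - {x})" using S span_mod_mono[of x "S - {x}"] by blast
        then show False using T C unfolding I_def by blast
      next
        case False
        then have "x \<in> S" using ch S T by blast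
        then show False using S C unfolding I_def by blast
      qed
    qed
    then show "\<Union>\<C> \<in> I" using C unfolding I_def by blast
  qed
  then obtain S where S: "S \<in> I" and max: "\<And>T. \<lbrakk>T \<in> I; S \<subseteq> T\<rbrakk> \<Longrightarrow> T = S" by blast
  then have SU: "S \<subseteq> U" and ind: "\<And>x. x \<in> S \<Longrightarrow> x \<notin> span_mod (S - {x})" unfolding I_def by auto
  have "U \<subseteq> span_mod S"
  proof
    fix x assume x: "x \<in> U"
    show "x \<in> span_mod S"
    proof (rule ccontr)
      assume nx: "x \<notin> span_mod S"
      then have xS: "x \<notin> S" using span_mod_gen SU by blast
      have "y \<notin> span_mod (insert x S - {y})" if y: "y \<in> insert x S" for y
      proof
        assume sp: "y \<in> span_mod (insert x S - {y})"
        show False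
        proof (cases "y = x")
          case True
          then show False using sp nx xS by simp
        next
          case False
          then have yS: "y \<in> S" using y by simp
          \<comment> \<open>Exchange: write \<open>y\<close> as \<open>z\<close> plus
            \<open>c\<close> times \<open>x\<close> with \<open>z\<close> spanned by the other
            elements. If \<open>c = 0\<close> the independence of \<open>S\<close> fails, otherwise
            \<open>x\<close> lies in the span of \<open>S\<close>.\<close>
          have "insert x S - {y} = insert x (S - {y})" using False by blast
          then obtain c z where z: "z \<in> span_mod (S - {y})" "y = z \<oplus> sm c x"
            using sp span_mod_insert[of y x "S - {y}"] x SU by auto
          have zS: "z \<in> span_mod S" using z(1) span_mod_mono by blast
          show False
          proof (cases "c = 0")
            case True
            then have "y = z" using z x span_mod_U[of z S] zS SU by (simp add: sm_zero)
            then show False using ind[OF yS] z(1) by simp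
          next
            case False
            then show False using span_mod_cancel[of z c x S] zS span_mod_gen[OF yS SU] z(2) SU x nx
                by simp
          qed
        qed
      qed
      then have "insert x S \<in> I" using x SU unfolding I_def by blast
      then show False using max[of "insert x S"] xS by blast
    qed
  qed
  then show ?thesis using that SU ind by blast
qed

end

section \<open>Killing cohomology\<close>

text \<open>All that the resolution uses of the bound quiver algebra. The idempotents are
  homogeneous cocycles and stand for conjugates of the vertex idempotents; \<open>ht\<close> bounds
  the lengths of chains of nonzero maps between distinct projectives \<open>e v A\<close>.\<close>

locale directed_dg_algebra = dg_algebra A
  for A :: "('k::field, 'a, 'x) dg_algebra_scheme" (structure) +
  fixes V :: "'v set" and e :: "'v \<Rightarrow> 'a" and ht :: "'v \<Rightarrow> nat" and d :: nat
  assumes finite_V: "finite V"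
    and e_gr: "v \<in> V \<Longrightarrow> e v \<in> gr A 0"
    and e_idem: "v \<in> V \<Longrightarrow> e v \<otimes> e v = e v"
    and e_sum: "finsum A e V = \<one>"
    and e_adif: "v \<in> V \<Longrightarrow> adif A (e v) = \<zero>"
    and gr_bounds: "n \<notin> {- int d..0} \<Longrightarrow> gr A n = {\<zero>}"
    and triangular: "\<lbrakk>v \<in> V; w \<in> V; a \<in> carrier A; e v \<otimes> a = a; a \<otimes> e w = a; a \<noteq> \<zero>\<rbrakk> \<Longrightarrow>
      (v = w \<and> (\<exists>c. a = c \<odot> e v)) \<or> ht w < ht v"
begin

text \<open>That is, \<open>e v\<close> annihilates the cohomology of \<open>K\<close> in degree
  \<open>n\<close>. The primitive is not asked to lie at \<open>v\<close>; acting on it by the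
  cocycle \<open>e v\<close> would move it there.\<close>

definition vanish :: "('a, 'q) dg_module \<Rightarrow> int \<Rightarrow> 'v \<Rightarrow> bool" where
  "vanish K n v \<longleftrightarrow> (\<forall>x\<in>carrier (part K n). dif K n x = \<zero>\<^bsub>part K (n + 1)\<^esub> \<longrightarrow> act K n 0 x (e v) = x \<longrightarrow>
    (\<exists>y\<in>carrier (part K (n - 1)). x = dif K (n - 1) y))"

lemma e_carrier [simp]: "v \<in> V \<Longrightarrow> e v \<in> carrier A"
  using e_gr gr_carrier by blast

lemma scal_gr: "v \<in> V \<Longrightarrow> c \<odot> e v \<in> gr A 0"
  using e_gr gr_smult by blast

lemma scal_adif: "v \<in> V \<Longrightarrow> adif A (c \<odot> e v) = \<zero>"
proof -
  assume v: "v \<in> V"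
  have "adif A (c \<odot> e v) = c \<odot> \<zero>" using v by (simp add: adif_smult e_adif)
  also have "\<dots> = \<zero>"
  proof (rule idem_zero)
    show "c \<odot> \<zero> \<oplus> c \<odot> \<zero> = c \<odot> \<zero>"
      using vs.smult_r_distr[of c \<zero> \<zero>] by (simp add: scalar_ring_def)
    show "c \<odot> \<zero> \<in> carrier A" using gr_smult[OF gr_zero[of 0]] gr_carrier by blast
  qed
  finally show ?thesis .
qed

text \<open>Multiples of \<open>e v\<close> are cocycles of degree 0. Through them the field acts on
  the part of \<open>K\<close> at \<open>v\<close>.\<close>

lemma dif_act_scal:
  assumes "dg_module A K" "x \<in> carrier (part K n)" "v \<in> V"
  shows "dif K n (act K n 0 x (c \<odot> e v)) = act K (n + 1) 0 (dif K n x) (c \<odot> e v)"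
proof -
  interpret K: dg_module A K by fact
  have "act K n 1 x (adif A (c \<odot> e v)) = \<zero>\<^bsub>part K (n + 1)\<^esub>"
    unfolding scal_adif[OF assms(3)] by (rule K.act_zero_right[OF assms(2) refl])
  then show ?thesis
    using K.dif_act[OF assms(2) scal_gr[OF assms(3)], of c]
      K.act_closed[OF K.dif_closed[OF assms(2)] scal_gr[OF assms(3)], of c] by simp
qed

lemma smult_one: "v \<in> V \<Longrightarrow> 1 \<odot> e v = e v"
  using vs.smult_one[of "e v"] by (simp add: scalar_ring_def)

lemma dif_act_e:
  assumes "dg_module A K" "x \<in> carrier (part K n)" "v \<in> V"
  shows "dif K n (act K n 0 x (e v)) = act K (n + 1) 0 (dif K n x) (e v)"
  using dif_act_scal[OF assms, of 1] assms(3) by (simp add: smult_one)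

text \<open>Since the idempotents sum to the unit, \<open>x\<close> is the sum of its components at
  the vertices, and each of them is again a cocycle.\<close>

lemma exact_of_vanish:
  assumes K: "dg_module A K" and vn: "\<And>v. v \<in> V \<Longrightarrow> vanish K n v"
    and x: "x \<in> carrier (part K n)" "dif K n x = \<zero>\<^bsub>part K (n + 1)\<^esub>"
  shows "\<exists>y\<in>carrier (part K (n - 1)). x = dif K (n - 1) y"
proof -
  interpret K: dg_module A K by fact
  have "\<exists>y\<in>carrier (part K (n - 1)). act K n 0 x (e v) = dif K (n - 1) y" if v: "v \<in> V" for v
  proof -
    have xv: "act K n 0 x (e v) \<in> carrier (part K n)" using K.act_closed[OF x(1) e_gr[OF v]] by simp
    moreover have "dif K n (act K n 0 x (e v)) = \<zero>\<^bsub>part K (n + 1)\<^esub>"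
      using dif_act_e[OF K x(1) v] x(2) K.act_zero_left[OF e_gr[OF v], of "n + 1" "n + 1"] by simp
    moreover have "act K n 0 (act K n 0 x (e v)) (e v) = act K n 0 x (e v)"
      using K.act_act[OF x(1) e_gr[OF v] e_gr[OF v]] e_idem[OF v] by simp
    ultimately show ?thesis using vn[OF v] unfolding vanish_def by blast
  qed
  then obtain y where y: "\<And>v. v \<in> V \<Longrightarrow> y v \<in> carrier (part K (n - 1))"
    "\<And>v. v \<in> V \<Longrightarrow> act K n 0 x (e v) = dif K (n - 1) (y v)" by metis
  \<comment> \<open>The membership in degree 0 is part of the induction because the action is
    additive only within one degree of the algebra.\<close>
  have sum: "act K n 0 x (finsum A e W) = dif K (n - 1) (finsum (part K (n - 1)) y W) \<and>
      finsum A e W \<in> gr A 0"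
    if "W \<subseteq> V" for W
    using finite_subset[OF that finite_V] that
  proof (induction W)
    case empty
    then show ?case using K.act_zero_right[OF x(1)] K.dif_zero[of n "n - 1"] by simp
  next
    case (insert v W)
    then have v: "v \<in> V" and W: "W \<subseteq> V" by auto
    have "finsum A e (insert v W) = e v \<oplus> finsum A e W"
      using insert v W by (subst finsum_insert) (auto simp: subset_iff)
    moreover have "finsum (part K (n - 1)) y (insert v W) = y v \<oplus>\<^bsub>part K (n - 1)\<^esub>
        finsum (part K (n - 1)) y W"
      using insert v W y by (subst K.P.finsum_insert) (auto simp: subset_iff)
    moreover have "finsum (part K (n - 1)) y W \<in> carrier (part K (n - 1))"
      using W y by (intro K.P.finsum_closed) auto
    ultimately show ?case
      using insert.IH[OF W] y v x K.act_add_right'[OF x(1) e_gr[OF v], of "finsum A e W" n]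
        K.dif_add[of "y v" "n - 1" "finsum (part K (n - 1)) y W" n] gr_add[OF e_gr[OF v]] by simp
  qed
  have "x = dif K (n - 1) (finsum (part K (n - 1)) y V)"
    using sum[of V] K.act_one[OF x(1)] by (simp add: e_sum)
  moreover have "finsum (part K (n - 1)) y V \<in> carrier (part K (n - 1))"
    using y by (intro K.P.finsum_closed) auto
  ultimately show ?thesis by blast
qed

section \<open>Cohomology at a vertex and its annihilation by cells\<close>

context
  fixes K :: "('a, 'q) dg_module"
  assumes K: "dg_module A K"
begin

interpretation K: dg_module A K by (rule K)

definition cyc :: "int \<Rightarrow> 'v \<Rightarrow> 'q set" where
  "cyc n v = {x \<in> carrier (part K n). dif K n x = \<zero>\<^bsub>part K (n + 1)\<^esub> \<and> act K n 0 x (e v) = x}"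

definition bdr :: "int \<Rightarrow> 'v \<Rightarrow> 'q set" where
  "bdr n v = {x \<in> cyc n v. \<exists>y\<in>carrier (part K (n - 1)). x = dif K (n - 1) y}"

lemma cyc_scal:
  assumes v: "v \<in> V" and x: "x \<in> cyc n v"
  shows "act K n 0 x (c \<odot> e v) \<in> cyc n v"
proof -
  have x': "x \<in> carrier (part K n)" "dif K n x = \<zero>\<^bsub>part K (n + 1)\<^esub>" using x unfolding cyc_def
      by auto
  have "(c \<odot> e v) \<otimes> e v = c \<odot> e v"
    using smult_mult_left[of "e v" "e v" c] v by (simp add: e_idem)
  then have "act K n 0 (act K n 0 x (c \<odot> e v)) (e v) = act K n 0 x (c \<odot> e v)"
    using K.act_act[OF x'(1) scal_gr[OF v] e_gr[OF v], of c] by simp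
  moreover have "dif K n (act K n 0 x (c \<odot> e v)) = \<zero>\<^bsub>part K (n + 1)\<^esub>"
    using dif_act_scal[OF K x'(1) v] x'(2) K.act_zero_left[OF scal_gr[OF v], of "n + 1" "n + 1"]
        by simp
  ultimately show ?thesis
    using K.act_closed[OF x'(1) scal_gr[OF v], of c] unfolding cyc_def by simp
qed

lemma vspace_mod_cohomology:
  assumes v: "v \<in> V"
  shows "vspace_mod (part K n) (\<lambda>c x. act K n 0 x (c \<odot> e v)) (cyc n v) (bdr n v)"
proof -
  have cD: "x \<in> carrier (part K n)" "dif K n x = \<zero>\<^bsub>part K (n + 1)\<^esub>" "act K n 0 x (e v) =
      x" if "x \<in> cyc n v" for x
    using that unfolding cyc_def by auto
  have cyc_add: "x \<oplus>\<^bsub>part K n\<^esub> y \<in> cyc n v" if "x \<in> cyc n v" "y \<in> cyc n v" for x y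
    using cD[OF that(1)] cD[OF that(2)] K.act_add_left'[of x n y "e v" 0 n, OF _ _ e_gr[OF v]]
    unfolding cyc_def by (simp add: K.dif_add[of _ _ _ "n + 1"])
  show ?thesis
  proof (intro vspace_mod.intro vspace_mod_axioms.intro K.part_group, goal_cases)
    case 1
    then show ?case by (auto simp: cyc_def)
  next
    case (2 x y)
    then show ?case by (rule cyc_add)
  next
    case (3 x c)
    then show ?case by (rule cyc_scal[OF v])
  next
    case 4
    then show ?case by (auto simp: bdr_def)
  next
    case 5
    have "\<zero>\<^bsub>part K n\<^esub> = dif K (n - 1) \<zero>\<^bsub>part K (n - 1)\<^esub>" using K.dif_zero[of n "n - 1"] by simp
    moreover have "\<zero>\<^bsub>part K n\<^esub> \<in> cyc n v"
      using K.act_zero_left[OF e_gr[OF v], of n n] K.dif_zero[of "n + 1" n] unfolding cyc_def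
          by simp
    ultimately show ?case unfolding bdr_def by blast
  next
    case (6 x y)
    then obtain x' y' where *: "x' \<in> carrier (part K (n - 1))" "x = dif K (n - 1) x'"
      "y' \<in> carrier (part K (n - 1))" "y = dif K (n - 1) y'" unfolding bdr_def by blast
    then have "x \<oplus>\<^bsub>part K n\<^esub> y = dif K (n - 1) (x' \<oplus>\<^bsub>part K (n - 1)\<^esub> y')"
      by (simp add: K.dif_add[of _ _ _ n])
    then show ?case using 6 * cyc_add unfolding bdr_def by blast
  next
    case (7 x c)
    then obtain y where y: "y \<in> carrier (part K (n - 1))" "x = dif K (n - 1) y" unfolding bdr_def
        by blast
    have "act K n 0 x (c \<odot> e v) = dif K (n - 1) (act K (n - 1) 0 y (c \<odot> e v))"
      using dif_act_scal[OF K y(1) v, of c] y(2) by simp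
    moreover have "act K (n - 1) 0 y (c \<odot> e v) \<in> carrier (part K (n - 1))"
      using K.act_closed[OF y(1) scal_gr[OF v]] by simp
    ultimately show ?case using 7 cyc_scal[OF v] unfolding bdr_def by blast
  next
    case (8 x y c)
    then show ?case using cD K.act_add_left'[OF _ _ scal_gr[OF v], of x n y n] by simp
  next
    case (9 x c c')
    have "(c + c') \<odot> e v = c \<odot> e v \<oplus> c' \<odot> e v"
      using vs.smult_l_distr[of c c' "e v"] v by (simp add: scalar_ring_def)
    then show ?case using 9 cD K.act_add_right'[OF _ scal_gr[OF v] scal_gr[OF v], of x n n] by simp
  next
    case (10 x c c')
    \<comment> \<open>For a right action the scalar that acts first is the left factor.\<close>
    have "(c * c') \<odot> e v = (c' \<odot> e v) \<otimes> (c \<odot> e v)"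
      using vs.smult_assoc1[of c c' "e v"] v smult_mult_right[of "c' \<odot> e v" "e v" c]
          smult_mult_left[of "e v" "e v" c']
        scal_gr[OF v, THEN gr_carrier] by (simp add: scalar_ring_def e_idem)
    then show ?case using 10 cD K.act_act[OF _ scal_gr[OF v] scal_gr[OF v], of x n] by simp
  next
    case (11 x)
    then show ?case using cD by (simp add: smult_one[OF v])
  qed
qed

text \<open>
  The cells \<open>(n, v, x)\<close> range over bases of the cohomology of \<open>K\<close> at the vertices, and
  \<open>w\<close> sends such a cell to the cocycle \<open>x\<close>. A new cocycle has a component in
  \<open>e v A e j\<close> for some cell at \<open>v\<close>. If \<open>ht j \<ge> h\<close>, triangularity leaves only
  multiples of \<open>e j\<close>, which are excluded by independence.
\<close>

lemma kill_cohomology: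
  assumes vanish: "\<And>n v. \<lbrakk>v \<in> V; n < a \<or> Suc h \<le> ht v\<rbrakk> \<Longrightarrow> vanish K n v"
  obtains G dg vt w where "free_gens A (G :: (int \<times> 'v \<times> 'q) set) vt"
    "G \<subseteq> UNIV \<times> V \<times> UNIV" "\<And>g. g \<in> G \<Longrightarrow> a \<le> dg g + 1" "twisting A (free_module A G dg vt) K w"
    "\<And>n v. \<lbrakk>v \<in> V; n < a - (int d + 1) \<or> h \<le> ht v\<rbrakk> \<Longrightarrow>
      vanish (twisted_sum K (free_module A G dg vt) w) n v"
proof -
  define sp where "sp n v = vspace_mod.span_mod (part K n) (\<lambda>c x. act K n 0 x (c \<odot> e v)) (bdr n v)"
      for n v
  define S where "S n v = (SOME S. S \<subseteq> cyc n v \<and> (\<forall>x\<in>S. x \<notin> sp n v (S - {x})) \<and> cyc n v \<subseteq> sp n v S)"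
      for n v
  have S: "S n v \<subseteq> cyc n v \<and> (\<forall>x\<in>S n v. x \<notin> sp n v (S n v - {x})) \<and> cyc n v \<subseteq> sp n v (S n v)"
      if v: "v \<in> V" for n v
  proof -
    have "\<exists>S. S \<subseteq> cyc n v \<and> (\<forall>x\<in>S. x \<notin> sp n v (S - {x})) \<and> cyc n v \<subseteq> sp n v S"
      unfolding sp_def by (rule vspace_mod.exists_basis[OF vspace_mod_cohomology[OF v, of n]]) blast
    then show ?thesis unfolding S_def by (rule someI_ex)
  qed
  define G where "G = {(n, v, x). v \<in> V \<and> x \<in> S n v}"
  \<comment> \<open>A cell lies one degree below its cocycle because the twisting \<open>w\<close>
    has degree 1.\<close>
  define dg :: "int \<times> 'v \<times> 'q \<Rightarrow> int" where "dg = (\<lambda>(n, v, x). n - 1)"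
  define vt :: "int \<times> 'v \<times> 'q \<Rightarrow> 'a" where "vt = (\<lambda>(n, v, x). e v)"
  \<comment> \<open>Basis elements are not coboundaries, so cells occur only where cohomology is
    left; hence the bounds on the degree and height of cells.\<close>
  have not_vanish: "\<not> vanish K n v" if "(n, v, x) \<in> G" for n v x
  proof
    assume "vanish K n v"
    have v: "v \<in> V" and x: "x \<in> S n v" using that unfolding G_def by auto
    interpret B: vspace_mod "part K n" "\<lambda>c x. act K n 0 x (c \<odot> e v)" "cyc n v" "bdr n v"
      by (rule vspace_mod_cohomology[OF v])
    have "x \<in> bdr n v" using \<open>vanish K n v\<close> S[OF v] x unfolding vanish_def bdr_def cyc_def by blast
    then have "x \<in> sp n v (S n v - {x})" unfolding sp_def by (rule B.span_mod_B)
    then show False using S[OF v] x by blast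
  qed
  then have G_bounds: "a \<le> n" "ht v \<le> h" "v \<in> V" "x \<in> S n v" if "(n, v, x) \<in> G" for n v x
    using vanish[of v n] that unfolding G_def by fastforce+
  have gens: "free_gens A G vt"
    by (unfold_locales) (auto simp: G_def vt_def e_gr e_idem e_adif)
  interpret free_gens A G dg vt by (rule gens)
  have Gx: "x \<in> carrier (part K n)" "dif K n x = \<zero>\<^bsub>part K (n + 1)\<^esub>" "act K n 0 x (e v) =
      x" if "(n, v, x) \<in> G" for n v x
    using that S[of v n] unfolding G_def cyc_def by auto
  obtain w where w: "lin_map A F K 1 w" and w_gen: "\<And>g. g \<in> G \<Longrightarrow> w (dg g) (gen g) = snd (snd g)"
  proof (rule lin_map_extend[OF K, of "\<lambda>g. snd (snd g)" 1])
    fix g assume "g \<in> G"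
    then show "snd (snd g) \<in> carrier (part K (dg g + 1))"
      "act K (dg g + 1) 0 (snd (snd g)) (vt g) = snd (snd g)"
      using Gx by (auto simp: dg_def vt_def split: prod.splits)
  qed blast
  \<comment> \<open>Basis elements are cocycles, so the graded commutator of \<open>w\<close> with
    the differential vanishes on generators and hence everywhere. For degree 1 this is the twisting
    condition.\<close>
  have dw: "dif K (n + 1) (w n f) = \<ominus>\<^bsub>part K (n + 1 + 1)\<^esub> w (n + 1) (dif F n f)"
    if f: "f \<in> carrier (part F n)" for n f
  proof -
    have "dif K (dg g + 1) (w (dg g) (gen g)) = \<zero>\<^bsub>part K (dg g + (1 + 1))\<^esub>" if "g \<in> G" for g
      using w_gen[OF that] Gx that by (auto simp: dg_def add.commute split: prod.splits)
    from dif_lin_map[OF K w zero_lin_map[OF F_dg_module K] this f]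
    show ?thesis
      using lin_map_closed[OF w F.dif_closed[OF f] refl]
      by (simp add: koszul_sign_def add.commute[of n 2] del: F_simps)
  qed
  then have tw: "twisting A F K w" unfolding twisting_def using w by blast
  show ?thesis
  proof (rule that[OF gens _ _ tw])
    show "G \<subseteq> UNIV \<times> V \<times> UNIV" unfolding G_def by auto
    show "a \<le> dg g + 1" if "g \<in> G" for g using that G_bounds(1)
        by (auto simp: dg_def split: prod.splits)
  next
    fix n j assume j: "j \<in> V" and nj: "n < a - (int d + 1) \<or> h \<le> ht j"
    note e_j = e_gr[OF j]
    show "vanish (twisted_sum K F w) n j"
      unfolding vanish_def
    proof (intro ballI impI)
      fix x assume "x \<in> carrier (part (twisted_sum K F w) n)"
        and dx: "dif (twisted_sum K F w) n x = \<zero>\<^bsub>part (twisted_sum K F w) (n + 1)\<^esub>"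
        and xe: "act (twisted_sum K F w) n 0 x (e j) = x"
      then obtain k f where x: "x = (k, f)" and k: "k \<in> carrier (part K n)"
          and f: "f \<in> carrier (part F n)"
        by auto
      have dk: "dif K n k \<oplus>\<^bsub>part K (n + 1)\<^esub> w n f = \<zero>\<^bsub>part K (n + 1)\<^esub>" and df: "dif F n f = (\<lambda>_. \<zero>)"
        and ke: "act K n 0 k (e j) = k" and fe: "\<And>g. f g \<otimes> e j = f g"
        using dx xe unfolding x by (auto simp: fun_eq_iff)
      have supp: "m = n + 1 \<and> v = j \<and> (\<exists>c. f (m, v, y) = c \<odot> e j)" if nz: "f (m, v, y) \<noteq> \<zero>"
          for m v y
      proof -
        have g: "(m, v, y) \<in> G" using F_outside[OF f] nz by blast
        have gr: "f (m, v, y) \<in> gr A (n + 1 - m)" by (rule F_gr[OF f]) (simp add: dg_def)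
        have ve: "e v \<otimes> f (m, v, y) = f (m, v, y)" using F_vt[OF f g] by (simp add: vt_def)
        \<comment> \<open>The origin of the drop by \<open>d + 1\<close>: coefficients have degree
          at least \<open>- d\<close>, and the cell has degree \<open>m - 1\<close> with
          \<open>a \<le> m\<close>, so a nonzero coefficient forces
          \<open>n \<ge> a - (d + 1)\<close>.\<close>
        have "n + 1 - m \<ge> - int d" using gr_bounds[of "n + 1 - m"] gr nz by auto
        then have "\<not> n < a - (int d + 1)" using G_bounds(1)[OF g] by auto
        then have "\<not> ht j < ht v" using nj G_bounds(2)[OF g] by auto
        then obtain c where c: "v = j" "f (m, v, y) = c \<odot> e v"
          using triangular[OF G_bounds(3)[OF g] j F_carrier[OF f] ve fe nz] by blast
        moreover have "n + 1 - m = 0"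
          using gr_disjoint[OF gr, of 0] scal_gr[OF j, of c] c nz by auto
        ultimately show ?thesis by auto
      qed
      have "f = (\<lambda>_. \<zero>)"
      proof (rule ccontr)
        assume "f \<noteq> (\<lambda>_. \<zero>)"
        then obtain m v x0 where nz: "f (m, v, x0) \<noteq> \<zero>" by (auto simp: fun_eq_iff)
        then have mv: "m = n + 1" "v = j" using supp by blast+
        define g0 where "g0 = (n + 1, j, x0)"
        have g0: "g0 \<in> G" "x0 \<in> S (n + 1) j" using F_outside[OF f] nz mv unfolding g0_def G_def
            by auto
        obtain c where c: "f g0 = c \<odot> e j" using supp[OF nz] mv unfolding g0_def by blast
        interpret B: vspace_mod "part K (n + 1)" "\<lambda>c x. act K (n + 1) 0 x (c \<odot> e j)" "cyc (n + 1) j"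
            "bdr (n + 1) j"
          by (rule vspace_mod_cohomology[OF j])
        have S_cyc: "S (n + 1) j \<subseteq> cyc (n + 1) j" using S[OF j] by blast
        \<comment> \<open>Stated for all restrictions of \<open>f\<close> with support over
          \<open>T\<close>, since the induction deletes generators one by one.\<close>
        have span: "w n f' \<in> B.span_mod T" if "f' \<in> carrier (part F n)"
          and T: "T \<subseteq> cyc (n + 1) j" "\<And>g. f' g \<noteq> \<zero> \<Longrightarrow> f' g = f g \<and> snd (snd g) \<in> T" for f' T
          using that(1) T(2)
        proof (induction f' rule: F_induct)
          case zero
          then show ?case
            using lin_map_zero[OF F_dg_module K w refl, of n] B.span_mod_B[OF B.B_zero] by simp
        next
          case (upd f' g)
          obtain m v y where gg: "g = (m, v, y)" by (cases g)
          have "f' g = f g" and "y \<in> T" using upd(5)[OF upd(3)] by (simp_all add: gg)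
          then have mv: "m = n + 1" "v = j" using supp[of m v y] upd(3) unfolding gg by simp_all
          have y: "g = (n + 1, j, y)" "y \<in> T" "y \<in> cyc (n + 1) j"
            using gg mv \<open>y \<in> T\<close> T(1) by auto
          obtain c where c: "f' g = c \<odot> e j" using supp[of "n + 1" j y] upd(3) \<open>f' g =
              f g\<close> unfolding y(1) by auto
          have "w n f' = act K (n + 1) 0 y (c \<odot> e j) \<oplus>\<^bsub>part K (n + 1)\<^esub> w n (f'(g := \<zero>))"
            using lin_map_split[OF K w upd(1,2)] w_gen[OF upd(2)] unfolding c
                by (simp add: y(1) dg_def)
          also have "\<dots> = w n (f'(g := \<zero>)) \<oplus>\<^bsub>part K (n + 1)\<^esub> act K (n + 1) 0 y (c \<odot> e j)"
            using lin_map_closed[OF w F_upd_closed[OF upd(1)] refl] B.U_sm[OF y(3)]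
            by (intro K.P.a_comm) (auto dest: B.UD)
          finally have eq: "w n f' = w n (f'(g := \<zero>)) \<oplus>\<^bsub>part K (n + 1)\<^esub> act K (n + 1) 0 y (c \<odot> e j)"
              .
          have "w n (f'(g := \<zero>)) \<in> B.span_mod T"
          proof (rule upd(4))
            fix g' assume "(f'(g := \<zero>)) g' \<noteq> \<zero>"
            then show "(f'(g := \<zero>)) g' = f g' \<and> snd (snd g') \<in> T"
              using upd(5)[of g'] by (cases "g' = g") simp_all
          qed
          then show ?case unfolding eq using y(2) by (rule B.span_mod_step)
        qed
        \<comment> \<open>The cocycle equation in the twisted sum turns the combination
          \<open>w n f\<close> of basis elements into a coboundary, although its coefficient at
          \<open>x0\<close> is nonzero.\<close>
        have "w n f = dif K n (\<ominus>\<^bsub>part K n\<^esub> k)"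
          using dk k lin_map_closed[OF w f refl] K.dif_closed[OF k]
          by (simp add: K.dif_minus[of _ _ "n + 1"] K.P.add_eq_zero_iff)
        moreover have "dif K (n + 1) (dif K n (\<ominus>\<^bsub>part K n\<^esub> k)) = \<zero>\<^bsub>part K (n + 1 + 1)\<^esub>"
          using k K.dif_dif[of "\<ominus>\<^bsub>part K n\<^esub> k" n] by simp
        moreover have "act K (n + 1) 0 (w n f) (e j) = w n f"
        proof -
          have "act F n 0 f (e j) = f" using fe by auto
          then show ?thesis using lin_map_act[OF w f e_j, of n "n + 1"] by simp
        qed
        ultimately have "w n f \<in> bdr (n + 1) j"
          using k lin_map_closed[OF w f refl] unfolding bdr_def cyc_def by auto
        then have wf: "w n f \<in> B.span_mod (S (n + 1) j - {x0})" by (rule B.span_mod_B)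
        have "w n (f(g0 := \<zero>)) \<in> B.span_mod (S (n + 1) j - {x0})"
        proof (rule span[OF F_upd_closed[OF f]])
          show "S (n + 1) j - {x0} \<subseteq> cyc (n + 1) j" using S_cyc by blast
          fix g assume "(f(g0 := \<zero>)) g \<noteq> \<zero>"
          then have g: "g \<noteq> g0" "f g \<noteq> \<zero>" by (auto split: if_splits)
          obtain m v y where gg: "g = (m, v, y)" by (cases g)
          then have "m = n + 1" "v = j" using supp[of m v y] g by blast+
          moreover have "g \<in> G" using F_outside[OF f] g by blast
          ultimately show "(f(g0 := \<zero>)) g = f g \<and> snd (snd g) \<in> S (n + 1) j - {x0}"
            using g gg unfolding g0_def G_def by auto
        qed
        moreover have "w n f = w n (f(g0 := \<zero>)) \<oplus>\<^bsub>part K (n + 1)\<^esub> act K (n + 1) 0 x0 (c \<odot> e j)"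
        proof -
          have "w n f = act K (n + 1) 0 x0 (c \<odot> e j) \<oplus>\<^bsub>part K (n + 1)\<^esub> w n (f(g0 := \<zero>))"
            using lin_map_split[OF K w f g0(1)] w_gen[OF g0(1)] unfolding c
                by (simp add: g0_def dg_def)
          also have "\<dots> = w n (f(g0 := \<zero>)) \<oplus>\<^bsub>part K (n + 1)\<^esub> act K (n + 1) 0 x0 (c \<odot> e j)"
            using lin_map_closed[OF w F_upd_closed[OF f] refl] B.U_sm[of x0 c] g0(2) S_cyc
            by (intro K.P.a_comm) (auto dest: B.UD)
          finally show ?thesis .
        qed
        moreover have "c \<noteq> 0"
        proof
          assume "c = 0"
          moreover have "0 \<odot> e j = \<zero>"
            using vs.smult_l_distr[of 0 0 "e j"] j idem_zero[of "0 \<odot> e j"] scal_gr[OF j, THEN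
                gr_carrier]
            by (simp add: scalar_ring_def)
          ultimately show False using c nz mv unfolding g0_def by simp
        qed
        ultimately have "x0 \<in> B.span_mod (S (n + 1) j - {x0})"
          using B.span_mod_cancel[where z = "w n (f(g0 := \<zero>))" and c = c and x = x0 and S =
              "S (n + 1) j - {x0}"] wf g0(2) S_cyc by auto
        then show False using S[OF j, of "n + 1"] g0(2) unfolding sp_def by blast
      qed
      note f0 = this
      have "w n (\<lambda>_. \<zero>) = \<zero>\<^bsub>part K (n + 1)\<^esub>"
        using lin_map_zero[OF F_dg_module K w refl, of n] by simp
      then have "k \<in> cyc n j"
        using dk k ke K.dif_closed[OF k] unfolding f0 cyc_def by simp
      then have ksp: "k \<in> sp n j (S n j)" using S[OF j] by blast
      interpret B: vspace_mod "part K n" "\<lambda>c x. act K n 0 x (c \<odot> e j)" "cyc n j" "bdr n j"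
        by (rule vspace_mod_cohomology[OF j])
      \<comment> \<open>With \<open>f = 0\<close> the remaining cocycle \<open>k\<close> lies in the
        old module. It is a combination of basis elements up to a coboundary, and each basis element
        is the image under \<open>w\<close> of its own generator.\<close>
      have "\<exists>f'\<in>carrier (part F (n - 1)). \<exists>y\<in>carrier (part K (n - 1)).
          dif F (n - 1) f' = (\<lambda>_. \<zero>) \<and> k = dif K (n - 1) y \<oplus>\<^bsub>part K n\<^esub> w (n - 1) f'"
        using ksp unfolding sp_def
      proof (induction k rule: B.span_mod.induct)
        case (span_mod_B x)
        then obtain y where "y \<in> carrier (part K (n - 1))" "x =
            dif K (n - 1) y" "x \<in> carrier (part K n)"
          unfolding bdr_def cyc_def by blast
        moreover have "w (n - 1) (\<lambda>_. \<zero>) = \<zero>\<^bsub>part K n\<^esub>"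
          using lin_map_zero[OF F_dg_module K w, of n "n - 1"] by simp
        ultimately show ?case
          using F_zero_closed[of "n - 1"] by (intro bexI[of _ "\<lambda>_. \<zero>"] bexI[of _ y]) auto
      next
        case (span_mod_step z x c)
        then obtain f' y where f': "f' \<in> carrier (part F (n - 1))"
            and y: "y \<in> carrier (part K (n - 1))"
          and df': "dif F (n - 1) f' = (\<lambda>_. \<zero>)" and z: "z = dif K (n - 1) y \<oplus>\<^bsub>part K n\<^esub>
              w (n - 1) f'" by blast
        define g where "g = (n, j, x)"
        have g: "g \<in> G" using span_mod_step j unfolding g_def G_def by simp
        have dgg: "dg g = n - 1" unfolding g_def dg_def by simp
        note gen = gen_closed[OF g, unfolded dgg]
        define f1 where "f1 = act F (n - 1) 0 (gen g) (c \<odot> e j)"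
        have f1: "f1 \<in> carrier (part F (n - 1))"
          unfolding f1_def using F.act_closed[OF gen scal_gr[OF j]] by simp
        have df1: "dif F (n - 1) f1 = (\<lambda>_. \<zero>)"
          unfolding f1_def dif_act_scal[OF F_dg_module gen j]
          using gen_dif[OF g, unfolded dgg] F.act_zero_left[OF scal_gr[OF j], of n n c] by simp
        have wf1: "w (n - 1) f1 = act K n 0 x (c \<odot> e j)"
          unfolding f1_def using lin_map_act[OF w gen scal_gr[OF j], of "n - 1" n c] w_gen[OF g] dgg
          by (simp add: g_def)
        have "z \<oplus>\<^bsub>part K n\<^esub> act K n 0 x (c \<odot> e j) = dif K (n - 1) y \<oplus>\<^bsub>part K n\<^esub>
            w (n - 1) (f' \<oplus>\<^bsub>part F (n - 1)\<^esub> f1)"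
          using lin_map_closed[OF w f', of n] lin_map_closed[OF w f1, of n] K.dif_closed'[OF y,
              of n]
            lin_map_add[OF w f' f1, of n]
          unfolding z wf1[symmetric] by (simp add: K.P.a_assoc del: F_simps)
        moreover have "dif F (n - 1) (f' \<oplus>\<^bsub>part F (n - 1)\<^esub> f1) = (\<lambda>_. \<zero>)"
          using F.dif_add[OF f' f1 refl] unfolding df' df1 by simp
        moreover have "f' \<oplus>\<^bsub>part F (n - 1)\<^esub> f1 \<in> carrier (part F (n - 1))"
          by (rule F.P.a_closed[OF f' f1])
        ultimately show ?case using y by blast
      qed
      then obtain f' y where "f' \<in> carrier (part F (n - 1))" "y \<in> carrier (part K (n - 1))"
        "dif F (n - 1) f' = (\<lambda>_. \<zero>)" "k = dif K (n - 1) y \<oplus>\<^bsub>part K n\<^esub> w (n - 1) f'" by blast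
      then show "\<exists>y\<in>carrier (part (twisted_sum K F w) (n - 1)). x =
          dif (twisted_sum K F w) (n - 1) y"
        unfolding x f0 by (intro bexI[of _ "(y, f')"]) (auto simp del: F_simps)
    qed
  qed
qed

end

end

section \<open>Resolutions\<close>

text \<open>In degree \<open>n\<close>: pairs of degree \<open>n - 1\<close> in \<open>M\<close> and degree \<open>n\<close> in \<open>P\<close>.\<close>

definition fiber :: "('a, 'm) dg_module \<Rightarrow> ('a, 'p) dg_module \<Rightarrow> (int \<Rightarrow> 'p \<Rightarrow> 'm) \<Rightarrow> ('a, 'm \<times> 'p)
    dg_module" where
  "fiber M P g = twisted_sum (shift M (- 1)) P g"

text \<open>The shift by \<open>- 1\<close> raises the degree of \<open>g\<close> to 1 and negates
  the differential of the target, so commuting with differentials becomes anticommuting.\<close>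

lemma fiber_twisting:
  assumes "dg_module A M" "dg_module A P" "chain_map A P M g"
  shows "twisting A P (shift M (- 1)) g"
proof -
  interpret P: dg_module A P by fact
  have "lin_map A P (shift M (- 1)) 1 g"
    using lin_map_closed[OF chain_map_lin[OF assms(3)]] lin_map_add[OF chain_map_lin[OF assms(3)]]
      lin_map_act[OF chain_map_lin[OF assms(3)]]
    by (intro lin_mapI) simp_all
  moreover have "dif (shift M (- 1)) (n + 1) (g n x) = \<ominus>\<^bsub>part (shift M (- 1)) (n + 1 + 1)\<^esub>
      g (n + 1) (dif P n x)"
    if "x \<in> carrier (part P n)" for n x
    using chain_map_dif[OF assms(3) that, of "n + 1"] by (simp add: koszul_sign_def)
  ultimately show ?thesis unfolding twisting_def by blast
qed

lemma fiber_dg_module: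
  assumes "dg_module A M" "dg_module A P" "chain_map A P M g"
  shows "dg_module A (fiber M P g)"
  unfolding fiber_def
  by (rule twisted_sum_dg_module[OF shift_dg_module[OF assms(1)] assms(2) fiber_twisting[OF assms]])

lemma fiber_simps [simp]:
  "part (fiber M P g) n = RDirProd (part M (n - 1)) (part P n)"
  "dif (fiber M P g) n (m, p) = (\<ominus>\<^bsub>part M n\<^esub> dif M (n - 1) m \<oplus>\<^bsub>part M n\<^esub> g n p, dif P n p)"
  "act (fiber M P g) n j (m, p) a = (act M (n - 1) j m a, act P n j p a)"
  by (simp_all add: fiber_def koszul_sign_def)

context directed_dg_algebra
begin

text \<open>Stands for "built from cells of degree at least \<open>c\<close>". Only the resulting
  lifting property is recorded, not the cells, so it is easily carried to an isomorphic copy over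
  \<open>'m\<close>.\<close>

definition lifts_from_degree :: "('a, 'm) dg_module \<Rightarrow> int \<Rightarrow> bool" where
  "lifts_from_degree P c \<longleftrightarrow> (\<forall>(Z :: ('a, 'm) dg_module) (Y :: ('a, 'm) dg_module) s.
    dg_module A Z \<longrightarrow> dg_module A Y \<longrightarrow> chain_map A Z Y s \<longrightarrow> (\<forall>n\<ge>c. rel_exact Z Y s n) \<longrightarrow>
        lifts A P Z Y s)"

lemma lepoll_free_part:
  assumes inf: "infinite (UNIV :: 'm set)" and A: "carrier A \<lesssim> (UNIV :: 'm set)"
      and G: "G \<lesssim> (UNIV :: 'm set)"
  shows "carrier (part (free_module A G dg vt) n) \<lesssim> (UNIV :: 'm set)"
proof -
  have "carrier (part (free_module A G dg vt) n) \<subseteq>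
    {f. finite {g. f g \<noteq> \<zero>} \<and> {g. f g \<noteq> \<zero>} \<subseteq> G \<and> range f \<subseteq> carrier A}"
  proof
    fix f assume "f \<in> carrier (part (free_module A G dg vt) n)"
    then have *: "finite {g. f g \<noteq> \<zero>}" "\<And>g. g \<notin> G \<Longrightarrow> f g = \<zero>" "\<And>g. g \<in> G \<Longrightarrow> f g \<in> gr A (n - dg g)"
      by (simp_all add: free_module_def)
    have "f g \<in> carrier A" for g
      using *(2,3)[of g] gr_carrier by (cases "g \<in> G") auto
    then show "f \<in> {f. finite {g. f g \<noteq> \<zero>} \<and> {g. f g \<noteq> \<zero>} \<subseteq> G \<and> range f \<subseteq> carrier A}"
      using * by auto
  qed
  then show ?thesis
    by (rule lepoll_trans[OF subset_imp_lepoll finite_support_lepoll[OF inf G A]])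
qed

text \<open>Cells attached to the fiber by \<open>w\<close> are attached to \<open>P\<close> by the
  second component of \<open>w\<close>, while the first one extends \<open>g\<close> to them. Up to
  reassociation of triples, the fiber of the new map is the twisted sum of the old fiber with the
  cells, where \<open>kill_cohomology\<close> applies.\<close>

lemma attach_cells:
  fixes M P :: "('a, 'm) dg_module"
  assumes inf: "infinite (UNIV :: 'm set)" and A: "carrier A \<lesssim> (UNIV :: 'm set)"
    and M: "dg_module A M" and P: "dg_module A P" and g: "chain_map A P M g"
    and van: "\<And>n v. \<lbrakk>v \<in> V; n < a \<or> Suc h \<le> ht v\<rbrakk> \<Longrightarrow> vanish (fiber M P g) n v"
    and lift: "lifts_from_degree P c" and c: "c \<le> a - 1"
  obtains P' :: "('a, 'm) dg_module" and g' where "dg_module A P'" "chain_map A P' M g'"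
    "\<And>n v. \<lbrakk>v \<in> V; n < a - (int d + 1) \<or> h \<le> ht v\<rbrakk> \<Longrightarrow> vanish (fiber M P' g') n v"
    "lifts_from_degree P' c"
proof -
  interpret M: dg_module A M by (rule M)
  interpret P: dg_module A P by (rule P)
  let ?K = "fiber M P g"
  have K: "dg_module A ?K" by (rule fiber_dg_module[OF M P g])
  interpret K: dg_module A ?K by (rule K)
  obtain G :: "(int \<times> 'v \<times> 'm \<times> 'm) set" and dg vt w where gens: "free_gens A G vt"
    and G: "G \<subseteq> UNIV \<times> V \<times> UNIV" and Ga: "\<And>x. x \<in> G \<Longrightarrow> a \<le> dg x + 1"
    and tw: "twisting A (free_module A G dg vt) ?K w"
    and van': "\<And>n v. \<lbrakk>v \<in> V; n < a - (int d + 1) \<or> h \<le> ht v\<rbrakk> \<Longrightarrow>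
      vanish (twisted_sum ?K (free_module A G dg vt) w) n v"
  proof (rule kill_cohomology[OF K, where a = a and h = h], goal_cases)
    case (1 n v)
    show ?case by (rule van[OF 1(2,3)])
  next
    case (2 G dg vt w)
    show ?case by (rule 2(1)[OF 2(2-6)])
  qed
  interpret free_gens A G dg vt by (rule gens)
  have w: "lin_map A F ?K 1 w" and
    dw: "\<And>n f. f \<in> carrier (part F n) \<Longrightarrow> dif ?K (n + 1) (w n f) = \<ominus>\<^bsub>part ?K (n + 1 + 1)\<^esub>
        w (n + 1) (dif F n f)"
    using tw unfolding twisting_def by auto
  define wM where "wM n f = fst (w n f)" for n f
  define wP where "wP n f = snd (w n f)" for n f
  have w_eq: "w n f = (wM n f, wP n f)" for n f by (simp add: wM_def wP_def)
  have wP: "lin_map A F P 1 wP"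
    using lin_map_comp[OF w twisted_sum_fst(2)[of A "shift M (- 1)" P g, folded fiber_def], of 1]
    unfolding wP_def by simp
  have wM: "lin_map A F M 0 wM"
    using lin_map_comp[OF w twisted_sum_fst(1)[of A "shift M (- 1)" P g, folded fiber_def], of 1]
    unfolding wM_def lin_map_def by simp
  \<comment> \<open>The two components of the twisting condition for \<open>w\<close>: the first
    makes the extension of \<open>g\<close> a chain map, the second makes \<open>wP\<close> a
    twisting.\<close>
  have dwMP: "dif M n (wM n f) = g (n + 1) (wP n f) \<oplus>\<^bsub>part M (n + 1)\<^esub> wM (n + 1) (dif F n f)"
    "dif P (n + 1) (wP n f) = \<ominus>\<^bsub>part P (n + 1 + 1)\<^esub> wP (n + 1) (dif F n f)"
    if f: "f \<in> carrier (part F n)" for n f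
  proof -
    have cl: "wM (n + 1) (dif F n f) \<in> carrier (part M (n + 1))" "wP (n + 1) (dif F n f) \<in>
        carrier (part P (n + 1 + 1))"
      "g (n + 1) (wP n f) \<in> carrier (part M (n + 1))" "dif M n (wM n f) \<in> carrier (part M (n + 1))"
      using lin_map_closed[OF wM F.dif_closed[OF f]] lin_map_closed[OF wP F.dif_closed[OF f]]
        chain_map_closed[OF g lin_map_closed[OF wP f refl]] M.dif_closed[OF lin_map_closed[OF wM f]]
            by simp_all
    have "(\<ominus>\<^bsub>part M (n + 1)\<^esub> dif M n (wM n f) \<oplus>\<^bsub>part M (n + 1)\<^esub> g (n + 1) (wP n f), dif
        P (n + 1) (wP n f))
      = \<ominus>\<^bsub>RDirProd (part M (n + 1)) (part P (n + 1 + 1))\<^esub> (wM (n + 1) (dif F n f), wP (n + 1)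
          (dif F n f))"
      using dw[OF f] by (simp add: w_eq add.commute[of n] del: F_simps RDirProd_minus)
    also have "\<dots> = (\<ominus>\<^bsub>part M (n + 1)\<^esub> wM (n + 1) (dif F n f), \<ominus>\<^bsub>part P (n + 1 + 1)\<^esub>
        wP (n + 1) (dif F n f))"
      by (rule RDirProd_minus[OF M.part_group P.part_group cl(1,2)])
    finally have *: "\<ominus>\<^bsub>part M (n + 1)\<^esub> dif M n (wM n f) \<oplus>\<^bsub>part M (n + 1)\<^esub> g (n + 1) (wP n f) =
        \<ominus>\<^bsub>part M (n + 1)\<^esub> wM (n + 1) (dif F n f)"
      and "dif P (n + 1) (wP n f) = \<ominus>\<^bsub>part P (n + 1 + 1)\<^esub> wP (n + 1) (dif F n f)" by blast+
    then show "dif P (n + 1) (wP n f) = \<ominus>\<^bsub>part P (n + 1 + 1)\<^esub> wP (n + 1) (dif F n f)" by blast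
    have "dif M n (wM n f) \<oplus>\<^bsub>part M (n + 1)\<^esub> (\<ominus>\<^bsub>part M (n + 1)\<^esub> dif M n (wM n f) \<oplus>\<^bsub>part M (n + 1)\<^esub>
        g (n + 1) (wP n f)) \<oplus>\<^bsub>part M (n + 1)\<^esub> wM (n + 1) (dif F n f)
      = dif M n (wM n f)"
      unfolding * using cl by (simp add: M.P.a_assoc M.P.l_neg)
    then show "dif M n (wM n f) = g (n + 1) (wP n f) \<oplus>\<^bsub>part M (n + 1)\<^esub> wM (n + 1) (dif F n f)"
      using cl by (simp add: M.P.r_neg2 del: F_simps)
  qed
  have twP: "twisting A F P wP"
    unfolding twisting_def using wP dwMP(2) by blast
  define Q where "Q = twisted_sum P F wP"
  have Q: "dg_module A Q" unfolding Q_def by (rule twisted_sum_dg_module[OF P F_dg_module twP])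
  interpret Q: dg_module A Q by (rule Q)
  define g1 where "g1 n x = g n (fst x) \<oplus>\<^bsub>part M n\<^esub> wM n (snd x)" for n x
  have g1_lin: "lin_map A Q M 0 g1"
    using twisted_sum_case[OF M chain_map_lin[OF g] wM, of wP] unfolding g1_def Q_def by simp
  have g1: "chain_map A Q M g1"
    unfolding chain_map_def
  proof (intro conjI g1_lin allI ballI)
    fix n x assume "x \<in> carrier (part Q n)"
    then obtain p f where x: "x = (p, f)" and p: "p \<in> carrier (part P n)"
        and f: "f \<in> carrier (part F n)"
      unfolding Q_def by auto
    have "g (n + 1) (dif P n p \<oplus>\<^bsub>part P (n + 1)\<^esub> wP n f) = dif M n (g n p) \<oplus>\<^bsub>part M (n + 1)\<^esub>
        g (n + 1) (wP n f)"
      using lin_map_add[OF chain_map_lin[OF g] P.dif_closed[OF p] lin_map_closed[OF wP f refl]]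
        chain_map_dif[OF g p] by simp
    then show "g1 (n + 1) (dif Q n x) = dif M n (g1 n x)"
      using p f chain_map_closed[OF g p] lin_map_closed[OF wM f, of n] dwMP(1)[OF f]
        chain_map_closed[OF g lin_map_closed[OF wP f refl]] lin_map_closed[OF wM F.dif_closed[OF f],
            of "n + 1"]
      unfolding g1_def x Q_def by (simp add: M.dif_add[of _ _ _ "n + 1"] M.P.a_assoc M.dif_closed
          del: F_simps)
  qed
  \<comment> \<open>Cells are indexed by an integer, a vertex and an element of the fiber, hence by
    at most as many triples as \<open>'m\<close> has elements; finite combinations with coefficients
    in \<open>A\<close> do not exceed this.\<close>
  have "\<exists>en :: _ \<Rightarrow> 'm. inj_on en (carrier (part Q n))" for n
  proof -
    have "G \<lesssim> (UNIV :: 'm set)"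
    proof -
      have "(UNIV :: int set) \<times> V \<times> (UNIV :: ('m \<times> 'm) set) \<lesssim> (UNIV :: 'm set)"
        using inf finite_lepoll_infinite[OF inf finite_V] infinite_Times_lepoll[OF inf]
          countable_lepoll_infinite[OF inf, of "UNIV :: int set"]
        by (intro Times_lepoll_infinite)
      then show ?thesis using G subset_imp_lepoll lepoll_trans by blast
    qed
    then have "carrier (part F n) \<lesssim> (UNIV :: 'm set)" by (rule lepoll_free_part[OF inf A])
    then have "carrier (part Q n) \<lesssim> (UNIV :: 'm set)"
      unfolding Q_def using Times_lepoll_infinite[OF inf
          subset_imp_lepoll[OF subset_UNIV[of "carrier (part P n)"]]] by simp
    then show ?thesis unfolding lepoll_def by blast
  qed
  then obtain en :: "int \<Rightarrow> _ \<Rightarrow> 'm" where en: "\<And>n. inj_on (en n) (carrier (part Q n))" by metis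
  obtain T :: "('a, 'm) dg_module" and de where T: "dg_module A T" and e: "chain_map A Q T en"
      and de: "chain_map A T Q de"
    and ed: "\<And>n x. x \<in> carrier (part T n) \<Longrightarrow> en n (de n x) = x"
    and de_en: "\<And>n x. x \<in> carrier (part Q n) \<Longrightarrow> de n (en n x) = x"
    by (rule dg_module_transport[OF Q en]) blast
  interpret T: dg_module A T by (rule T)
  define g2 where "g2 n x = g1 n (de n x)" for n x
  have g2: "chain_map A T M g2" unfolding g2_def by (rule chain_map_comp[OF de g1])
  show ?thesis
  proof (rule that[OF T g2])
    fix n v assume v: "v \<in> V" and nv: "n < a - (int d + 1) \<or> h \<le> ht v"
    show "vanish (fiber M T g2) n v"
      unfolding vanish_def
    proof (intro ballI impI)
      fix x assume "x \<in> carrier (part (fiber M T g2) n)"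
        and dx: "dif (fiber M T g2) n x = \<zero>\<^bsub>part (fiber M T g2) (n + 1)\<^esub>"
        and xe: "act (fiber M T g2) n 0 x (e v) = x"
      then obtain m t where x: "x = (m, t)" and m: "m \<in> carrier (part M (n - 1))"
          and t: "t \<in> carrier (part T n)"
        by auto
      obtain p f where pf: "de n t = (p, f)" and p: "p \<in> carrier (part P n)"
          and f: "f \<in> carrier (part F n)"
        using chain_map_closed[OF de t] unfolding Q_def by auto
      have "dif Q n (de n t) = \<zero>\<^bsub>part Q (n + 1)\<^esub>"
        using chain_map_dif[OF de t, of "n + 1"] dx lin_map_zero[OF T Q chain_map_lin[OF de],
            of "n + 1" "n + 1"]
        unfolding x by simp
      then have d1: "dif P n p \<oplus>\<^bsub>part P (n + 1)\<^esub> wP n f = \<zero>\<^bsub>part P (n + 1)\<^esub>" "dif F n f =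
          \<zero>\<^bsub>part F (n + 1)\<^esub>"
        unfolding pf Q_def by (simp_all del: F_simps)
      have d2: "\<ominus>\<^bsub>part M n\<^esub> dif M (n - 1) m \<oplus>\<^bsub>part M n\<^esub> (g n p \<oplus>\<^bsub>part M n\<^esub> wM n f) = \<zero>\<^bsub>part M n\<^esub>"
        using dx unfolding x by (simp add: g2_def g1_def pf)
      have "act Q n 0 (de n t) (e v) = de n t"
        using lin_map_act[OF chain_map_lin[OF de] t e_gr[OF v], of n n] xe unfolding x by simp
      then have e1: "act P n 0 p (e v) = p" "act F n 0 f (e v) = f" "act M (n - 1) 0 m (e v) = m"
        using xe unfolding pf Q_def x by (simp_all del: F_simps)
      have cl: "g n p \<in> carrier (part M n)" "wM n f \<in> carrier (part M n)" "dif M (n - 1) m \<in>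
          carrier (part M n)"
        using chain_map_closed[OF g p] lin_map_closed[OF wM f] M.dif_closed[OF m] by simp_all
      \<comment> \<open>The cocycle \<open>(m, t)\<close> is read as \<open>((m, p), f)\<close> in
        the twisted sum over the old fiber; the primitive found there is reassociated and encoded
        back.\<close>
      let ?S = "twisted_sum ?K F w"
      have "((m, p), f) \<in> carrier (part ?S n)" using m p f by simp
      moreover have "dif ?S n ((m, p), f) = \<zero>\<^bsub>part ?S (n + 1)\<^esub>"
        using d1 d2 cl by (simp add: w_eq M.P.a_assoc del: F_simps)
      moreover have "act ?S n 0 ((m, p), f) (e v) = ((m, p), f)"
        using e1 by (simp del: F_simps)
      ultimately obtain z where "z \<in> carrier (part ?S (n - 1))" "((m, p), f) = dif ?S (n - 1) z"
        using van'[OF v nv] unfolding vanish_def by blast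
      then obtain m' p' f' where c': "m' \<in> carrier (part M (n - 2))" "p' \<in> carrier (part P (n - 1))"
          "f' \<in> carrier (part F (n - 1))" and eq: "((m, p), f) = dif ?S (n - 1) ((m', p'), f')"
        by auto
      have cl': "g (n - 1) p' \<in> carrier (part M (n - 1))" "wM (n - 1) f' \<in> carrier (part M (n - 1))"
        "dif M (n - 2) m' \<in> carrier (part M (n - 1))"
        using chain_map_closed[OF g c'(2)] lin_map_closed[OF wM c'(3)] M.dif_closed'[OF c'(1)]
            by simp_all
      have pf': "(p', f') \<in> carrier (part Q (n - 1))" unfolding Q_def using c' by simp
      have eq1: "m = \<ominus>\<^bsub>part M (n - 1)\<^esub> dif M (n - 2) m' \<oplus>\<^bsub>part M (n - 1)\<^esub>
          (g (n - 1) p' \<oplus>\<^bsub>part M (n - 1)\<^esub> wM (n - 1) f')"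
        using eq cl' by (simp add: w_eq M.P.a_assoc del: F_simps)
      have eq2: "de n t = dif Q (n - 1) (p', f')"
        unfolding pf Q_def using eq by (simp add: w_eq del: F_simps)
      have "t = en n (dif Q (n - 1) (p', f'))" using ed[OF t] eq2 by simp
      also have "\<dots> = dif T (n - 1) (en (n - 1) (p', f'))"
        using chain_map_dif[OF e pf', of n] by simp
      finally have "t = dif T (n - 1) (en (n - 1) (p', f'))" .
      then have "x = dif (fiber M T g2) (n - 1) (m', en (n - 1) (p', f'))"
        unfolding x using eq1 by (simp add: g2_def g1_def de_en[OF pf'])
      then show "\<exists>y\<in>carrier (part (fiber M T g2) (n - 1)). x = dif (fiber M T g2) (n - 1) y"
        using c'(1) chain_map_closed[OF e pf'] by (intro bexI[of _ "(m', en (n - 1) (p', f'))"])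
            simp_all
    qed
  next
    show "lifts_from_degree T c"
      unfolding lifts_from_degree_def
    proof (intro allI impI)
      fix Z Y :: "('a, 'm) dg_module" and s
      assume Z: "dg_module A Z" and Y: "dg_module A Y" and s: "chain_map A Z Y s"
          and ex: "\<forall>n\<ge>c. rel_exact Z Y s n"
      have "lifts A P Z Y s" using lift Z Y s ex unfolding lifts_from_degree_def by blast
      moreover have "rel_exact Z Y s (dg x)" if "x \<in> G" for x
        using ex Ga[OF that] c by simp
      ultimately have "lifts A Q Z Y s"
        unfolding Q_def by (intro lifts_twisted_sum[OF P twP Z Y s])
      with ed show "lifts A T Z Y s" by (rule lifts_along_iso[OF e de])
    qed
  qed
qed

lemma resolution:
  fixes M :: "('a, 'm) dg_module"
  assumes inf: "infinite (UNIV :: 'm set)" and A: "carrier A \<lesssim> (UNIV :: 'm set)"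
    and M: "dg_module A M"
    and M0: "\<And>n x. \<lbrakk>n < 0; x \<in> carrier (part M n); dif M n x = \<zero>\<^bsub>part M (n + 1)\<^esub>\<rbrakk> \<Longrightarrow>
      \<exists>y\<in>carrier (part M (n - 1)). x = dif M (n - 1) y"
    and l: "\<And>v. v \<in> V \<Longrightarrow> ht v \<le> l"
  obtains P :: "('a, 'm) dg_module" and g where "dg_module A P" "chain_map A P M g"
    "\<And>n v. v \<in> V \<Longrightarrow> vanish (fiber M P g) n v" "lifts_from_degree P (- int (l * (d + 1)))"
proof -
  interpret M: dg_module A M by (rule M)
  \<comment> \<open>State after \<open>k\<close> rounds: cohomology of the fiber survives only in
    degrees at least \<open>1 - k (d + 1)\<close> and at vertices of height at most
    \<open>l - k\<close>.\<close>
  let ?ok = "\<lambda>k (P :: ('a, 'm) dg_module) g. dg_module A P \<and> chain_map A P M g \<and>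
    (\<forall>n. \<forall>v\<in>V. n < 1 - int (k * (d + 1)) \<or> Suc l - k \<le> ht v \<longrightarrow> vanish (fiber M P g) n v) \<and>
    lifts_from_degree P (- int (l * (d + 1)))"
  have "k \<le> Suc l \<Longrightarrow> \<exists>P g. ?ok k P g" for k
  proof (induction k)
    case 0
    let ?P = "zero_module undefined :: ('a, 'm) dg_module" and ?g = "\<lambda>n x. \<zero>\<^bsub>part M n\<^esub>"
    have P: "dg_module A ?P" by (rule zero_module_dg_module) unfold_locales
    have "vanish (fiber M ?P ?g) n v" if v: "v \<in> V" and nv: "n < 1 \<or> Suc l \<le> ht v" for n v
      unfolding vanish_def
    proof (intro ballI impI)
      have n: "n < 1" using nv l[OF v] by simp
      fix x assume "x \<in> carrier (part (fiber M ?P ?g) n)"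
        and dx: "dif (fiber M ?P ?g) n x = \<zero>\<^bsub>part (fiber M ?P ?g) (n + 1)\<^esub>"
      then obtain m where x: "x = (m, undefined)" and m: "m \<in> carrier (part M (n - 1))" by auto
      have dm: "dif M (n - 1) m \<in> carrier (part M n)" using M.dif_closed[OF m] by simp
      have "\<ominus>\<^bsub>part M n\<^esub> dif M (n - 1) m = \<zero>\<^bsub>part M n\<^esub>"
        using dx dm unfolding x by simp
      then have "dif M (n - 1) m = \<zero>\<^bsub>part M n\<^esub>"
        using M.P.l_neg[OF dm] dm by simp
      then obtain y where y: "y \<in> carrier (part M (n - 2))" "m = dif M (n - 2) y"
        using M0[of "n - 1" m] m n by auto
      \<comment> \<open>The fiber negates the differential of \<open>M\<close>, hence the sign of
        the witness.\<close>
      have "x = dif (fiber M ?P ?g) (n - 1) (\<ominus>\<^bsub>part M (n - 2)\<^esub> y, undefined)"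
        unfolding x using y m by (simp add: M.dif_minus[of y "n - 2" "n - 1"] M.dif_closed'[of y
            "n - 2" "n - 1"])
      then show "\<exists>y\<in>carrier (part (fiber M ?P ?g) (n - 1)). x = dif (fiber M ?P ?g) (n - 1) y"
        using y by (intro bexI[of _ "(\<ominus>\<^bsub>part M (n - 2)\<^esub> y, undefined)"]) simp_all
    qed
    moreover have "lifts_from_degree ?P c" for c
      unfolding lifts_from_degree_def by (intro allI impI lifts_zero_module)
    ultimately have "?ok 0 ?P ?g" using P zero_chain_map[OF P M] by simp
    then show ?case by blast
  next
    case (Suc k)
    then obtain P :: "('a, 'm) dg_module" and g where P: "dg_module A P" and g: "chain_map A P M g"
      and van: "\<forall>n. \<forall>v\<in>V. n < 1 - int (k * (d + 1)) \<or> Suc l - k \<le> ht v \<longrightarrow> vanish (fiber M P g) n v"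
      and lift: "lifts_from_degree P (- int (l * (d + 1)))" by auto
    have k: "k \<le> l" using Suc(2) by simp
    then have "k * (d + 1) \<le> l * (d + 1)" by (rule mult_le_mono1)
    \<comment> \<open>Round \<open>k\<close> attaches cells of degree at least
      \<open>- k (d + 1)\<close>, one below the bound on the fiber, and \<open>k \<le> l\<close> in
      every round.\<close>
    then have c: "- int (l * (d + 1)) \<le> 1 - int (k * (d + 1)) - 1" by linarith
    have van': "vanish (fiber M P g) n v" if "v \<in> V" "n < 1 - int (k * (d + 1)) \<or> Suc (l - k) \<le> ht
        v" for n v
      using van[rule_format, OF that(1)] that(2) k by (auto simp: Suc_diff_le)
    show ?case
    proof (rule attach_cells[OF inf A M P g van' lift c])
      fix P' :: "('a, 'm) dg_module" and g'
      assume P': "dg_module A P'" "chain_map A P' M g'"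
        "\<And>n v. \<lbrakk>v \<in> V; n < 1 - int (k * (d + 1)) - (int d + 1) \<or> l - k \<le> ht v\<rbrakk> \<Longrightarrow>
            vanish (fiber M P' g') n v"
        "lifts_from_degree P' (- int (l * (d + 1)))"
      have "1 - int (Suc k * (d + 1)) = 1 - int (k * (d + 1)) - (int d + 1)" "Suc l - Suc k = l - k"
        by (simp_all add: algebra_simps)
      then have "?ok (Suc k) P' g'" using P' by simp
      then show "\<exists>P g. ?ok (Suc k) P g" by blast
    qed
  qed
  \<comment> \<open>After round \<open>l\<close> the height bound has reached 0, so no vertex is
    left.\<close>
  from this[of "Suc l"] obtain P g where "?ok (Suc l) P g" by blast
  then show ?thesis using that[of P g] by auto
qed

end

section \<open>Idempotents of degree zero\<close>

text \<open>The inverse is the finite geometric series; its telescoping identity is proved from both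
  sides because the ring is not commutative.\<close>

lemma (in ring) one_minus_nilpotent_unit:
  assumes x: "x \<in> carrier R" and nil: "x [^] (k::nat) = \<zero>"
  shows "\<exists>y\<in>carrier R. (\<one> \<ominus> x) \<otimes> y = \<one> \<and> y \<otimes> (\<one> \<ominus> x) = \<one>"
proof -
  have "\<exists>y\<in>carrier R. (\<one> \<ominus> x) \<otimes> y = \<one> \<ominus> x [^] k \<and> y \<otimes> (\<one> \<ominus> x) = \<one> \<ominus> x [^] k" for k :: nat
  proof (induction k)
    case 0
    then show ?case using x by (intro bexI[of _ \<zero>]) (auto simp: a_minus_def r_neg)
  next
    case (Suc k)
    then obtain y where y: "y \<in> carrier R" "(\<one> \<ominus> x) \<otimes> y = \<one> \<ominus> x [^] k" "y \<otimes> (\<one> \<ominus> x) = \<one> \<ominus> x [^] k"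
      by blast
    have p: "x [^] k \<in> carrier R" and c: "x \<otimes> x [^] k = x [^] k \<otimes> x"
      using x by (simp_all add: nat_pow_Suc2[symmetric])
    have "(\<one> \<ominus> x) \<otimes> (y \<oplus> x [^] k) = (\<one> \<ominus> x [^] k) \<oplus> (x [^] k \<ominus> x \<otimes> x [^] k)"
      using x y p by (simp add: r_distr l_distr a_minus_def l_minus)
    also have "\<dots> = \<one> \<ominus> x [^] Suc k"
      using x p c by (simp add: a_minus_def a_assoc r_neg1)
    finally have 1: "(\<one> \<ominus> x) \<otimes> (y \<oplus> x [^] k) = \<one> \<ominus> x [^] Suc k" .
    have "(y \<oplus> x [^] k) \<otimes> (\<one> \<ominus> x) = (\<one> \<ominus> x [^] k) \<oplus> (x [^] k \<ominus> x [^] k \<otimes> x)"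
      using x y p l_distr[of y "x [^] k" "\<one> \<ominus> x"]
      by (simp add: r_distr[of _ _ "x [^] k"] r_minus a_minus_def)
    also have "\<dots> = \<one> \<ominus> x [^] Suc k"
      using x p by (simp add: a_minus_def a_assoc r_neg1)
    finally show ?case using 1 y p by blast
  qed
  from this[of k] show ?thesis using nil by (simp add: a_minus_def)
qed

section \<open>The filtration by degree\<close>

context dg_algebra
begin

text \<open>Elements whose homogeneous components all have degree at most \<open>- k\<close>.
  Generation by homogeneous summands makes closure properties inductions that add one summand at a
  time.\<close>

inductive_set low :: "int \<Rightarrow> 'a set" for k where
  low_zero: "\<zero> \<in> low k"
| low_add: "\<lbrakk>b \<in> low k; a \<in> gr A n; n \<le> - k\<rbrakk> \<Longrightarrow> b \<oplus> a \<in> low k"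

lemma low_carrier: "b \<in> low k \<Longrightarrow> b \<in> carrier A"
  by (induction rule: low.induct) (auto dest: gr_carrier)

lemma gr_low: "\<lbrakk>a \<in> gr A n; n \<le> - k\<rbrakk> \<Longrightarrow> a \<in> low k"
  using low_add[OF low_zero, of a n k] gr_carrier by simp

lemma low_plus: "\<lbrakk>b \<in> low k; c \<in> low k\<rbrakk> \<Longrightarrow> c \<oplus> b \<in> low k"
proof (induction b rule: low.induct)
  case low_zero
  then show ?case using low_carrier by simp
next
  case (low_add b a n)
  then have "c \<oplus> (b \<oplus> a) = c \<oplus> b \<oplus> a" using low_carrier gr_carrier by (simp add: a_assoc)
  then show ?case using low_add low.low_add by simp
qed

lemma low_uminus: "b \<in> low k \<Longrightarrow> \<ominus> b \<in> low k"
proof (induction b rule: low.induct)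
  case low_zero
  then show ?case using low.low_zero by simp
next
  case (low_add b a n)
  then have "\<ominus> (b \<oplus> a) = \<ominus> b \<oplus> \<ominus> a" using low_carrier gr_carrier by (simp add: minus_add)
  then show ?case using low.low_add[OF low_add(4) gr_minus[OF low_add(2)] low_add(3)] by simp
qed

lemma low_mult:
  assumes "b \<in> low k" "c \<in> low l"
  shows "b \<otimes> c \<in> low (k + l)"
  using assms(1)
proof (induction b rule: low.induct)
  case low_zero
  then show ?case using low.low_zero low_carrier[OF assms(2)] by simp
next
  case (low_add b a n)
  have "a \<otimes> c \<in> low (k + l)"
    using assms(2)
  proof (induction c rule: low.induct)
    case low_zero
    then show ?case using low.low_zero gr_carrier[OF low_add(2)] by simp
  next
    case (low_add c a' m)
    then have "a \<otimes> (c \<oplus> a') = a \<otimes> c \<oplus> a \<otimes> a'"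
      using low_carrier gr_carrier \<open>a \<in> gr A n\<close> by (simp add: r_distr)
    moreover have "a \<otimes> a' \<in> gr A (n + m)" using gr_mult \<open>a \<in> gr A n\<close> low_add by blast
    ultimately show ?case using low_add \<open>n \<le> - k\<close> low.low_add by simp
  qed
  moreover have "(b \<oplus> a) \<otimes> c = b \<otimes> c \<oplus> a \<otimes> c"
    using low_carrier gr_carrier low_add assms(2) by (simp add: l_distr)
  ultimately show ?case using low_add low_plus by simp
qed

lemma low_finsum:
  assumes "finite S" "\<And>x. x \<in> S \<Longrightarrow> f x \<in> low k"
  shows "finsum A f S \<in> low k"
  using assms
proof (induction S)
  case empty
  then show ?case using low_zero by simp
next
  case (insert x S)
  then show ?case using low_carrier low_plus by (subst finsum_insert) auto
qed

lemma low_pow: "x \<in> low 1 \<Longrightarrow> x [^] k \<in> low (int k)"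
proof (induction k)
  case 0
  then show ?case using gr_low[OF gr_one, of 0] by simp
next
  case (Suc k)
  then show ?case using low_mult[of "x [^] k" "int k" x 1] by (simp add: add.commute)
qed

end

locale nonpositive_dg_algebra = dg_algebra A
  for A :: "('k::field, 'a, 'x) dg_algebra_scheme" (structure) +
  fixes d :: nat
  assumes gr_outside: "n \<notin> {- int d..0} \<Longrightarrow> gr A n = {\<zero>}"
begin

lemma low_trivial: "\<lbrakk>b \<in> low k; int d < k\<rbrakk> \<Longrightarrow> b = \<zero>"
  by (induction rule: low.induct) (use gr_outside in force)+

lemma low_all:
  assumes "a \<in> carrier A"
  shows "a \<in> low 0"
proof -
  obtain f where f: "\<forall>n. f n \<in> gr A n" "finite {n. f n \<noteq> \<zero>}" "a = finsum A f {n. f n \<noteq> \<zero>}"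
    using ex1_implies_ex[OF gr_decomposition[OF assms]] by blast
  have "f n \<in> low 0" for n
  proof (cases "n \<in> {- int d..0}")
    case True
    then show ?thesis using f gr_low[of "f n" n 0] by auto
  next
    case False
    then have "f n = \<zero>" using f(1) gr_outside by blast
    then show ?thesis using low_zero by simp
  qed
  then show ?thesis unfolding f(3) using low_finsum[OF f(2), of f 0] by blast
qed

lemma low_split:
  assumes "a \<in> carrier A"
  obtains a0 b where "a0 \<in> gr A 0" "b \<in> low 1" "a = a0 \<oplus> b"
proof -
  have "\<exists>a0\<in>gr A 0. \<exists>b\<in>low 1. a = a0 \<oplus> b"
    using low_all[OF assms]
  proof (induction rule: low.induct)
    case low_zero
    then show ?case using gr_zero low.low_zero by (intro bexI[of _ \<zero>]) auto
  next
    case (low_add b a n)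
    then obtain a0 b' where *: "a0 \<in> gr A 0" "b' \<in> low 1" "b = a0 \<oplus> b'" by blast
    note c = gr_carrier[OF *(1)] low_carrier[OF *(2)] gr_carrier[OF low_add(2)]
    show ?case
    proof (cases "n = 0")
      case True
      have "b \<oplus> a = (a0 \<oplus> a) \<oplus> b'" using * c by (simp add: a_ac)
      then show ?thesis using * gr_add low_add(2) True by blast
    next
      case False
      have "b \<oplus> a = a0 \<oplus> (b' \<oplus> a)" using * c by (simp add: a_ac)
      moreover have "b' \<oplus> a \<in> low 1" using low.low_add[OF *(2) low_add(2)] low_add(3) False by simp
      ultimately show ?thesis using * by blast
    qed
  qed
  then show ?thesis using that by blast
qed

text \<open>A nonzero \<open>a\<close> would have a decomposition concentrated in degree 0 and
  another one in negative degrees. The second is built over the fixed index set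
  \<open>{- int d..-1}\<close>, so that summands can be added termwise.\<close>

lemma gr_low_disjoint:
  assumes a: "a \<in> gr A 0" "a \<in> low 1"
  shows "a = \<zero>"
proof (rule ccontr)
  assume nz: "a \<noteq> \<zero>"
  have "\<exists>f. (\<forall>n. f n \<in> gr A n) \<and> (\<forall>n. n \<notin> {- int d..-1} \<longrightarrow> f n = \<zero>) \<and> a = finsum A f {- int d..-1}"
    using a(2)
  proof (induction rule: low.induct)
    case low_zero
    then show ?case by (intro exI[of _ "\<lambda>_. \<zero>"]) simp
  next
    case (low_add b a n)
    then obtain f where f: "\<forall>n. f n \<in> gr A n" "\<forall>n. n \<notin> {- int d..-1} \<longrightarrow> f n = \<zero>" "b =
        finsum A f {- int d..-1}"
      by blast
    have c: "f n \<in> carrier A" "a \<in> carrier A" for n using f(1) gr_carrier low_add by blast+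
    show ?case
    proof (cases "n \<in> {- int d..-1}")
      case True
      have "finsum A (\<lambda>m. f m \<oplus> (if n = m then a else \<zero>)) {- int d..-1} =
        finsum A f {- int d..-1} \<oplus> finsum A (\<lambda>m. if n = m then a else \<zero>) {- int d..-1}"
        using c by (intro finsum_addf) auto
      also have "\<dots> = b \<oplus> a"
        using finsum_singleton[OF True, of "\<lambda>_. a"] f(3) c by (simp add: Pi_iff)
      finally have "b \<oplus> a = finsum A (\<lambda>m. f m \<oplus> (if n = m then a else \<zero>)) {- int d..-1}" by simp
      moreover have "f m \<oplus> (if n = m then a else \<zero>) \<in> gr A m" for m
        using f(1) low_add(2) gr_add by auto
      moreover have "m \<notin> {- int d..-1} \<longrightarrow> f m \<oplus> (if n = m then a else \<zero>) = \<zero>" for m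
        using f(2) True by auto
      ultimately show ?thesis by (intro exI[of _ "\<lambda>m. f m \<oplus> (if n = m then a else \<zero>)"]) blast
    next
      case False
      then have "n \<notin> {- int d..0}" using low_add(3) by auto
      then have "a = \<zero>" using gr_outside low_add(2) by blast
      moreover have "b \<in> carrier A" using low_carrier low_add(1) by blast
      ultimately show ?thesis using f by (intro exI[of _ f]) simp
    qed
  qed
  then obtain f where f: "\<forall>n. f n \<in> gr A n" "\<forall>n. n \<notin> {- int d..-1} \<longrightarrow> f n = \<zero>" "a =
      finsum A f {- int d..-1}"
    by blast
  have c: "f n \<in> carrier A" "a \<in> carrier A" for n using f(1) gr_carrier a by blast+
  let ?P = "\<lambda>f. (\<forall>n. f n \<in> gr A n) \<and> finite {n. f n \<noteq> \<zero>} \<and> a = finsum A f {n. f n \<noteq> \<zero>}"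
  have supp: "{n. f n \<noteq> \<zero>} \<subseteq> {- int d..-1}" using f(2) by blast
  have "finsum A f {n. f n \<noteq> \<zero>} = finsum A f {- int d..-1}"
    using supp c by (intro add.finprod_mono_neutral_cong_left) auto
  then have 1: "?P f" using f(1,3) finite_subset[OF supp] by simp
  have "{n. (if n = 0 then a else \<zero>) \<noteq> \<zero>} = {0 :: int}" using nz by auto
  then have 2: "?P (\<lambda>n. if n = 0 then a else \<zero>)" using a c by auto
  have "f = (\<lambda>n. if n = 0 then a else \<zero>)"
    by (rule ex1_unique[of ?P, OF gr_decomposition[OF c(2)] 1 2])
  then have "f 0 = a" by simp
  then show False using f(2) nz by simp
qed

text \<open>
  The unit \<open>u\<close>, the sum of the \<open>\<epsilon> w \<otimes> e w\<close>, satisfies \<open>\<epsilon> v \<otimes> u = u \<otimes> e v\<close>. Conjugation by \<open>u\<close> thus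
  transports triangularity from the \<open>\<epsilon> v\<close> to their degree 0 components \<open>e v\<close>.
\<close>

lemma directed_dg_algebra_exists:
  fixes V :: "'v set" and \<epsilon> :: "'v \<Rightarrow> 'a" and ht :: "'v \<Rightarrow> nat"
  assumes V: "finite V" and \<epsilon>_carrier: "\<And>v. v \<in> V \<Longrightarrow> \<epsilon> v \<in> carrier A"
    and \<epsilon>_idem: "\<And>v. v \<in> V \<Longrightarrow> \<epsilon> v \<otimes> \<epsilon> v = \<epsilon> v"
    and \<epsilon>_orth: "\<And>v w. \<lbrakk>v \<in> V; w \<in> V; v \<noteq> w\<rbrakk> \<Longrightarrow> \<epsilon> v \<otimes> \<epsilon> w = \<zero>"
    and \<epsilon>_sum: "finsum A \<epsilon> V = \<one>"
    and \<epsilon>_tri: "\<And>v w a. \<lbrakk>v \<in> V; w \<in> V; a \<in> carrier A; \<epsilon> v \<otimes> a = a; a \<otimes> \<epsilon> w = a; a \<noteq> \<zero>\<rbrakk> \<Longrightarrow>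
      (v = w \<and> (\<exists>c. a = c \<odot> \<epsilon> v)) \<or> ht w < ht v"
  obtains e where "directed_dg_algebra A V e ht d"
proof -
  have "\<exists>e\<in>gr A 0. \<exists>b\<in>low 1. \<epsilon> v = e \<oplus> b" if "v \<in> V" for v
    using low_split[OF \<epsilon>_carrier[OF that]] by metis
  then obtain e b where e: "\<And>v. v \<in> V \<Longrightarrow> e v \<in> gr A 0" and b: "\<And>v. v \<in> V \<Longrightarrow> b v \<in> low 1"
    and eb: "\<And>v. v \<in> V \<Longrightarrow> \<epsilon> v = e v \<oplus> b v" by metis
  note ec [simp] = gr_carrier[OF e] and bc [simp] = low_carrier[OF b] and \<epsilon>_carrier [simp]
  have el: "e v \<in> low 0" if "v \<in> V" for v using gr_low[OF e[OF that]] by simp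
  \<comment> \<open>Uniqueness of the degree 0 component, in place of a projection map.\<close>
  have eq: "x = y" if "x \<in> gr A 0" "y \<in> gr A 0" "c \<in> low 1" "c' \<in> low 1" "x \<oplus> c = y \<oplus> c'"
      for x y c c'
  proof -
    note cc = gr_carrier[OF that(1)] gr_carrier[OF that(2)] low_carrier[OF that(3)]
        low_carrier[OF that(4)]
    have "x \<oplus> \<ominus> y = c' \<oplus> \<ominus> c"
    proof -
      have "x \<oplus> \<ominus> y = (x \<oplus> c) \<oplus> (\<ominus> y \<oplus> \<ominus> c)"
      proof -
        have "(x \<oplus> c) \<oplus> (\<ominus> y \<oplus> \<ominus> c) = (x \<oplus> \<ominus> y) \<oplus> (c \<oplus> \<ominus> c)"
          using cc by (simp add: a_ac)
        then show ?thesis using cc by (simp add: r_neg)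
      qed
      also have "\<dots> = (y \<oplus> c') \<oplus> (\<ominus> y \<oplus> \<ominus> c)" unfolding that(5) ..
      also have "\<dots> = y \<oplus> (\<ominus> y \<oplus> (c' \<oplus> \<ominus> c))" using cc by (simp add: a_ac)
      also have "\<dots> = c' \<oplus> \<ominus> c" using cc by (simp add: r_neg2)
      finally show ?thesis .
    qed
    then have "x \<oplus> \<ominus> y \<in> low 1" using low_plus low_uminus that by simp
    moreover have "x \<oplus> \<ominus> y \<in> gr A 0" using gr_add gr_minus that by blast
    ultimately have "x \<oplus> \<ominus> y = \<zero>" using gr_low_disjoint by blast
    then show ?thesis using cc add_eq_zero_iff[of x "\<ominus> y"] by simp
  qed
  \<comment> \<open>Elements of negative degree form an ideal, so taking degree 0 components is
    multiplicative.\<close>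
  have prod: "\<exists>c\<in>low 1. \<epsilon> v \<otimes> \<epsilon> w = e v \<otimes> e w \<oplus> c" if v: "v \<in> V" and w: "w \<in> V" for v w
  proof -
    have "e v \<otimes> b w \<in> low 1" "b v \<otimes> e w \<in> low 1"
      using low_mult[OF el[OF v] b[OF w]] low_mult[OF b[OF v] el[OF w]] by simp_all
    moreover have "b v \<otimes> b w \<in> low 1"
      using low_mult[OF low_all[OF bc[OF v]] b[OF w]] by simp
    moreover have "\<epsilon> v \<otimes> \<epsilon> w = e v \<otimes> e w \<oplus> (e v \<otimes> b w \<oplus> (b v \<otimes> e w \<oplus> b v \<otimes> b w))"
      using v w by (simp add: eb l_distr r_distr a_ac)
    ultimately show ?thesis by (intro bexI[of _ "e v \<otimes> b w \<oplus> (b v \<otimes> e w \<oplus> b v \<otimes> b w)"] low_plus)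
  qed
  have ee: "e v \<otimes> e w \<in> gr A 0" if "v \<in> V" "w \<in> V" for v w
    using gr_mult[OF e e, OF that] by simp
  have e_idem: "e v \<otimes> e v = e v" if v: "v \<in> V" for v
  proof -
    obtain c where "c \<in> low 1" "\<epsilon> v \<otimes> \<epsilon> v = e v \<otimes> e v \<oplus> c" using prod[OF v v] by blast
    then show ?thesis using eq[OF ee[OF v v] e[OF v], of c "b v"] b[OF v] \<epsilon>_idem[OF v] eb[OF v]
        by simp
  qed
  have e_orth: "e v \<otimes> e w = \<zero>" if v: "v \<in> V" and w: "w \<in> V" and "v \<noteq> w" for v w
  proof -
    obtain c where c: "c \<in> low 1" "\<epsilon> v \<otimes> \<epsilon> w = e v \<otimes> e w \<oplus> c" using prod[OF v w] by blast
    have "e v \<otimes> e w \<oplus> c = \<zero> \<oplus> \<zero>"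
      by (simp add: c(2)[symmetric] \<epsilon>_orth[OF that])
    then show ?thesis by (rule eq[OF ee[OF v w] gr_zero c(1) low_zero])
  qed
  have e_sum: "finsum A e V = \<one>"
  proof -
    have "\<one> = finsum A (\<lambda>v. e v \<oplus> b v) V"
      unfolding \<epsilon>_sum[symmetric] by (intro finsum_cong') (auto simp: eb)
    also have "\<dots> = finsum A e V \<oplus> finsum A b V" by (intro finsum_addf) auto
    finally have "finsum A e V \<oplus> finsum A b V = \<one> \<oplus> \<zero>" by simp
    moreover have "finsum A e W \<in> gr A 0" if "W \<subseteq> V" for W
      using finite_subset[OF that V] that
    proof (induction W)
      case (insert v W)
      then have "finsum A e (insert v W) = e v \<oplus> finsum A e W"
        by (subst finsum_insert) auto
      then show ?case using insert e gr_add by simp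
    qed simp
    ultimately show ?thesis
      using low_finsum[OF V b] low_zero gr_one by (intro eq[of "finsum A e V" \<one> "finsum A b V" \<zero>])
          auto
  qed
  define u where "u = finsum A (\<lambda>w. \<epsilon> w \<otimes> e w) V"
  have uc [simp]: "u \<in> carrier A" unfolding u_def by (intro finsum_closed) auto
  have "u = finsum A (\<lambda>w. e w \<oplus> b w \<otimes> e w) V"
    unfolding u_def by (intro finsum_cong') (auto simp: eb l_distr e_idem)
  also have "\<dots> = \<one> \<oplus> finsum A (\<lambda>w. b w \<otimes> e w) V"
    unfolding e_sum[symmetric] by (intro finsum_addf) auto
  finally have u1: "u = \<one> \<oplus> finsum A (\<lambda>w. b w \<otimes> e w) V" .
  define x where "x = \<ominus> finsum A (\<lambda>w. b w \<otimes> e w) V"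
  have be: "b w \<otimes> e w \<in> low 1" if "w \<in> V" for w
    using low_mult[OF b[OF that] el[OF that]] by simp
  have x: "x \<in> low 1" unfolding x_def using low_uminus low_finsum[OF V be] by simp
  have u2: "u = \<one> \<ominus> x"
    unfolding u1 x_def a_minus_def using low_carrier[OF low_finsum[OF V be]] by simp
  \<comment> \<open>The power lies in degrees at most \<open>- (d + 1)\<close>, below all degrees of
    the algebra.\<close>
  have "x [^] Suc d = \<zero>" using low_trivial[OF low_pow[OF x, of "Suc d"]] by simp
  from one_minus_nilpotent_unit[OF low_carrier[OF x] this, folded u2]
  obtain u' where u': "u' \<in> carrier A" "u \<otimes> u' = \<one>" "u' \<otimes> u = \<one>" by blast
  note u'(1) [simp]
  have intertwine: "\<epsilon> v \<otimes> u = u \<otimes> e v" if v: "v \<in> V" for v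
  proof -
    have "\<epsilon> v \<otimes> u = finsum A (\<lambda>w. \<epsilon> v \<otimes> (\<epsilon> w \<otimes> e w)) V"
      unfolding u_def using v V by (intro finsum_rdistr) auto
    also have "\<dots> = finsum A (\<lambda>w. if v = w then \<epsilon> v \<otimes> e v else \<zero>) V"
      using v by (intro finsum_cong') (auto simp: m_assoc[symmetric] \<epsilon>_idem \<epsilon>_orth)
    finally have 1: "\<epsilon> v \<otimes> u = finsum A (\<lambda>w. if v = w then \<epsilon> v \<otimes> e v else \<zero>) V" .
    have "u \<otimes> e v = finsum A (\<lambda>w. (\<epsilon> w \<otimes> e w) \<otimes> e v) V"
      unfolding u_def using v V by (intro finsum_ldistr) auto
    also have "\<dots> = finsum A (\<lambda>w. if v = w then \<epsilon> v \<otimes> e v else \<zero>) V"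
      using v by (intro finsum_cong') (auto simp: m_assoc e_idem e_orth)
    finally show ?thesis using 1 by simp
  qed
  have intertwine': "u' \<otimes> \<epsilon> v = e v \<otimes> u'" if v: "v \<in> V" for v
  proof -
    have "u' \<otimes> \<epsilon> v = u' \<otimes> (\<epsilon> v \<otimes> u) \<otimes> u'" using v u' by (simp add: m_assoc)
    also have "\<dots> = (u' \<otimes> u) \<otimes> e v \<otimes> u'" unfolding intertwine[OF v] using v by (simp add: m_assoc)
    finally show ?thesis using u' v by simp
  qed
  have "directed_dg_algebra A V e ht d"
  proof (unfold_locales, goal_cases)
    case 1 show ?case by (rule V)
  next
    case (2 v) then show ?case by (rule e)
  next
    case (3 v) then show ?case by (rule e_idem)
  next
    case 4 show ?case by (rule e_sum)
  next
    \<comment> \<open>The differential of a degree 0 element lies in degree 1, which is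
      zero.\<close>
    case (5 v)
    then show ?case using adif_degree[OF e[OF 5]] gr_outside[of 1] by simp
  next
    case (6 n) then show ?case by (rule gr_outside)
  next
    case (7 v w a)
    note v = 7(1) and w = 7(2) and a [simp] = 7(3) and va = 7(4) and aw = 7(5)
    define a' where "a' = u \<otimes> a \<otimes> u'"
    have a'c: "a' \<in> carrier A" unfolding a'_def by simp
    have a_eq: "a = u' \<otimes> a' \<otimes> u"
    proof -
      have "u' \<otimes> a' \<otimes> u = (u' \<otimes> u) \<otimes> a \<otimes> (u' \<otimes> u)" unfolding a'_def by (simp add: m_assoc)
      then show ?thesis using u' by simp
    qed
    have "\<epsilon> v \<otimes> a' = (\<epsilon> v \<otimes> u) \<otimes> a \<otimes> u'" unfolding a'_def using v by (simp add: m_assoc)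
    also have "\<dots> = u \<otimes> (e v \<otimes> a) \<otimes> u'" unfolding intertwine[OF v] using v by (simp add: m_assoc)
    finally have 1: "\<epsilon> v \<otimes> a' = a'" unfolding va a'_def .
    have "a' \<otimes> \<epsilon> w = u \<otimes> a \<otimes> (u' \<otimes> \<epsilon> w)" unfolding a'_def using w by (simp add: m_assoc)
    also have "\<dots> = u \<otimes> (a \<otimes> e w) \<otimes> u'" unfolding intertwine'[OF w] using w by (simp add: m_assoc)
    finally have 2: "a' \<otimes> \<epsilon> w = a'" unfolding aw a'_def .
    have "a' \<noteq> \<zero>" using a_eq 7(6) by auto
    from \<epsilon>_tri[OF v w a'c 1 2 this] show ?case
    proof (elim disjE conjE exE)
      fix c assume vw: "v = w" and c: "a' = c \<odot> \<epsilon> v"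
      have "a = c \<odot> (u' \<otimes> \<epsilon> v \<otimes> u)"
        unfolding a_eq c using v smult_mult_right[of u' "\<epsilon> v" c] smult_mult_left[of "u' \<otimes> \<epsilon> v" u c]
            by simp
      also have "u' \<otimes> \<epsilon> v \<otimes> u = e v \<otimes> (u' \<otimes> u)" unfolding intertwine'[OF v] using v
          by (simp add: m_assoc)
      finally show ?thesis using vw u' v by auto
    qed blast
  qed
  then show ?thesis by (rule that)
qed

end

section \<open>Bound quiver algebras of acyclic quivers\<close>

locale acyclic_quiver = fin_digraph Q for Q :: "('v, 'e) pre_digraph" +
  assumes acyclic: "\<nexists>p. cycle p"
begin

lemma closed_awalk_Nil: "awalk u p u \<Longrightarrow> p = []"
  using closed_w_imp_cycle[of p] acyclic unfolding closed_w_def by auto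

text \<open>A repeated vertex would split off a nontrivial closed walk and hence a cycle. So there
  are finitely many paths, and \<open>max_path_length\<close> is a maximum over a finite
  set.\<close>

lemma awalk_length:
  assumes "awalk u p v"
  shows "length p < card (verts Q)"
proof -
  have "distinct (awalk_verts u p)"
  proof (rule ccontr)
    assume "\<not> distinct (awalk_verts u p)"
    from awalk_not_distinct_decomp[OF assms this] show False
      using closed_w_imp_cycle acyclic unfolding closed_w_def by blast
  qed
  then show ?thesis using assms by (intro length_apath_less[of u p v]) (simp add: apath_def)
qed

lemma finite_quiver_paths: "finite (quiver_paths Q)"
proof (rule finite_subset)
  show "quiver_paths Q \<subseteq> verts Q \<times> {p. set p \<subseteq> arcs Q \<and> length p \<le> card (verts Q)}"
    unfolding quiver_paths_def using awalk_length by (fastforce simp: awalk_def)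
qed (simp add: finite_lists_length_le)

text \<open>The element 0 keeps the set nonempty when \<open>v\<close> is not a vertex.\<close>

definition height :: "'v \<Rightarrow> nat" where
  "height v = Max (insert 0 {length p |p. \<exists>w. awalk v p w})"

lemma finite_lengths: "finite {length p |p. \<exists>w. awalk v p w}"
  by (rule finite_subset[of _ "{..card (verts Q)}"]) (auto dest: awalk_length)

lemma height_le: "v \<in> verts Q \<Longrightarrow> height v \<le> max_path_length Q"
proof -
  assume v: "v \<in> verts Q"
  have fin: "finite ((\<lambda>(u, p). length p) ` quiver_paths Q)" using finite_quiver_paths by blast
  have "length p \<le> max_path_length Q" if "awalk v p w" for p w
    unfolding max_path_length_def using that
    by (intro Max_ge[OF fin] image_eqI[of _ _ "(v, p)"]) (auto simp: quiver_paths_def)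
  then show ?thesis unfolding height_def using finite_lengths by (subst Max_le_iff) auto
qed

text \<open>A longest path out of \<open>w\<close> can be prolonged at its start by
  \<open>p\<close>.\<close>

lemma height_less:
  assumes p: "awalk v p w" and ne: "p \<noteq> []"
  shows "height w < height v"
proof -
  have h: "height w \<in> insert 0 {length p |p. \<exists>u. awalk w p u}"
    unfolding height_def by (rule Max_in) (simp_all add: finite_lengths)
  have "w \<in> verts Q"
    using p awlast_in_verts[of v p] awlast_if_cas[of v p w] by (auto simp: awalk_def)
  then have nil: "awalk w [] w" by (simp add: awalk_Nil_iff)
  obtain q u where q: "awalk w q u" "height w = length q"
  proof (cases "height w = 0")
    case True
    then show ?thesis using nil that[of "[]" w] by simp
  next
    case False
    then show ?thesis using h that by auto
  qed
  have "awalk v (p @ q) u" using p q by (metis awalk_appendI)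
  then have "length (p @ q) \<in> {length p |p. \<exists>w. awalk v p w}" by blast
  then have "length (p @ q) \<le> height v"
    unfolding height_def using finite_lengths by (intro Max_ge) auto
  then show ?thesis using q ne by (cases p) auto
qed

end

section \<open>Multiplication by trivial paths\<close>

lemma path_algebra_simps [simp]:
  "carrier (path_algebra Q) = {f. finite {x. f x \<noteq> 0} \<and> {x. f x \<noteq> 0} \<subseteq> quiver_paths Q}"
  "f \<otimes>\<^bsub>path_algebra Q\<^esub> g = (\<lambda>(u, p). \<Sum>i\<le>length p. f (u, take i p) * g (path_target Q u (take i p),
      drop i p))"
  "\<one>\<^bsub>path_algebra Q\<^esub> = (\<lambda>(u, p). if u \<in> verts Q \<and> p = [] then 1 else 0)"
  "\<zero>\<^bsub>path_algebra Q\<^esub> = (\<lambda>_. 0)"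
  "f \<oplus>\<^bsub>path_algebra Q\<^esub> g = (\<lambda>x. f x + g x)"
  "c \<odot>\<^bsub>path_algebra Q\<^esub> f = (\<lambda>x. c * f x)"
  by (simp_all add: path_algebra_def)

definition vertex_path :: "'v \<Rightarrow> ('v \<times> 'e list \<Rightarrow> 'k::field)" where
  "vertex_path v = (\<lambda>x. if x = (v, []) then 1 else 0)"

lemma path_target_Nil [simp]: "path_target Q u [] = u"
  by (simp add: path_target_def pre_digraph.awalk_verts.simps)

text \<open>Only the cut at the start of a path contributes. The case of a single vertex gives its
  idempotent; taking all vertices gives the scalar \<open>c\<close> as an element of the
  algebra.\<close>

lemma scaled_vertex_path_mult:
  "((\<lambda>(u, p). if u \<in> W \<and> p = [] then c else 0) \<otimes>\<^bsub>path_algebra Q\<^esub> f) =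
      (\<lambda>(u, p). if u \<in> W then c * f (u, p) else 0)"
proof (rule ext, clarify)
  fix u p
  have "(\<Sum>i\<le>length p. (if u \<in> W \<and> take i p = [] then c else 0) * f (path_target Q u (take i p), drop
      i p))
    = (\<Sum>i\<in>{0}. (if u \<in> W \<and> take i p = [] then c else 0) * f (path_target Q u (take i p), drop i p))"
    by (rule sum.mono_neutral_right) auto
  then show "((\<lambda>(u, p). if u \<in> W \<and> p = [] then c else 0) \<otimes>\<^bsub>path_algebra Q\<^esub> f) (u, p) =
      (if u \<in> W then c * f (u, p) else 0)"
    by simp
qed

lemma vertex_path_mult:
  "vertex_path v \<otimes>\<^bsub>path_algebra Q\<^esub> f = (\<lambda>(u, p). if u = v then f (u, p) else 0)"
proof -
  have eq: "vertex_path v = (\<lambda>(u, p). if u \<in> {v} \<and> p = [] then 1 else 0)"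
    by (auto simp: vertex_path_def fun_eq_iff)
  show ?thesis unfolding eq scaled_vertex_path_mult by (auto simp: fun_eq_iff)
qed

lemma mult_vertex_path:
  "f \<otimes>\<^bsub>path_algebra Q\<^esub> vertex_path w = (\<lambda>(u, p). if path_target Q u p = w then f (u, p) else 0)"
proof (rule ext, clarify)
  fix u p
  have "(\<Sum>i\<le>length p. f (u, take i p) * vertex_path w (path_target Q u (take i p), drop i p))
    = (\<Sum>i\<in>{length p}. f (u, take i p) * vertex_path w (path_target Q u (take i p), drop i p))"
    by (rule sum.mono_neutral_right) (auto simp: vertex_path_def)
  then show "(f \<otimes>\<^bsub>path_algebra Q\<^esub> vertex_path w) (u, p) = (if path_target Q u p =
      w then f (u, p) else 0)"
    by (simp add: vertex_path_def)
qed

lemma vertex_path_closed: "v \<in> verts Q \<Longrightarrow> vertex_path v \<in> carrier (path_algebra Q)"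
  by (auto simp: vertex_path_def quiver_paths_def pre_digraph.awalk_def pre_digraph.cas.simps)

text \<open>\<open>module.truncate\<close> forgets the grading and the differential: both are
  arbitrary on the given algebra.\<close>

locale bound_quiver = acyclic_quiver Q + A: dg_algebra A + I: ideal I "path_algebra Q"
  for Q :: "('v, 'e) pre_digraph" and I :: "('v \<times> 'e list \<Rightarrow> 'k::field) set"
    and A :: "('k, ('v \<times> 'e list \<Rightarrow> 'k) set) dg_algebra" +
  assumes A_eq: "module.truncate A = bound_quiver_algebra Q I"
begin

abbreviation R :: "('k, 'v \<times> 'e list \<Rightarrow> 'k) module" where "R \<equiv> path_algebra Q"

lemma zero_in_I: "\<zero>\<^bsub>R\<^esub> \<in> I"
  by (rule additive_subgroup.zero_closed[OF I.is_additive_subgroup])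

definition cls :: "('v \<times> 'e list \<Rightarrow> 'k) \<Rightarrow> ('v \<times> 'e list \<Rightarrow> 'k) set" where
  "cls f = I +>\<^bsub>R\<^esub> f"

lemma A_simps:
  "carrier A = carrier (R Quot I)" "a \<otimes>\<^bsub>A\<^esub> b = a \<otimes>\<^bsub>R Quot I\<^esub> b" "\<one>\<^bsub>A\<^esub> = \<one>\<^bsub>R Quot I\<^esub>"
  "\<zero>\<^bsub>A\<^esub> = \<zero>\<^bsub>R Quot I\<^esub>" "a \<oplus>\<^bsub>A\<^esub> b = a \<oplus>\<^bsub>R Quot I\<^esub> b"
  "c \<odot>\<^bsub>A\<^esub> S = (\<Union>x\<in>S. I +>\<^bsub>R\<^esub> (c \<odot>\<^bsub>R\<^esub> x))"
proof -
  note eq = A_eq[unfolded bound_quiver_algebra_def quotient_algebra_def]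
  show "carrier A = carrier (R Quot I)"
    using arg_cong[OF eq, of carrier] by (simp add: module.defs ring.defs)
  show "a \<otimes>\<^bsub>A\<^esub> b = a \<otimes>\<^bsub>R Quot I\<^esub> b"
    using arg_cong[OF eq, of "\<lambda>x. a \<otimes>\<^bsub>x\<^esub> b"] by (simp add: module.defs ring.defs)
  show "\<one>\<^bsub>A\<^esub> = \<one>\<^bsub>R Quot I\<^esub>"
    using arg_cong[OF eq, of one] by (simp add: module.defs ring.defs)
  show "\<zero>\<^bsub>A\<^esub> = \<zero>\<^bsub>R Quot I\<^esub>"
    using arg_cong[OF eq, of ring.zero] by (simp add: module.defs ring.defs)
  show "a \<oplus>\<^bsub>A\<^esub> b = a \<oplus>\<^bsub>R Quot I\<^esub> b"
    using arg_cong[OF eq, of "\<lambda>x. a \<oplus>\<^bsub>x\<^esub> b"] by (simp add: module.defs ring.defs)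
  show "c \<odot>\<^bsub>A\<^esub> S = (\<Union>x\<in>S. I +>\<^bsub>R\<^esub> (c \<odot>\<^bsub>R\<^esub> x))"
    using arg_cong[OF eq, of "\<lambda>x. c \<odot>\<^bsub>x\<^esub> S"] by (simp add: module.defs ring.defs)
qed

lemma cls_closed: "f \<in> carrier R \<Longrightarrow> cls f \<in> carrier A"
  and cls_mult: "\<lbrakk>f \<in> carrier R; g \<in> carrier R\<rbrakk> \<Longrightarrow> cls (f \<otimes>\<^bsub>R\<^esub> g) = cls f \<otimes>\<^bsub>A\<^esub> cls g"
  and cls_add: "\<lbrakk>f \<in> carrier R; g \<in> carrier R\<rbrakk> \<Longrightarrow> cls (f \<oplus>\<^bsub>R\<^esub> g) = cls f \<oplus>\<^bsub>A\<^esub> cls g"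
  and cls_one: "cls \<one>\<^bsub>R\<^esub> = \<one>\<^bsub>A\<^esub>"
  using I.rcos_ring_hom unfolding ring_hom_def A_simps cls_def
      by (auto simp del: path_algebra_simps)

lemma cls_surj: "a \<in> carrier A \<Longrightarrow> \<exists>f\<in>carrier R. a = cls f"
  unfolding A_simps cls_def FactRing_def A_RCOSETS_defs a_r_coset_def
      by (auto simp del: path_algebra_simps)

lemma cls_ideal: "i \<in> I \<Longrightarrow> cls i = \<zero>\<^bsub>A\<^esub>"
  unfolding A_simps cls_def using I.a_rcos_const by (simp add: FactRing_def)

text \<open>\<open>ideal\<close> refers to the ring structure alone; multiplication by
  \<open>c\<close> is realised by the element \<open>c\<close> times the unit, which is a finite sum
  of trivial paths.\<close>

lemma scal_ideal:
  assumes i: "i \<in> I"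
  shows "c \<odot>\<^bsub>R\<^esub> i \<in> I"
proof -
  let ?c = "\<lambda>(u, p). if u \<in> verts Q \<and> p = [] then c else 0"
  have iR: "i \<in> carrier R" using i I.a_Hcarr by blast
  have "?c \<in> carrier R"
  proof -
    have "finite {x. ?c x \<noteq> 0}"
      by (rule finite_subset[of _ "verts Q \<times> {[]}"]) (auto split: if_splits)
    then show ?thesis by (auto simp: quiver_paths_def awalk_Nil_iff split: if_splits)
  qed
  from I.I_l_closed[OF i this] have "?c \<otimes>\<^bsub>R\<^esub> i \<in> I" .
  moreover have "?c \<otimes>\<^bsub>R\<^esub> i = c \<odot>\<^bsub>R\<^esub> i"
    unfolding scaled_vertex_path_mult using iR by (auto simp: quiver_paths_def awalk_def fun_eq_iff)
  ultimately show ?thesis by simp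
qed

lemma scal_closed: "f \<in> carrier R \<Longrightarrow> c \<odot>\<^bsub>R\<^esub> f \<in> carrier R"
  by (auto intro: finite_subset[rotated])

text \<open>The scalar multiple of a coset is a union over all representatives; by
  \<open>scal_ideal\<close> each of them contributes the same coset.\<close>

lemma cls_scal:
  assumes f: "f \<in> carrier R"
  shows "c \<odot>\<^bsub>A\<^esub> cls f = cls (c \<odot>\<^bsub>R\<^esub> f)"
proof -
  have "I +>\<^bsub>R\<^esub> (c \<odot>\<^bsub>R\<^esub> x) = cls (c \<odot>\<^bsub>R\<^esub> f)" if "x \<in> cls f" for x
  proof -
    from that obtain i where i: "i \<in> I" "x = i \<oplus>\<^bsub>R\<^esub> f"
      unfolding cls_def a_r_coset_def r_coset_def by auto
    have iR: "c \<odot>\<^bsub>R\<^esub> i \<in> carrier R" using scal_ideal[OF i(1)] I.a_Hcarr by blast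
    have "c \<odot>\<^bsub>R\<^esub> x = c \<odot>\<^bsub>R\<^esub> i \<oplus>\<^bsub>R\<^esub> c \<odot>\<^bsub>R\<^esub> f" unfolding i by (simp add: distrib_left)
    then have "cls (c \<odot>\<^bsub>R\<^esub> x) = cls (c \<odot>\<^bsub>R\<^esub> i) \<oplus>\<^bsub>A\<^esub> cls (c \<odot>\<^bsub>R\<^esub> f)"
      using cls_add[OF iR scal_closed[OF f]] by simp
    also have "\<dots> = cls (c \<odot>\<^bsub>R\<^esub> f)"
      using cls_ideal[OF scal_ideal[OF i(1)]] cls_closed[OF scal_closed[OF f]]
          by (simp del: path_algebra_simps)
    finally show ?thesis unfolding cls_def .
  qed
  moreover have "f \<in> cls f" unfolding cls_def by (rule I.a_rcos_self[OF f])
  ultimately show ?thesis unfolding A_simps by blast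
qed

definition \<epsilon> :: "'v \<Rightarrow> ('v \<times> 'e list \<Rightarrow> 'k) set" where
  "\<epsilon> v = cls (vertex_path v)"

lemma \<epsilon>_mult:
  assumes "v \<in> verts Q" "w \<in> verts Q"
  shows "\<epsilon> v \<otimes>\<^bsub>A\<^esub> \<epsilon> w = (if v = w then \<epsilon> v else \<zero>\<^bsub>A\<^esub>)"
proof -
  have "\<epsilon> v \<otimes>\<^bsub>A\<^esub> \<epsilon> w = cls (vertex_path v \<otimes>\<^bsub>R\<^esub> vertex_path w)"
    unfolding \<epsilon>_def using assms by (simp only: cls_mult vertex_path_closed)
  also have "vertex_path v \<otimes>\<^bsub>R\<^esub> vertex_path w = (if v = w then vertex_path v else \<zero>\<^bsub>R\<^esub>)"
    unfolding vertex_path_mult by (auto simp: vertex_path_def fun_eq_iff)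
  also have "cls \<dots> = (if v = w then \<epsilon> v else \<zero>\<^bsub>A\<^esub>)"
    using cls_ideal[of "\<zero>\<^bsub>R\<^esub>"] zero_in_I by (simp add: \<epsilon>_def del: path_algebra_simps)
  finally show ?thesis .
qed

lemma \<epsilon>_sum: "finsum A \<epsilon> (verts Q) = \<one>\<^bsub>A\<^esub>"
proof -
  have "finsum A \<epsilon> W = cls (\<lambda>(u, p). if u \<in> W \<and> p = [] then 1 else 0) \<and>
    (\<lambda>(u, p). if u \<in> W \<and> p = [] then 1 else 0) \<in> carrier R" if "W \<subseteq> verts Q" for W
    using finite_subset[OF that finite_verts] that
  proof (induction W)
    case empty
    have "cls (\<lambda>_. 0) = \<zero>\<^bsub>A\<^esub>" using cls_ideal[OF zero_in_I] by simp
    then show ?case by (simp add: case_prod_unfold)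
  next
    case (insert v W)
    let ?f = "\<lambda>(u, p). if u \<in> W \<and> p = [] then (1::'k) else 0"
    have v: "v \<in> verts Q" and IH: "finsum A \<epsilon> W = cls ?f" "?f \<in> carrier R" using insert by auto
    have eq: "(\<lambda>(u, p). if u \<in> insert v W \<and> p = [] then 1 else 0) = vertex_path v \<oplus>\<^bsub>R\<^esub> ?f"
      using insert(2) by (auto simp: fun_eq_iff vertex_path_def)
    have "finsum A \<epsilon> (insert v W) = \<epsilon> v \<oplus>\<^bsub>A\<^esub> finsum A \<epsilon> W"
      using insert(1,2,4) cls_closed[OF vertex_path_closed] unfolding \<epsilon>_def
      by (intro A.finsum_insert) (auto simp del: path_algebra_simps)
    then show ?case
      unfolding eq IH \<epsilon>_def using cls_add[OF vertex_path_closed[OF v] IH(2)]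
        I.add.m_closed[OF vertex_path_closed[OF v] IH(2)] by simp
  qed
  from this[of "verts Q"] show ?thesis using cls_one by simp
qed

text \<open>Multiplying a representative by the two trivial paths does not change its class and
  leaves only paths from \<open>v\<close> to \<open>w\<close>.\<close>

lemma \<epsilon>_triangular:
  assumes v: "v \<in> verts Q" and w: "w \<in> verts Q" and a: "a \<in> carrier A"
    and va: "\<epsilon> v \<otimes>\<^bsub>A\<^esub> a = a" and aw: "a \<otimes>\<^bsub>A\<^esub> \<epsilon> w = a" and nz: "a \<noteq> \<zero>\<^bsub>A\<^esub>"
  shows "(v = w \<and> (\<exists>c. a = c \<odot>\<^bsub>A\<^esub> \<epsilon> v)) \<or> height w < height v"
proof -
  obtain f where f: "f \<in> carrier R" "a = cls f" using cls_surj[OF a] by blast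
  note vp = vertex_path_closed[OF v] vertex_path_closed[OF w]
  define f' where "f' = vertex_path v \<otimes>\<^bsub>R\<^esub> f \<otimes>\<^bsub>R\<^esub> vertex_path w"
  have vf: "vertex_path v \<otimes>\<^bsub>R\<^esub> f \<in> carrier R" by (rule I.m_closed[OF vp(1) f(1)])
  have "cls f' = \<epsilon> v \<otimes>\<^bsub>A\<^esub> a \<otimes>\<^bsub>A\<^esub> \<epsilon> w"
    unfolding f'_def \<epsilon>_def f(2) cls_mult[OF vf vp(2)] cls_mult[OF vp(1) f(1)] ..
  then have a_f': "a = cls f'" using va aw by simp
  have f'_eq: "f' = (\<lambda>(u, p). if u = v \<and> path_target Q u p = w then f (u, p) else 0)"
    unfolding f'_def mult_vertex_path vertex_path_mult by (auto simp: fun_eq_iff)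
  have walk: "awalk v p w" if "f' (u, p) \<noteq> 0" for u p
  proof -
    have "u = v" "path_target Q u p = w" "f (u, p) \<noteq> 0" using that unfolding f'_eq
        by (auto split: if_splits)
    moreover have "(u, p) \<in> quiver_paths Q" using f(1) \<open>f (u, p) \<noteq> 0\<close> by auto
    ultimately show ?thesis
      unfolding quiver_paths_def path_target_def by (auto dest: awalkE)
  qed
  show ?thesis
  proof (cases "v = w")
    case True
    \<comment> \<open>Without oriented cycles the only path from \<open>v\<close> to itself is the
      trivial one.\<close>
    have "f' = f (v, []) \<odot>\<^bsub>R\<^esub> vertex_path v"
    proof (rule ext, clarify)
      fix u p
      show "f' (u, p) = (f (v, []) \<odot>\<^bsub>R\<^esub> vertex_path v) (u, p)"
        using walk[of u p] closed_awalk_Nil[of v p] True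
        by (cases "f' (u, p) = 0") (auto simp: f'_eq vertex_path_def split: if_splits)
    qed
    then have "a = f (v, []) \<odot>\<^bsub>A\<^esub> \<epsilon> v"
      unfolding a_f' \<epsilon>_def cls_scal[OF vp(1)] by simp
    then show ?thesis using True by blast
  next
    case False
    have "f' \<noteq> (\<lambda>_. 0)"
      using a_f' nz cls_ideal[of "\<zero>\<^bsub>R\<^esub>"] zero_in_I by auto
    then obtain u p where "f' (u, p) \<noteq> 0" by (auto simp: fun_eq_iff)
    from walk[OF this] have p: "awalk v p w" .
    then have "p \<noteq> []" using False by (auto simp: awalk_Nil_iff)
    then show ?thesis using height_less[OF p] by blast
  qed
qed

text \<open>The cardinality bound on the coefficients of free modules that lets the resolution fit
  into \<open>'m\<close>.\<close>

lemma carrier_lepoll: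
  assumes "infinite (UNIV :: 'm set)" "(UNIV :: 'k set) \<lesssim> (UNIV :: 'm set)"
  shows "carrier A \<lesssim> (UNIV :: 'm set)"
proof -
  have "carrier R = {f. finite {x. f x \<noteq> 0} \<and> {x. f x \<noteq> 0} \<subseteq> quiver_paths Q \<and> range f \<subseteq> UNIV}"
    by simp
  moreover have "quiver_paths Q \<lesssim> (UNIV :: 'm set)"
    by (rule finite_lepoll_infinite[OF assms(1) finite_quiver_paths])
  ultimately have R: "carrier R \<lesssim> (UNIV :: 'm set)"
    using finite_support_lepoll[OF assms(1) _ assms(2), of "quiver_paths Q" 0] by (simp only:)
  have "carrier A \<subseteq> cls ` carrier R" using cls_surj by blast
  then show ?thesis
    using lepoll_trans[OF subset_imp_lepoll lepoll_trans[OF image_lepoll R]] by blast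
qed

end

section \<open>Cohomology, homotopy and the derived category\<close>

lemma dg_hom_iff_chain_map: "f \<in> dg_hom A M N \<longleftrightarrow> chain_map A M N f"
  unfolding dg_hom_def chain_map_def lin_map_def by auto

section \<open>Cohomology classes and quasi-isomorphisms\<close>

context dg_module
begin

lemma cocycles_iff: "x \<in> cocycles M n \<longleftrightarrow> x \<in> carrier (part M n) \<and> dif M n x = \<zero>\<^bsub>part M (n + 1)\<^esub>"
  by (auto simp: cocycles_def a_kernel_def kernel_def)

lemma coboundaries_iff: "x \<in> coboundaries M n \<longleftrightarrow> (\<exists>y\<in>carrier (part M (n - 1)). x = dif M (n - 1) y)"
  by (auto simp: coboundaries_def)

lemma coboundary_cocycle: "x \<in> coboundaries M n \<Longrightarrow> x \<in> cocycles M n"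
  unfolding coboundaries_iff cocycles_iff by (auto simp: dif_closed' dif_dif'[of _ "n - 1"]
      add.commute)

lemma cocycles_closed: "x \<in> cocycles M n \<Longrightarrow> x \<in> carrier (part M n)"
  by (simp add: cocycles_iff)

lemma cocycles_add: "\<lbrakk>x \<in> cocycles M n; y \<in> cocycles M n\<rbrakk> \<Longrightarrow> x \<oplus>\<^bsub>part M n\<^esub> y \<in> cocycles M n"
  by (simp add: cocycles_iff dif_add[of _ _ _ "n + 1"])

lemma cocycles_zero: "\<zero>\<^bsub>part M n\<^esub> \<in> cocycles M n"
  by (simp add: cocycles_iff dif_zero[of "n + 1"])

lemma cocycles_minus: "x \<in> cocycles M n \<Longrightarrow> \<ominus>\<^bsub>part M n\<^esub> x \<in> cocycles M n"
proof -
  have "\<ominus>\<^bsub>part M (n + 1)\<^esub> \<zero>\<^bsub>part M (n + 1)\<^esub> = \<zero>\<^bsub>part M (n + 1)\<^esub>"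
    by (rule P.minus_equality) auto
  then show "x \<in> cocycles M n \<Longrightarrow> \<ominus>\<^bsub>part M n\<^esub> x \<in> cocycles M n"
    by (simp add: cocycles_iff dif_minus[of _ _ "n + 1"])
qed

lemma coboundaries_add: "\<lbrakk>x \<in> coboundaries M n; y \<in> coboundaries M n\<rbrakk> \<Longrightarrow>
    x \<oplus>\<^bsub>part M n\<^esub> y \<in> coboundaries M n"
  unfolding coboundaries_iff
proof (elim bexE)
  fix x' y' assume *: "x' \<in> carrier (part M (n - 1))" "x =
      dif M (n - 1) x'" "y' \<in> carrier (part M (n - 1))" "y = dif M (n - 1) y'"
  then have "x \<oplus>\<^bsub>part M n\<^esub> y = dif M (n - 1) (x' \<oplus>\<^bsub>part M (n - 1)\<^esub> y')"
      by (simp add: dif_add[of _ _ _ n])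
  then show "\<exists>z\<in>carrier (part M (n - 1)). x \<oplus>\<^bsub>part M n\<^esub> y = dif M (n - 1) z" using * by blast
qed

lemma coboundaries_zero: "\<zero>\<^bsub>part M n\<^esub> \<in> coboundaries M n"
  unfolding coboundaries_iff using dif_zero[of n "n - 1"] by (intro bexI[of _ "\<zero>\<^bsub>part M (n - 1)\<^esub>"])
      simp_all

lemma coboundaries_minus: "x \<in> coboundaries M n \<Longrightarrow> \<ominus>\<^bsub>part M n\<^esub> x \<in> coboundaries M n"
  unfolding coboundaries_iff
proof (elim bexE)
  fix x' assume *: "x' \<in> carrier (part M (n - 1))" "x = dif M (n - 1) x'"
  then have "\<ominus>\<^bsub>part M n\<^esub> x = dif M (n - 1) (\<ominus>\<^bsub>part M (n - 1)\<^esub> x')"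
      by (simp add: dif_minus[of _ _ n])
  then show "\<exists>z\<in>carrier (part M (n - 1)). \<ominus>\<^bsub>part M n\<^esub> x = dif M (n - 1) z" using * by blast
qed

definition coh_class :: "int \<Rightarrow> 'm \<Rightarrow> 'm set" where
  "coh_class n x = coboundaries M n +>\<^bsub>part M n\<^esub> x"

lemma mem_coh_class: "y \<in> coh_class n x \<longleftrightarrow> (\<exists>b\<in>coboundaries M n. y = b \<oplus>\<^bsub>part M n\<^esub> x)"
  by (auto simp: coh_class_def a_r_coset_def r_coset_def)

lemma coboundaries_closed: "x \<in> coboundaries M n \<Longrightarrow> x \<in> carrier (part M n)"
  by (rule cocycles_closed[OF coboundary_cocycle])

lemma coh_class_eq_iff:
  assumes x: "x \<in> carrier (part M n)" and y: "y \<in> carrier (part M n)"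
  shows "coh_class n x = coh_class n y \<longleftrightarrow> (\<exists>b\<in>coboundaries M n. x = b \<oplus>\<^bsub>part M n\<^esub> y)"
proof
  assume "coh_class n x = coh_class n y"
  moreover have "x \<in> coh_class n x"
    unfolding mem_coh_class using coboundaries_zero x by (intro bexI[of _ "\<zero>\<^bsub>part M n\<^esub>"]) auto
  ultimately show "\<exists>b\<in>coboundaries M n. x = b \<oplus>\<^bsub>part M n\<^esub> y" unfolding mem_coh_class[symmetric]
      by simp
next
  have sub: "coh_class n x \<subseteq> coh_class n y"
    if "x \<in> carrier (part M n)" "y \<in> carrier (part M n)" "b \<in> coboundaries M n" "x =
        b \<oplus>\<^bsub>part M n\<^esub> y" for x y b
  proof
    fix z assume "z \<in> coh_class n x"
    then obtain c where c: "c \<in> coboundaries M n" "z = c \<oplus>\<^bsub>part M n\<^esub> x" unfolding mem_coh_class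
        by blast
    then have "z = c \<oplus>\<^bsub>part M n\<^esub> b \<oplus>\<^bsub>part M n\<^esub> y"
      unfolding c that(4) using that coboundaries_closed by (simp add: P.a_assoc)
    then show "z \<in> coh_class n y" unfolding mem_coh_class using coboundaries_add[OF c(1) that(3)]
        by blast
  qed
  assume "\<exists>b\<in>coboundaries M n. x = b \<oplus>\<^bsub>part M n\<^esub> y"
  then obtain b where b: "b \<in> coboundaries M n" "x = b \<oplus>\<^bsub>part M n\<^esub> y" by blast
  have "y = \<ominus>\<^bsub>part M n\<^esub> b \<oplus>\<^bsub>part M n\<^esub> x"
    unfolding b using coboundaries_closed[OF b(1)] y by (simp add: P.r_neg1)
  then show "coh_class n x = coh_class n y"
    using sub[OF x y b] sub[OF y x coboundaries_minus[OF b(1)]] by blast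
qed

lemma coh_class_coboundary:
  assumes "x \<in> cocycles M n"
  shows "coh_class n x = coboundaries M n \<longleftrightarrow> x \<in> coboundaries M n"
proof -
  have "coboundaries M n = coh_class n \<zero>\<^bsub>part M n\<^esub>"
    using coboundaries_closed by (auto simp: mem_coh_class)
  then show ?thesis
    using coh_class_eq_iff[OF cocycles_closed[OF assms] P.zero_closed] coboundaries_closed by auto
qed

lemma carrier_cohomology: "carrier (cohomology M n) = coh_class n ` cocycles M n"
  by (auto simp: cohomology_def FactGroup_def RCOSETS_def coh_class_def a_r_coset_def r_coset_def)

lemma cohomology_mult:
  assumes x: "x \<in> cocycles M n" and y: "y \<in> cocycles M n"
  shows "coh_class n x \<otimes>\<^bsub>cohomology M n\<^esub> coh_class n y = coh_class n (x \<oplus>\<^bsub>part M n\<^esub> y)"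
proof -
  note c = cocycles_closed[OF x] cocycles_closed[OF y]
  have "coh_class n x \<otimes>\<^bsub>cohomology M n\<^esub> coh_class n y =
      (\<Union>a\<in>coh_class n x. \<Union>b\<in>coh_class n y. {a \<oplus>\<^bsub>part M n\<^esub> b})"
    by (simp add: cohomology_def FactGroup_def set_mult_def)
  also have "\<dots> = coh_class n (x \<oplus>\<^bsub>part M n\<^esub> y)"
  proof (intro subset_antisym subsetI)
    fix z assume "z \<in> (\<Union>a\<in>coh_class n x. \<Union>b\<in>coh_class n y. {a \<oplus>\<^bsub>part M n\<^esub> b})"
    then obtain a b where ab: "a \<in> coboundaries M n" "b \<in> coboundaries M n"
      "z = (a \<oplus>\<^bsub>part M n\<^esub> x) \<oplus>\<^bsub>part M n\<^esub> (b \<oplus>\<^bsub>part M n\<^esub> y)" by (auto simp: mem_coh_class)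
    then have "z = (a \<oplus>\<^bsub>part M n\<^esub> b) \<oplus>\<^bsub>part M n\<^esub> (x \<oplus>\<^bsub>part M n\<^esub> y)"
      using c coboundaries_closed by (simp add: P.a_ac)
    then show "z \<in> coh_class n (x \<oplus>\<^bsub>part M n\<^esub> y)"
      unfolding mem_coh_class using coboundaries_add[OF ab(1,2)] by blast
  next
    fix z assume "z \<in> coh_class n (x \<oplus>\<^bsub>part M n\<^esub> y)"
    then obtain b where b: "b \<in> coboundaries M n" "z = b \<oplus>\<^bsub>part M n\<^esub> (x \<oplus>\<^bsub>part M n\<^esub> y)"
        unfolding mem_coh_class by blast
    then have "z = (b \<oplus>\<^bsub>part M n\<^esub> x) \<oplus>\<^bsub>part M n\<^esub> (\<zero>\<^bsub>part M n\<^esub> \<oplus>\<^bsub>part M n\<^esub> y)"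
      using c coboundaries_closed by (simp add: P.a_assoc)
    moreover have "b \<oplus>\<^bsub>part M n\<^esub> x \<in> coh_class n x" "\<zero>\<^bsub>part M n\<^esub> \<oplus>\<^bsub>part M n\<^esub> y \<in> coh_class n y"
      unfolding mem_coh_class using b coboundaries_zero by blast+
    ultimately show "z \<in> (\<Union>a\<in>coh_class n x. \<Union>b\<in>coh_class n y. {a \<oplus>\<^bsub>part M n\<^esub> b})" by blast
  qed
  finally show ?thesis .
qed

lemma trivial_cohomologyD:
  assumes "trivial_group (cohomology M n)" "x \<in> cocycles M n"
  shows "x \<in> coboundaries M n"
proof -
  have "carrier (cohomology M n) = {\<one>\<^bsub>cohomology M n\<^esub>}" using assms(1)
      by (simp add: trivial_group_def)
  moreover have "\<one>\<^bsub>cohomology M n\<^esub> = coboundaries M n" by (simp add: cohomology_def FactGroup_def)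
  ultimately have "coh_class n x = coboundaries M n"
    using assms(2) unfolding carrier_cohomology by blast
  then show ?thesis using coh_class_coboundary[OF assms(2)] by simp
qed

end

text \<open>The two clauses are surjectivity and injectivity on cohomology, expressed by cocycles so
  that cosets do not occur below.\<close>

lemma quasi_iso_iff:
  assumes Z: "dg_module A Z" and M: "dg_module A M" and s: "chain_map A Z M s"
  shows "quasi_iso Z M s \<longleftrightarrow> (\<forall>n.
    (\<forall>y\<in>cocycles M n. \<exists>x\<in>cocycles Z n. \<exists>b\<in>coboundaries M n. y = b \<oplus>\<^bsub>part M n\<^esub> s n x) \<and>
    (\<forall>x\<in>cocycles Z n. s n x \<in> coboundaries M n \<longrightarrow> x \<in> coboundaries Z n))"
  unfolding quasi_iso_def
proof (rule all_cong1)
  fix n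
  interpret Z: dg_module A Z by (rule Z)
  interpret M: dg_module A M by (rule M)
  let ?f = "cohomology_map M s n"
  have sc: "s n x \<in> cocycles M n" if "x \<in> cocycles Z n" for x
    using that chain_map_closed[OF s, of x n] chain_map_dif[OF s, of x n "n + 1"]
      lin_map_zero[OF Z M chain_map_lin[OF s], of "n + 1" "n + 1"]
    unfolding Z.cocycles_iff M.cocycles_iff by simp
  have sb: "s n x \<in> coboundaries M n" if "x \<in> coboundaries Z n" for x
    using that chain_map_closed[OF s, of _ "n - 1"] chain_map_dif[OF s, of _ "n - 1" n]
    unfolding Z.coboundaries_iff M.coboundaries_iff by auto
  have s_add: "s n (x \<oplus>\<^bsub>part Z n\<^esub> y) = s n x \<oplus>\<^bsub>part M n\<^esub> s n y"
    if "x \<in> carrier (part Z n)" "y \<in> carrier (part Z n)" for x y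
    using lin_map_add[OF chain_map_lin[OF s] that, of n] by simp
  note closed = Z.cocycles_closed M.cocycles_closed Z.coboundaries_closed M.coboundaries_closed
  have f: "?f (Z.coh_class n x) = M.coh_class n (s n x)" if x: "x \<in> cocycles Z n" for x
  proof -
    have "M.coh_class n (s n x') = M.coh_class n (s n x)" if x': "x' \<in> Z.coh_class n x" for x'
    proof -
      obtain b where b: "b \<in> coboundaries Z n" "x' = b \<oplus>\<^bsub>part Z n\<^esub> x" using x'
          unfolding Z.mem_coh_class by blast
      have "s n x' = s n b \<oplus>\<^bsub>part M n\<^esub> s n x" unfolding b(2)
          by (rule s_add[OF closed(3)[OF b(1)] closed(1)[OF x]])
      moreover have "s n x' \<in> carrier (part M n)"
        using b closed(1)[OF x] closed(3)[OF b(1)] chain_map_closed[OF s] by simp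
      ultimately show ?thesis
        using M.coh_class_eq_iff[OF _ closed(2)[OF sc[OF x]]] sb[OF b(1)] by blast
    qed
    moreover have "x \<in> Z.coh_class n x"
      unfolding Z.mem_coh_class using Z.coboundaries_zero closed(1)[OF x]
          by (intro bexI[of _ "\<zero>\<^bsub>part Z n\<^esub>"]) auto
    ultimately show ?thesis unfolding cohomology_map_def M.coh_class_def[symmetric] by blast
  qed
  show "?f \<in> iso (cohomology Z n) (cohomology M n) \<longleftrightarrow>
    (\<forall>y\<in>cocycles M n. \<exists>x\<in>cocycles Z n. \<exists>b\<in>coboundaries M n. y = b \<oplus>\<^bsub>part M n\<^esub> s n x) \<and>
    (\<forall>x\<in>cocycles Z n. s n x \<in> coboundaries M n \<longrightarrow> x \<in> coboundaries Z n)" (is "_ \<longleftrightarrow> ?surj \<and> ?inj")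
  proof
    assume "?f \<in> iso (cohomology Z n) (cohomology M n)"
    then have bij: "bij_betw ?f (carrier (cohomology Z n)) (carrier (cohomology M n))"
        by (simp add: iso_def)
    have ?surj
    proof
      fix y assume y: "y \<in> cocycles M n"
      then have "M.coh_class n y \<in> ?f ` carrier (cohomology Z n)"
        using bij_betw_imp_surj_on[OF bij] M.carrier_cohomology by blast
      then obtain x where x: "x \<in> cocycles Z n" "M.coh_class n y = M.coh_class n (s n x)"
        unfolding Z.carrier_cohomology using f by auto
      then show "\<exists>x\<in>cocycles Z n. \<exists>b\<in>coboundaries M n. y = b \<oplus>\<^bsub>part M n\<^esub> s n x"
        using M.coh_class_eq_iff[OF closed(2)[OF y] closed(2)[OF sc[OF x(1)]]] by blast
    qed
    moreover have ?inj
    proof (intro ballI impI)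
      fix x assume x: "x \<in> cocycles Z n" "s n x \<in> coboundaries M n"
      have 0: "s n \<zero>\<^bsub>part Z n\<^esub> \<in> coboundaries M n"
        using sb[OF Z.coboundaries_zero] .
      have "?f (Z.coh_class n x) = ?f (Z.coh_class n \<zero>\<^bsub>part Z n\<^esub>)"
        unfolding f[OF x(1)] f[OF Z.cocycles_zero]
        using M.coh_class_coboundary[OF sc[OF x(1)]]
            M.coh_class_coboundary[OF sc[OF Z.cocycles_zero]] x 0 by blast
      then have "Z.coh_class n x = Z.coh_class n \<zero>\<^bsub>part Z n\<^esub>"
        using bij_betw_imp_inj_on[OF bij] x(1) Z.cocycles_zero unfolding Z.carrier_cohomology
            inj_on_def by blast
      then show "x \<in> coboundaries Z n"
        using Z.coh_class_coboundary[OF x(1)] Z.coh_class_coboundary[OF Z.cocycles_zero]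
            Z.coboundaries_zero by blast
    qed
    ultimately show "?surj \<and> ?inj" ..
  next
    assume *: "?surj \<and> ?inj"
    have "?f \<in> hom (cohomology Z n) (cohomology M n)"
    proof (rule homI)
      fix S assume "S \<in> carrier (cohomology Z n)"
      then show "?f S \<in> carrier (cohomology M n)"
        unfolding Z.carrier_cohomology M.carrier_cohomology using f sc by auto
    next
      fix S T assume "S \<in> carrier (cohomology Z n)" "T \<in> carrier (cohomology Z n)"
      then obtain x y where x: "x \<in> cocycles Z n" "S = Z.coh_class n x" and y: "y \<in> cocycles Z n"
          "T = Z.coh_class n y"
        unfolding Z.carrier_cohomology by blast
      show "?f (S \<otimes>\<^bsub>cohomology Z n\<^esub> T) = ?f S \<otimes>\<^bsub>cohomology M n\<^esub> ?f T"
        unfolding x(2) y(2) Z.cohomology_mult[OF x(1) y(1)] f[OF x(1)] f[OF y(1)]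
            f[OF Z.cocycles_add[OF x(1) y(1)]]
          M.cohomology_mult[OF sc[OF x(1)] sc[OF y(1)]] s_add[OF closed(1)[OF x(1)]
              closed(1)[OF y(1)]] ..
    qed
    moreover have "bij_betw ?f (carrier (cohomology Z n)) (carrier (cohomology M n))"
      unfolding bij_betw_def
    proof
      show "inj_on ?f (carrier (cohomology Z n))"
      proof (rule inj_onI)
        fix S T assume "S \<in> carrier (cohomology Z n)" "T \<in> carrier (cohomology Z n)" and eq: "?f S =
            ?f T"
        then obtain x y where x: "x \<in> cocycles Z n" "S = Z.coh_class n x" and y: "y \<in> cocycles Z n"
            "T = Z.coh_class n y"
          unfolding Z.carrier_cohomology by blast
        have xc: "x \<in> carrier (part Z n)" "y \<in> carrier (part Z n)" using closed(1) x(1) y(1)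
            by blast+
        have "M.coh_class n (s n x) = M.coh_class n (s n y)" using eq unfolding x y f[OF x(1)]
            f[OF y(1)] .
        then obtain b where b: "b \<in> coboundaries M n" "s n x = b \<oplus>\<^bsub>part M n\<^esub> s n y"
          using M.coh_class_eq_iff[OF closed(2)[OF sc[OF x(1)]] closed(2)[OF sc[OF y(1)]]] by blast
        define z where "z = x \<oplus>\<^bsub>part Z n\<^esub> \<ominus>\<^bsub>part Z n\<^esub> y"
        have "s n z = s n x \<oplus>\<^bsub>part M n\<^esub> \<ominus>\<^bsub>part M n\<^esub> s n y"
          unfolding z_def using s_add[OF xc(1) Z.P.a_inv_closed[OF xc(2)]]
            lin_map_minus[OF Z M chain_map_lin[OF s], of n n y] xc by simp
        also have "\<dots> = b"
          unfolding b(2) using closed(4)[OF b(1)] closed(2)[OF sc[OF y(1)]]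
              by (simp add: M.P.a_assoc M.P.r_neg)
        finally have "s n z \<in> coboundaries M n" using b(1) by simp
        moreover have "z \<in> cocycles Z n" unfolding z_def
            by (rule Z.cocycles_add[OF x(1) Z.cocycles_minus[OF y(1)]])
        ultimately have "z \<in> coboundaries Z n" using * by blast
        moreover have "x = z \<oplus>\<^bsub>part Z n\<^esub> y" unfolding z_def using xc
            by (simp add: Z.P.a_assoc Z.P.l_neg)
        ultimately show "S = T" unfolding x y using Z.coh_class_eq_iff[OF xc] by blast
      qed
      show "?f ` carrier (cohomology Z n) = carrier (cohomology M n)"
      proof (intro subset_antisym subsetI)
        fix T assume "T \<in> ?f ` carrier (cohomology Z n)"
        then show "T \<in> carrier (cohomology M n)"
          unfolding Z.carrier_cohomology M.carrier_cohomology using f sc by auto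
      next
        fix T assume "T \<in> carrier (cohomology M n)"
        then obtain y where y: "y \<in> cocycles M n" "T = M.coh_class n y"
            unfolding M.carrier_cohomology by blast
        then obtain x b where x: "x \<in> cocycles Z n" "b \<in> coboundaries M n" "y = b \<oplus>\<^bsub>part M n\<^esub> s n x"
            using * by blast
        have "T = M.coh_class n (s n x)"
          unfolding y(2) using M.coh_class_eq_iff[OF closed(2)[OF y(1)] closed(2)[OF sc[OF x(1)]]] x
              by blast
        also have "\<dots> = ?f (Z.coh_class n x)" using f[OF x(1)] by simp
        finally show "T \<in> ?f ` carrier (cohomology Z n)" unfolding Z.carrier_cohomology using x(1)
            by blast
      qed
    qed
    ultimately show "?f \<in> iso (cohomology Z n) (cohomology M n)" by (simp add: iso_def)
  qed
qed

text \<open>The cone of a quasi-isomorphism is acyclic. Injectivity gives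
  \<open>z = dif Z n z0\<close>; then \<open>x\<close> minus the image of \<open>z0\<close> is a
  cocycle, and surjectivity corrects \<open>z0\<close> by a cocycle \<open>w\<close>.\<close>

lemma quasi_iso_rel_exact:
  assumes Z: "dg_module A Z" and M: "dg_module A M" and s: "chain_map A Z M s"
      and q: "quasi_iso Z M s"
  shows "rel_exact Z M s n"
  unfolding rel_exact_def
proof (intro ballI impI)
  interpret Z: dg_module A Z by (rule Z)
  interpret M: dg_module A M by (rule M)
  note q' = q[unfolded quasi_iso_iff[OF Z M s], rule_format]
  fix x z assume x: "x \<in> carrier (part M n)" and z: "z \<in> carrier (part Z (n + 1))"
    and "dif Z (n + 1) z = \<zero>\<^bsub>part Z (n + 1 + 1)\<^esub> \<and> s (n + 1) z = dif M n x"
  then have dz: "dif Z (n + 1) z = \<zero>\<^bsub>part Z (n + 1 + 1)\<^esub>" and sz: "s (n + 1) z = dif M n x" by auto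
  have "z \<in> cocycles Z (n + 1)" using z dz by (simp add: Z.cocycles_iff)
  moreover have "s (n + 1) z \<in> coboundaries M (n + 1)"
    unfolding sz M.coboundaries_iff using x by auto
  ultimately have "z \<in> coboundaries Z (n + 1)" using q' by blast
  then obtain z0 where z0: "z0 \<in> carrier (part Z n)" "z = dif Z n z0" unfolding Z.coboundaries_iff
      by auto
  have sz0: "s n z0 \<in> carrier (part M n)" by (rule chain_map_closed[OF s z0(1)])
  define y where "y = x \<oplus>\<^bsub>part M n\<^esub> \<ominus>\<^bsub>part M n\<^esub> s n z0"
  have "y \<in> cocycles M n"
    unfolding y_def M.cocycles_iff using x sz0 sz z0 chain_map_dif[OF s z0(1), of "n + 1"]
        M.dif_closed[OF x]
    by (simp add: M.dif_add[of _ _ _ "n + 1"] M.dif_minus[of _ _ "n + 1"] M.P.r_neg)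
  then obtain w b where w: "w \<in> cocycles Z n" "b \<in> coboundaries M n" "y = b \<oplus>\<^bsub>part M n\<^esub> s n w"
    using q' by blast
  then obtain x' where x': "x' \<in> carrier (part M (n - 1))" "b = dif M (n - 1) x'"
      unfolding M.coboundaries_iff by blast
  have wc: "w \<in> carrier (part Z n)" "dif Z n w = \<zero>\<^bsub>part Z (n + 1)\<^esub>" using w(1)
      by (auto simp: Z.cocycles_iff)
  have b: "b \<in> carrier (part M n)" by (rule M.coboundaries_closed[OF w(2)])
  have sw: "s n w \<in> carrier (part M n)" by (rule chain_map_closed[OF s wc(1)])
  have "x = y \<oplus>\<^bsub>part M n\<^esub> s n z0" unfolding y_def using x sz0 by (simp add: M.P.a_assoc M.P.l_neg)
  also have "\<dots> = s n (z0 \<oplus>\<^bsub>part Z n\<^esub> w) \<oplus>\<^bsub>part M n\<^esub> b"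
    unfolding w(3) using lin_map_add[OF chain_map_lin[OF s] z0(1) wc(1), of n] sz0 sw b
        by (simp add: M.P.a_ac)
  finally have "x = s n (z0 \<oplus>\<^bsub>part Z n\<^esub> w) \<oplus>\<^bsub>part M n\<^esub> dif M (n - 1) x'" unfolding x'(2) .
  moreover have "z = dif Z n (z0 \<oplus>\<^bsub>part Z n\<^esub> w)"
    using z0 wc z by (simp add: Z.dif_add[of _ _ _ "n + 1"])
  ultimately show "\<exists>z'\<in>carrier (part Z n). \<exists>x'\<in>carrier (part M (n - 1)). z = dif Z n z' \<and> x =
      s n z' \<oplus>\<^bsub>part M n\<^esub> dif M (n - 1) x'"
    using x'(1) Z.P.a_closed[OF z0(1) wc(1)] by blast
qed

section \<open>Homotopy of chain maps\<close>

lemma homotopic_iff: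
  "homotopic A M N f g \<longleftrightarrow> (\<exists>h. lin_map A M N (- 1) h \<and> (\<forall>n. \<forall>x\<in>carrier (part M n).
    f n x = g n x \<oplus>\<^bsub>part N n\<^esub> (dif N (n - 1) (h n x) \<oplus>\<^bsub>part N n\<^esub> h (n + 1) (dif M n x))))"
  unfolding homotopic_def lin_map_def by (rule arg_cong[where f = Ex], rule ext) auto

lemma homotopy_closed:
  assumes "dg_module A M" "dg_module A N" "lin_map A M N (- 1) h" "x \<in> carrier (part M n)"
  shows "h n x \<in> carrier (part N (n - 1))" "dif N (n - 1) (h n x) \<in> carrier (part N n)"
    "h (n + 1) (dif M n x) \<in> carrier (part N n)"
proof -
  show 1: "h n x \<in> carrier (part N (n - 1))" using lin_map_closed[OF assms(3,4)] by simp
  show "dif N (n - 1) (h n x) \<in> carrier (part N n)" using dg_module.dif_closed'[OF assms(2) 1]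
      by simp
  show "h (n + 1) (dif M n x) \<in> carrier (part N n)"
    using lin_map_closed[OF assms(3) dg_module.dif_closed[OF assms(1,4)]] by simp
qed

lemma homotopic_sym:
  assumes M: "dg_module A M" and N: "dg_module A N" and f: "chain_map A M N f"
      and g: "chain_map A M N g"
    and fg: "homotopic A M N f g"
  shows "homotopic A M N g f"
proof -
  interpret N: dg_module A N by (rule N)
  obtain h where h: "lin_map A M N (- 1) h" and eq: "\<And>n x. x \<in> carrier (part M n) \<Longrightarrow>
    f n x = g n x \<oplus>\<^bsub>part N n\<^esub> (dif N (n - 1) (h n x) \<oplus>\<^bsub>part N n\<^esub> h (n + 1) (dif M n x))"
    using fg unfolding homotopic_iff by blast
  show ?thesis
    unfolding homotopic_iff
  proof (intro exI conjI allI ballI)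
    show "lin_map A M N (- 1) (\<lambda>n x. \<ominus>\<^bsub>part N (n - 1)\<^esub> h n x)"
      using lin_map_koszul_sign_map[OF N h, of 1] by (simp add: koszul_sign_def)
    fix n x assume x: "x \<in> carrier (part M n)"
    note c = homotopy_closed[OF M N h x] chain_map_closed[OF g x]
    have "dif N (n - 1) (\<ominus>\<^bsub>part N (n - 1)\<^esub> h n x) = \<ominus>\<^bsub>part N n\<^esub> dif N (n - 1) (h n x)"
      using c by (simp add: N.dif_minus[of _ _ n])
    moreover have "a = (a \<oplus>\<^bsub>part N n\<^esub> (b \<oplus>\<^bsub>part N n\<^esub> c)) \<oplus>\<^bsub>part N n\<^esub> (\<ominus>\<^bsub>part N n\<^esub> b \<oplus>\<^bsub>part N n\<^esub>
        \<ominus>\<^bsub>part N n\<^esub> c)"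
      if "a \<in> carrier (part N n)" "b \<in> carrier (part N n)" "c \<in> carrier (part N n)" for a b c
    proof -
      have "\<ominus>\<^bsub>part N n\<^esub> b \<oplus>\<^bsub>part N n\<^esub> \<ominus>\<^bsub>part N n\<^esub> c = \<ominus>\<^bsub>part N n\<^esub> (b \<oplus>\<^bsub>part N n\<^esub> c)"
        using that by (simp add: N.P.minus_add)
      then show ?thesis using that by (simp add: N.P.a_assoc N.P.r_neg)
    qed
    ultimately show "g n x = f n x \<oplus>\<^bsub>part N n\<^esub> (dif N (n - 1) (\<ominus>\<^bsub>part N (n - 1)\<^esub> h n x) \<oplus>\<^bsub>part N n\<^esub>
      \<ominus>\<^bsub>part N (n + 1 - 1)\<^esub> h (n + 1) (dif M n x))"
      unfolding eq[OF x] using c by simp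
  qed
qed

lemma homotopic_trans:
  assumes M: "dg_module A M" and N: "dg_module A N" and k: "chain_map A M N k"
    and fg: "homotopic A M N f g" and gk: "homotopic A M N g k"
  shows "homotopic A M N f k"
proof -
  interpret N: dg_module A N by (rule N)
  obtain h where h: "lin_map A M N (- 1) h" and eq: "\<And>n x. x \<in> carrier (part M n) \<Longrightarrow>
    f n x = g n x \<oplus>\<^bsub>part N n\<^esub> (dif N (n - 1) (h n x) \<oplus>\<^bsub>part N n\<^esub> h (n + 1) (dif M n x))"
    using fg unfolding homotopic_iff by blast
  obtain h' where h': "lin_map A M N (- 1) h'" and eq': "\<And>n x. x \<in> carrier (part M n) \<Longrightarrow>
    g n x = k n x \<oplus>\<^bsub>part N n\<^esub> (dif N (n - 1) (h' n x) \<oplus>\<^bsub>part N n\<^esub> h' (n + 1) (dif M n x))"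
    using gk unfolding homotopic_iff by blast
  show ?thesis
    unfolding homotopic_iff
  proof (intro exI conjI allI ballI)
    show "lin_map A M N (- 1) (\<lambda>n x. h n x \<oplus>\<^bsub>part N (n - 1)\<^esub> h' n x)"
      using lin_map_plus[OF N h h'] by simp
    fix n x assume x: "x \<in> carrier (part M n)"
    note c = homotopy_closed[OF M N h x] homotopy_closed[OF M N h' x] chain_map_closed[OF k x]
    show "f n x = k n x \<oplus>\<^bsub>part N n\<^esub> (dif N (n - 1) (h n x \<oplus>\<^bsub>part N (n - 1)\<^esub> h' n x) \<oplus>\<^bsub>part N n\<^esub>
      (h (n + 1) (dif M n x) \<oplus>\<^bsub>part N (n + 1 - 1)\<^esub> h' (n + 1) (dif M n x)))"
      unfolding eq[OF x] eq'[OF x] using c by (simp add: N.dif_add[of _ _ _ n] N.P.a_ac)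
  qed
qed

text \<open>On cocycles, homotopic maps differ by coboundaries.\<close>

lemma quasi_iso_homotopic:
  assumes M: "dg_module A M" and N: "dg_module A N" and f: "chain_map A M N f"
      and g: "chain_map A M N g"
    and h: "homotopic A M N f g" and q: "quasi_iso M N g"
  shows "quasi_iso M N f"
proof -
  interpret M: dg_module A M by (rule M)
  interpret N: dg_module A N by (rule N)
  have diff: "\<exists>b\<in>coboundaries N n. f n x = b \<oplus>\<^bsub>part N n\<^esub> g n x" if x: "x \<in> cocycles M n"
    and h: "homotopic A M N f g" and g: "chain_map A M N g" for f g n x
  proof -
    obtain h where h: "lin_map A M N (- 1) h" and eq: "\<And>n x. x \<in> carrier (part M n) \<Longrightarrow>
      f n x = g n x \<oplus>\<^bsub>part N n\<^esub> (dif N (n - 1) (h n x) \<oplus>\<^bsub>part N n\<^esub> h (n + 1) (dif M n x))"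
      using h unfolding homotopic_iff by blast
    have x': "x \<in> carrier (part M n)" "dif M n x = \<zero>\<^bsub>part M (n + 1)\<^esub>" using x
        by (auto simp: M.cocycles_iff)
    note c = homotopy_closed[OF M N h x'(1)] chain_map_closed[OF g x'(1)]
    have "h (n + 1) (dif M n x) = \<zero>\<^bsub>part N n\<^esub>"
      unfolding x'(2) using lin_map_zero[OF M N h, of n "n + 1"] by simp
    then have "f n x = dif N (n - 1) (h n x) \<oplus>\<^bsub>part N n\<^esub> g n x"
      using eq[OF x'(1)] c by (simp add: N.P.a_comm)
    moreover have "dif N (n - 1) (h n x) \<in> coboundaries N n"
      unfolding N.coboundaries_iff by (rule bexI[OF refl c(1)])
    ultimately show ?thesis by (rule bexI)
  qed
  have h': "homotopic A M N g f" by (rule homotopic_sym[OF M N f g h])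
  show ?thesis
    unfolding quasi_iso_iff[OF M N f]
  proof (intro allI conjI ballI impI)
    fix n y assume "y \<in> cocycles N n"
    then obtain x b where x: "x \<in> cocycles M n" "b \<in> coboundaries N n" "y = b \<oplus>\<^bsub>part N n\<^esub> g n x"
      using q unfolding quasi_iso_iff[OF M N g] by blast
    obtain b' where b': "b' \<in> coboundaries N n" "g n x = b' \<oplus>\<^bsub>part N n\<^esub> f n x"
        using diff[OF x(1) h' f] by blast
    have "y = (b \<oplus>\<^bsub>part N n\<^esub> b') \<oplus>\<^bsub>part N n\<^esub> f n x"
      unfolding x(3) b'(2) using N.coboundaries_closed[OF x(2)] N.coboundaries_closed[OF b'(1)]
        chain_map_closed[OF f M.cocycles_closed[OF x(1)]] by (simp add: N.P.a_assoc)
    then show "\<exists>x\<in>cocycles M n. \<exists>b\<in>coboundaries N n. y = b \<oplus>\<^bsub>part N n\<^esub> f n x"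
      using x(1) N.coboundaries_add[OF x(2) b'(1)] by blast
  next
    fix n x assume x: "x \<in> cocycles M n" and "f n x \<in> coboundaries N n"
    moreover obtain b' where "b' \<in> coboundaries N n" "g n x = b' \<oplus>\<^bsub>part N n\<^esub> f n x"
        using diff[OF x h' f] by blast
    ultimately have "g n x \<in> coboundaries N n" using N.coboundaries_add by simp
    then show "x \<in> coboundaries M n" using q x unfolding quasi_iso_iff[OF M N g] by blast
  qed
qed

section \<open>Roofs and projective dimension\<close>

context directed_dg_algebra
begin

text \<open>The long exact sequence by hand: a cocycle \<open>y\<close> of \<open>M\<close> is the
  cocycle \<open>(y, 0)\<close> of the fiber one degree higher, and a cocycle \<open>x\<close> of
  \<open>P\<close> whose image bounds \<open>m\<close> is the cocycle \<open>(m, x)\<close>.\<close>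

lemma exact_fiber_quasi_iso:
  assumes M: "dg_module A M" and P: "dg_module A P" and g: "chain_map A P M g"
    and van: "\<And>n v. v \<in> V \<Longrightarrow> vanish (fiber M P g) n v"
  shows "quasi_iso P M g"
proof -
  interpret M: dg_module A M by (rule M)
  interpret P: dg_module A P by (rule P)
  note exact = exact_of_vanish[OF fiber_dg_module[OF M P g] van]
  have g0: "g n \<zero>\<^bsub>part P n\<^esub> = \<zero>\<^bsub>part M n\<^esub>" for n
    using lin_map_zero[OF P M chain_map_lin[OF g]] by simp
  have minus_zero: "\<ominus>\<^bsub>part M n\<^esub> \<zero>\<^bsub>part M n\<^esub> = \<zero>\<^bsub>part M n\<^esub>" for n
    by (rule M.P.minus_equality) auto
  show ?thesis
    unfolding quasi_iso_iff[OF P M g]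
  proof (intro allI conjI ballI impI)
    fix n y assume "y \<in> cocycles M n"
    then have y: "y \<in> carrier (part M n)" "dif M n y = \<zero>\<^bsub>part M (n + 1)\<^esub>"
        by (auto simp: M.cocycles_iff)
    have "\<exists>z\<in>carrier (part (fiber M P g) (n + 1 - 1)). (y, \<zero>\<^bsub>part P (n + 1)\<^esub>) =
        dif (fiber M P g) (n + 1 - 1) z"
      by (rule exact) (use y in \<open>simp_all add: g0 minus_zero P.dif_zero add.commute\<close>)
    then obtain m p where m: "m \<in> carrier (part M (n - 1))" and p: "p \<in> carrier (part P n)"
      and eq: "y = \<ominus>\<^bsub>part M n\<^esub> dif M (n - 1) m \<oplus>\<^bsub>part M n\<^esub> g n p" "dif P n p = \<zero>\<^bsub>part P (n + 1)\<^esub>"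
          by auto
    have "p \<in> cocycles P n" using p eq(2) by (simp add: P.cocycles_iff)
    moreover have "\<ominus>\<^bsub>part M n\<^esub> dif M (n - 1) m \<in> coboundaries M n"
      using M.coboundaries_minus m unfolding M.coboundaries_iff by blast
    ultimately show "\<exists>x\<in>cocycles P n. \<exists>b\<in>coboundaries M n. y = b \<oplus>\<^bsub>part M n\<^esub> g n x"
      using eq(1) by blast
  next
    fix n x assume "x \<in> cocycles P n" and "g n x \<in> coboundaries M n"
    then obtain m where x: "x \<in> carrier (part P n)" "dif P n x = \<zero>\<^bsub>part P (n + 1)\<^esub>"
      and m: "m \<in> carrier (part M (n - 1))" "g n x = dif M (n - 1) m"
      by (auto simp: P.cocycles_iff M.coboundaries_iff)
    have "\<exists>z\<in>carrier (part (fiber M P g) (n - 1)). (m, x) = dif (fiber M P g) (n - 1) z"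
      by (rule exact) (use x m M.dif_closed[OF m(1)] in \<open>simp_all add: M.P.l_neg\<close>)
    then show "x \<in> coboundaries P n" unfolding P.coboundaries_iff by auto
  qed
qed

text \<open>The resolution \<open>P\<close> of \<open>M\<close> dominates any two roofs: it maps to
  both tops compatibly with \<open>g\<close> up to homotopy, and both composites to the shift of
  \<open>N\<close> are null-homotopic.\<close>

lemma roofs_equiv:
  fixes M N :: "('a, 'm) dg_module"
  assumes inf: "infinite (UNIV :: 'm set)" and A: "carrier A \<lesssim> (UNIV :: 'm set)"
    and l: "\<And>v. v \<in> V \<Longrightarrow> ht v \<le> l"
    and M: "M \<in> heart A" and N: "N \<in> heart A" and i: "int (l * (d + 1)) < i"
  shows "roof_equiv A M (shift N i) = roofs A M (shift N i) \<times> roofs A M (shift N i)"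
proof
  show "roof_equiv A M (shift N i) \<subseteq> roofs A M (shift N i) \<times> roofs A M (shift N i)"
    unfolding roof_equiv_def by blast
  have dM: "dg_module A M" and dN: "dg_module A N" using M N unfolding heart_def by auto
  interpret M: dg_module A M by (rule dM)
  interpret N: dg_module A N by (rule dN)
  let ?Y = "shift N i"
  have dY: "dg_module A ?Y" by (rule shift_dg_module[OF dN])
  interpret Y: dg_module A ?Y by (rule dY)
  have M0: "\<exists>y\<in>carrier (part M (n - 1)). x = dif M (n - 1) y"
    if "n < 0" "x \<in> carrier (part M n)" "dif M n x = \<zero>\<^bsub>part M (n + 1)\<^esub>" for n x
    using that M M.trivial_cohomologyD[of n x] unfolding heart_def M.cocycles_iff M.coboundaries_iff
        by auto
  have "\<exists>(P :: ('a, 'm) dg_module) g. dg_module A P \<and> chain_map A P M g \<and>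
      (\<forall>n. \<forall>v\<in>V. vanish (fiber M P g) n v) \<and> lifts_from_degree P (- int (l * (d + 1)))"
    by (rule resolution[where l = l, OF inf A dM M0 l]) (assumption | blast)+
  then obtain P :: "('a, 'm) dg_module" and g where P: "dg_module A P" and g: "chain_map A P M g"
    and van: "\<And>n v. v \<in> V \<Longrightarrow> vanish (fiber M P g) n v"
        and lift: "lifts_from_degree P (- int (l * (d + 1)))"
    by blast
  interpret P: dg_module A P by (rule P)
  have gq: "quasi_iso P M g" by (rule exact_fiber_quasi_iso[OF dM P g van])
  let ?O = "zero_module undefined :: ('a, 'm) dg_module"
  have O: "dg_module A ?O" by (rule zero_module_dg_module[OF M.algebra])
  have zO: "chain_map A ?O ?Y (\<lambda>n x. \<zero>\<^bsub>part ?Y n\<^esub>)" by (rule zero_chain_map[OF O dY])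
  \<comment> \<open>For the zero source, relative exactness in degree \<open>n\<close> is the
    vanishing of the cohomology of the target in degree \<open>n\<close>.\<close>
  have ex: "rel_exact ?O ?Y (\<lambda>n x. \<zero>\<^bsub>part ?Y n\<^esub>) n" if "n \<ge> - int (l * (d + 1))" for n
    unfolding rel_exact_def
  proof (intro ballI impI)
    fix x z assume x: "x \<in> carrier (part ?Y n)" and z: "z \<in> carrier (part ?O (n + 1))"
      and "dif ?O (n + 1) z = \<zero>\<^bsub>part ?O (n + 1 + 1)\<^esub> \<and> \<zero>\<^bsub>part ?Y (n + 1)\<^esub> = dif ?Y n x"
    then have "koszul_sign (part N (n + 1 + i)) i (dif N (n + i) x) = \<zero>\<^bsub>part N (n + 1 + i)\<^esub>"
        and xN: "x \<in> carrier (part N (n + i))"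
      by simp_all
    then have "koszul_sign (part N (n + 1 + i)) i (koszul_sign (part N (n + 1 + i)) i (dif N (n + i)
        x)) = \<zero>\<^bsub>part N (n + 1 + i)\<^esub>"
      by simp
    then have "dif N (n + i) x = \<zero>\<^bsub>part N (n + i + 1)\<^esub>"
      using N.dif_closed'[OF xN, of "n + 1 + i"] by (simp add: ac_simps)
    then have "x \<in> cocycles N (n + i)" using xN by (simp add: N.cocycles_iff)
    \<comment> \<open>Here the bound on \<open>i\<close> enters: \<open>n \<ge> - l (d + 1)\<close>
      and \<open>i > l (d + 1)\<close> give \<open>n + i > 0\<close>.\<close>
    moreover have "n + i \<noteq> 0" using that i by linarith
    ultimately obtain y where y: "y \<in> carrier (part N (n + i - 1))" "x = dif N (n + i - 1) y"
      using N N.trivial_cohomologyD unfolding heart_def N.coboundaries_iff by blast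
    define y' where "y' = koszul_sign (part N (n + i - 1)) i y"
    have "y' \<in> carrier (part ?Y (n - 1))" unfolding y'_def using y
        by (simp add: add_diff_eq add.commute diff_add_eq)
    moreover have "x = dif ?Y (n - 1) y'"
    proof -
      have e: "n - 1 + i = n + i - 1" "n - 1 + 1 + i = n + i" by simp_all
      show ?thesis
        unfolding shift_simps e y'_def using y N.dif_koszul_sign[OF y(1), of "n + i" i]
            N.dif_closed'[OF y(1), of "n + i"] by simp
    qed
    moreover have "\<zero>\<^bsub>part ?Y n\<^esub> \<oplus>\<^bsub>part ?Y n\<^esub> x = x" using x by (simp del: shift_simps)
    ultimately show "\<exists>z'\<in>carrier (part ?O n). \<exists>x'\<in>carrier (part ?Y (n - 1)).
      z = dif ?O n z' \<and> x = \<zero>\<^bsub>part ?Y n\<^esub> \<oplus>\<^bsub>part ?Y n\<^esub> dif ?Y (n - 1) x'"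
      using z by (simp del: shift_simps) metis
  qed
  have null: "homotopic A P ?Y \<phi> (\<lambda>n x. \<zero>\<^bsub>part ?Y n\<^esub>)" if \<phi>: "chain_map A P ?Y \<phi>" for \<phi>
  proof -
    have "lifts A P ?O ?Y (\<lambda>n x. \<zero>\<^bsub>part ?Y n\<^esub>)"
      using lift O dY zO ex unfolding lifts_from_degree_def by blast
    then show ?thesis using \<phi> unfolding lifts_def homotopic_iff by blast
  qed
  have lift_g: "\<exists>u. chain_map A P Z u \<and> homotopic A P M g (\<lambda>n. s n \<circ> u n)"
    if Z: "dg_module A Z" and s: "chain_map A Z M s" and q: "quasi_iso Z M s"
        for Z :: "('a, 'm) dg_module" and s
  proof -
    \<comment> \<open>A quasi-isomorphism is relatively exact in every degree, whatever the degrees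
      of the cells.\<close>
    have "lifts A P Z M s"
      using lift Z dM s quasi_iso_rel_exact[OF Z dM s q] unfolding lifts_from_degree_def by blast
    then show ?thesis using g unfolding lifts_def homotopic_iff comp_def by blast
  qed
  show "roofs A M ?Y \<times> roofs A M ?Y \<subseteq> roof_equiv A M ?Y"
  proof (rule subsetI, clarify)
    fix Z s f Z' s' f'
    assume r: "(Z, s, f) \<in> roofs A M ?Y" and r': "(Z', s', f') \<in> roofs A M ?Y"
    have Z: "dg_module A Z" "chain_map A Z M s" "quasi_iso Z M s" "chain_map A Z ?Y f"
      and Z': "dg_module A Z'" "chain_map A Z' M s'" "quasi_iso Z' M s'" "chain_map A Z' ?Y f'"
      using r r' unfolding roofs_def dg_hom_iff_chain_map by auto
    obtain u where u: "chain_map A P Z u" "homotopic A P M g (\<lambda>n. s n \<circ> u n)"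
        using lift_g[OF Z(1-3)] by blast
    obtain v where v: "chain_map A P Z' v" "homotopic A P M g (\<lambda>n. s' n \<circ> v n)"
        using lift_g[OF Z'(1-3)] by blast
    have su: "chain_map A P M (\<lambda>n. s n \<circ> u n)" and sv: "chain_map A P M (\<lambda>n. s' n \<circ> v n)"
      and fu: "chain_map A P ?Y (\<lambda>n. f n \<circ> u n)" and fv: "chain_map A P ?Y (\<lambda>n. f' n \<circ> v n)"
      unfolding comp_def using chain_map_comp[OF u(1)] chain_map_comp[OF v(1)] Z Z' by blast+
    have gs: "homotopic A P M (\<lambda>n. s n \<circ> u n) g" by (rule homotopic_sym[OF P dM g su u(2)])
    have z: "chain_map A P ?Y (\<lambda>n x. \<zero>\<^bsub>part ?Y n\<^esub>)" by (rule zero_chain_map[OF P dY])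
    have "quasi_iso P M (\<lambda>n. s n \<circ> u n)" by (rule quasi_iso_homotopic[OF P dM su g gs gq])
    moreover have "homotopic A P M (\<lambda>n. s n \<circ> u n) (\<lambda>n. s' n \<circ> v n)"
      by (rule homotopic_trans[OF P dM sv gs v(2)])
    moreover have "homotopic A P ?Y (\<lambda>n. f n \<circ> u n) (\<lambda>n. f' n \<circ> v n)"
      by (rule homotopic_trans[OF P dY fv null[OF fu] homotopic_sym[OF P dY fv z null[OF fv]]])
    ultimately show "((Z, s, f), (Z', s', f')) \<in> roof_equiv A M ?Y"
      unfolding roof_equiv_def dg_hom_iff_chain_map using r r' P u(1) v(1) by blast
  qed
qed

lemma pdim_heart_le:
  fixes M :: "('a, 'm) dg_module"
  assumes inf: "infinite (UNIV :: 'm set)" and A: "carrier A \<lesssim> (UNIV :: 'm set)"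
    and l: "\<And>v. v \<in> V \<Longrightarrow> ht v \<le> l" and M: "M \<in> heart A"
  shows "pdim A M \<le> ereal (real (l * (d + 1)))"
  unfolding pdim_def
proof (rule Inf_lower, intro CollectI conjI allI impI ballI)
  have "ereal (real (l * (d + 1))) = ereal (of_int (int (l * (d + 1))))" by simp
  then show "ereal (real (l * (d + 1))) \<in> {- \<infinity>, \<infinity>} \<union> range (\<lambda>i :: int. ereal (of_int i))" by blast
  fix i :: int and N :: "('a, 'm) dg_module"
  assume "ereal (real (l * (d + 1))) < ereal (of_int i)" and N: "N \<in> heart A"
  then have i: "int (l * (d + 1)) < i" by (simp only: less_ereal.simps)
  have dM: "dg_module A M" and dN: "dg_module A N" using M N unfolding heart_def by auto
  interpret M: dg_module A M by (rule dM)
  have dY: "dg_module A (shift N i)" by (rule shift_dg_module[OF dN])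
  have eq: "roof_equiv A M (shift N i) = roofs A M (shift N i) \<times> roofs A M (shift N i)"
    by (rule roofs_equiv[OF inf A _ M N i]) (rule l)
  have id: "chain_map A M M (\<lambda>n. id)" unfolding chain_map_def by (auto intro!: lin_mapI)
  have "quasi_iso M M (\<lambda>n. id)"
    unfolding quasi_iso_iff[OF dM dM id]
  proof (intro allI conjI ballI impI)
    fix n y assume y: "y \<in> cocycles M n"
    have "y = \<zero>\<^bsub>part M n\<^esub> \<oplus>\<^bsub>part M n\<^esub> id y" using M.cocycles_closed[OF y] by simp
    then show "\<exists>x\<in>cocycles M n. \<exists>b\<in>coboundaries M n. y = b \<oplus>\<^bsub>part M n\<^esub> id x"
      using y M.coboundaries_zero by blast
  qed simp
  \<comment> \<open>The zero roof exists, so the set of roofs is nonempty and its quotient by the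
    full relation has exactly one element.\<close>
  then have z: "(M, \<lambda>n. id, \<lambda>n x. \<zero>\<^bsub>part (shift N i) n\<^esub>) \<in> roofs A M (shift N i)"
    unfolding roofs_def dg_hom_iff_chain_map using dM id zero_chain_map[OF dM dY] by auto
  have "roof_equiv A M (shift N i) `` {r} = roofs A M (shift N i)" if "r \<in> roofs A M (shift N i)"
      for r
    unfolding eq using that by blast
  then show "derived_hom A M (shift N i) = {derived_zero A M (shift N i)}"
    unfolding derived_hom_def derived_zero_def quotient_def using z by auto
qed

end

theorem proposition4p5:
  fixes Q :: "('v, 'e) pre_digraph"
    and I :: "('v \<times> 'e list \<Rightarrow> 'k::field) set"
    and A :: "('k, ('v \<times> 'e list \<Rightarrow> 'k) set) dg_algebra"
    and d :: nat
  assumes "fin_digraph Q"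
    and "admissible_ideal Q I"
    and "module.truncate A = bound_quiver_algebra Q I"
    and "dg_algebra A"
    and "connective A"
    and "concentrated_in A {- int d..0}"
    and "\<nexists>p. pre_digraph.cycle Q p"
    and "infinite (UNIV :: 'm set)"
    and "(UNIV :: 'k set) \<lesssim> (UNIV :: 'm set)"
  shows "gl_dim TYPE('m) A \<le> ereal (real (max_path_length Q * (d + 1)))"
proof -
  have I: "ideal I (path_algebra Q)" using assms(2) unfolding admissible_ideal_def by blast
  interpret bound_quiver Q I A
    by (intro bound_quiver.intro acyclic_quiver.intro acyclic_quiver_axioms.intro
        bound_quiver_axioms.intro)
      (use assms I in auto)
  interpret nonpositive_dg_algebra A d
    by (unfold_locales) (use assms(6) in \<open>auto simp: concentrated_in_def\<close>)
  \<comment> \<open>The classes of the trivial paths supply the triangularity, the degree 0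
    idempotents \<open>e\<close> inherit it.\<close>
  obtain e where e: "directed_dg_algebra A (verts Q) e height d"
  proof (rule directed_dg_algebra_exists[of "verts Q" \<epsilon> height])
    show "finite (verts Q)" by (rule finite_verts)
    show "\<epsilon> v \<in> carrier A" if "v \<in> verts Q" for v
      unfolding \<epsilon>_def by (rule cls_closed[OF vertex_path_closed[OF that]])
  qed (use \<epsilon>_mult \<epsilon>_sum \<epsilon>_triangular in auto)
  show ?thesis
    unfolding gl_dim_def
    by (rule SUP_least)
      (rule directed_dg_algebra.pdim_heart_le[OF e assms(8) carrier_lepoll[OF assms(8,9)]
          height_le])
qed

end
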